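(* Let $d\in\mathbb{N}$, $0<p\le u<\infty$ and $0<q\le\infty$. If $1\le r<\infty$, then there exists a positive constant $c$ such that $$\left(\frac1{|Q|}\int_Q|f(x)|^r\,dx\right)^{\frac1r}\le c\,(1+|Q|)^{-\frac{\min(1,\frac pr)}{u}}\log\left(e+|Q|^{-1}\right)\|f|\mathcal{E}^{\frac du}_{u,p,q}(\mathbb{R}^d)\|$$ holds for all dyadic cubes $Q$ and all $f\in\mathcal{E}^{\frac du}_{u,p,q}(\mathbb{R}^d)$.
   Context: Dyadic cubes: $\mathcal{Q}=\{Q_{j,k}=2^{-j}([0,1)^d+k): j\in\mathbb{Z},\ k\in\mathbb{Z}^d\}$; $|\cdot|$ is Lebesgue measure. Morrey space: for $0<p\le u<\infty$, $\mathcal{M}_{u,p}(\mathbb{R}^d)$ is the set of all $f\in L_p^{\mathrm{loc}}(\mathbb{R}^d)$ with $\|f|\mathcal{M}_{u,p}(\mathbb{R}^d)\|=\sup_{Q\in\mathcal{Q}}|Q|^{\frac1u-\frac1p}\left(\int_Q|f(y)|^p\,dy\right)^{1/p}<\infty$. Resolution of unity: $\varphi_0=\varphi\in\mathcal{S}(\mathbb{R}^d)$ with $\operatorname{supp}\varphi\subset\{|x|\le 2\}$ and $\varphi(x)=1$ for $|x|\le1$; $\varphi_j(x)=\varphi(2^{-j}x)-\varphi(2^{-j+1}x)$ for $j\in\mathbb{N}$. $\mathcal{F}$ is the Fourier transform on $\mathcal{S}'(\mathbb{R}^d)$. Triebel-Lizorkin-Morrey space: for $0<p\le u<\infty$, $0<q\le\infty$,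 $s\in\mathbb{R}$, $\mathcal{E}^s_{u,p,q}(\mathbb{R}^d)$ is the set of all $f\in\mathcal{S}'(\mathbb{R}^d)$ with $\|f|\mathcal{E}^s_{u,p,q}(\mathbb{R}^d)\|=\left\|\left(\sum_{j=0}^\infty 2^{jsq}|\mathcal{F}^{-1}(\varphi_j\mathcal{F}f)(\cdot)|^q\right)^{1/q}\big|\mathcal{M}_{u,p}(\mathbb{R}^d)\right\|<\infty$ (usual modification if $q=\infty$). Part of the assertion is that each such $f$ is (identified with) a locally integrable function. *)

theory Defs
  imports "HOL-Analysis.Analysis"
begin

section \<open>Dyadic cubes and Morrey norms\<close>

definition dyadic_cube :: "int \<Rightarrow> int ^ 'd \<Rightarrow> (real ^ 'd) set" where
  "dyadic_cube j k =
     (\<lambda>y. (2 powi (- j)) *\<^sub>R (y + (\<chi> i. of_int (k $ i)))) ` {y. \<forall>i. 0 \<le> y $ i \<and> y $ i < 1}"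

definition dyadic_cubes :: "(real ^ 'd) set set" where
  "dyadic_cubes = {dyadic_cube j k | j k. True}"

text \<open>Powers of extended nonnegative reals; only used with exponents \<open>a > 0\<close>.\<close>

definition enn_powr :: "ennreal \<Rightarrow> real \<Rightarrow> ennreal" where
  "enn_powr x a = (if x = \<infinity> then \<infinity> else ennreal (enn2real x powr a))"

text \<open>The Morrey quasi-norm of \<open>\<bar>f\<bar>\<close>, as a functional on \<open>[0,\<infinity>]\<close>-valued functions. For measurable
  \<open>f\<close>, finiteness already implies \<open>f \<in> L\<^sub>p\<close> locally, since every compact set is covered by finitely
  many dyadic cubes.\<close>

definition morrey_norm :: "real \<Rightarrow> real \<Rightarrow> (real ^ 'd \<Rightarrow> ennreal) \<Rightarrow> ennreal" where
  "morrey_norm u p f =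
     (SUP Q\<in>dyadic_cubes. ennreal (measure lebesgue Q powr (1 / u - 1 / p)) *
        enn_powr (\<integral>\<^sup>+x\<in>Q. enn_powr (f x) p \<partial>lebesgue) (1 / p))"

section \<open>Schwartz functions\<close>

text \<open>A list \<open>[i\<^sub>1,\<dots>,i\<^sub>n]\<close> of coordinates stands for the derivative
  \<open>\<partial>\<^sub>i\<^sub>1 \<dots> \<partial>\<^sub>i\<^sub>n\<close>; for smooth functions the order is irrelevant, so that these are the usual
  multi-index derivatives.\<close>

primrec partials :: "'d list \<Rightarrow> (real ^ 'd \<Rightarrow> complex) \<Rightarrow> real ^ 'd \<Rightarrow> complex" where
  "partials [] f = f"
| "partials (i # is) f = (\<lambda>x. frechet_derivative (partials is f) (at x) (axis i 1))"

definition smooth :: "(real ^ 'd \<Rightarrow> complex) \<Rightarrow> bool" where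
  "smooth f \<longleftrightarrow> (\<forall>is. partials is f differentiable_on UNIV)"

definition schwartz :: "(real ^ 'd \<Rightarrow> complex) set" where
  "schwartz = {f. smooth f \<and>
     (\<forall>N is. bounded (range (\<lambda>x. complex_of_real ((1 + norm x) ^ N) * partials is f x)))}"

text \<open>The supremum is meaningful, i.e. taken over a set bounded above, for Schwartz functions.\<close>

definition schwartz_norm :: "nat \<Rightarrow> (real ^ 'd \<Rightarrow> complex) \<Rightarrow> real" where
  "schwartz_norm N f =
     (SUP (is, x) \<in> {is. length is \<le> N} \<times> UNIV. (1 + norm x) ^ N * norm (partials is f x))"

definition supp :: "(real ^ 'd \<Rightarrow> complex) \<Rightarrow> (real ^ 'd) set" where
  "supp f = closure {x. f x \<noteq> 0}"

definition test_functions :: "(real ^ 'd \<Rightarrow> complex) set" where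
  "test_functions = {f. smooth f \<and> compact (supp f)}"

definition fourier :: "(real ^ 'd \<Rightarrow> complex) \<Rightarrow> real ^ 'd \<Rightarrow> complex" where
  "fourier f \<xi> = complex_of_real ((2 * pi) powr (- real CARD('d) / 2)) *
     (LINT x|lborel. exp (- \<i> * complex_of_real (x \<bullet> \<xi>)) * f x)"

definition inv_fourier :: "(real ^ 'd \<Rightarrow> complex) \<Rightarrow> real ^ 'd \<Rightarrow> complex" where
  "inv_fourier f x = complex_of_real ((2 * pi) powr (- real CARD('d) / 2)) *
     (LINT \<xi>|lborel. exp (\<i> * complex_of_real (x \<bullet> \<xi>)) * f \<xi>)"

section \<open>Tempered distributions\<close>

text \<open>A tempered distribution is a functional on Schwartz functions. It is represented by a total
  function whose values outside \<^term>\<open>schwartz\<close> are arbitrary and never used.\<close>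

type_synonym 'd functional = "(real ^ 'd \<Rightarrow> complex) \<Rightarrow> complex"

text \<open>The last condition is continuity in the Frechet topology given by the (increasing) norms
  \<^const>\<open>schwartz_norm\<close>.\<close>

definition tempered_distributions :: "'d::finite functional set" where
  "tempered_distributions = {T.
     (\<forall>\<phi>\<in>schwartz. \<forall>\<psi>\<in>schwartz. T (\<lambda>x. \<phi> x + \<psi> x) = T \<phi> + T \<psi>) \<and>
     (\<forall>c. \<forall>\<phi>\<in>schwartz. T (\<lambda>x. c * \<phi> x) = c * T \<phi>) \<and>
     (\<exists>N C. \<forall>\<phi>\<in>schwartz. norm (T \<phi>) \<le> C * schwartz_norm N \<phi>)}"

definition fourier_distr :: "'d::finite functional \<Rightarrow> 'd functional" where
  "fourier_distr T = (\<lambda>\<psi>. T (fourier \<psi>))"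

definition inv_fourier_distr :: "'d::finite functional \<Rightarrow> 'd functional" where
  "inv_fourier_distr T = (\<lambda>\<psi>. T (inv_fourier \<psi>))"

definition mult_distr :: "(real ^ 'd \<Rightarrow> complex) \<Rightarrow> 'd::finite functional \<Rightarrow> 'd functional" where
  "mult_distr m T = (\<lambda>\<psi>. T (\<lambda>x. m x * \<psi> x))"

definition locally_integrable :: "(real ^ 'd \<Rightarrow> complex) \<Rightarrow> bool" where
  "locally_integrable f \<longleftrightarrow> (\<forall>K. compact K \<longrightarrow> f absolutely_integrable_on K)"

text \<open>\<open>T\<close> is the regular distribution with density \<open>f\<close>. Only compactly supported test functions are
  used, as \<open>f * \<psi>\<close> need not be integrable for a Schwartz function \<open>\<psi>\<close>; a tempered distribution is
  determined by its values on these.\<close>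

definition represents :: "(real ^ 'd \<Rightarrow> complex) \<Rightarrow> 'd::finite functional \<Rightarrow> bool" where
  "represents f T \<longleftrightarrow> locally_integrable f \<and>
     (\<forall>\<psi>\<in>test_functions. T \<psi> = (LINT x|lebesgue. f x * \<psi> x))"

section \<open>Triebel-Lizorkin-Morrey spaces\<close>

definition resolution_generator :: "(real ^ 'd \<Rightarrow> complex) \<Rightarrow> bool" where
  "resolution_generator \<phi> \<longleftrightarrow>
     \<phi> \<in> schwartz \<and> supp \<phi> \<subseteq> {x. norm x \<le> 2} \<and> (\<forall>x. norm x \<le> 1 \<longrightarrow> \<phi> x = 1)"

definition resolution :: "(real ^ 'd \<Rightarrow> complex) \<Rightarrow> nat \<Rightarrow> real ^ 'd \<Rightarrow> complex" where
  "resolution \<phi> j x = (if j = 0 then \<phi> x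
     else \<phi> ((2 powi (- int j)) *\<^sub>R x) - \<phi> ((2 powi (- int j + 1)) *\<^sub>R x))"

text \<open>By the Paley-Wiener-Schwartz theorem \<open>F\<^sup>-\<^sup>1 (\<phi>\<^sub>j F T)\<close> is (represented by) a unique
  continuous function; that function is chosen here.\<close>

definition lp_block ::
    "(real ^ 'd \<Rightarrow> complex) \<Rightarrow> nat \<Rightarrow> 'd::finite functional \<Rightarrow> real ^ 'd \<Rightarrow> complex" where
  "lp_block \<phi> j T = (THE g. continuous_on UNIV g \<and>
     represents g (inv_fourier_distr (mult_distr (resolution \<phi> j) (fourier_distr T))))"

definition tlm_norm ::
    "(real ^ 'd \<Rightarrow> complex) \<Rightarrow> real \<Rightarrow> real \<Rightarrow> real \<Rightarrow> ereal \<Rightarrow> 'd::finite functional \<Rightarrow> ennreal" where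
  "tlm_norm \<phi> s u p q T = morrey_norm u p (\<lambda>x.
     if q = \<infinity> then (SUP j. ennreal (2 powr (real j * s) * norm (lp_block \<phi> j T x)))
     else enn_powr
       (\<Sum>j. ennreal (2 powr (real j * s * real_of_ereal q) *
                      norm (lp_block \<phi> j T x) powr real_of_ereal q))
       (1 / real_of_ereal q))"

definition tlm_space ::
    "(real ^ 'd \<Rightarrow> complex) \<Rightarrow> real \<Rightarrow> real \<Rightarrow> real \<Rightarrow> ereal \<Rightarrow> 'd::finite functional set" where
  "tlm_space \<phi> s u p q = {T \<in> tempered_distributions. tlm_norm \<phi> s u p q T < \<infinity>}"

end

theory Submission
  imports Defs "HOL-Probability.Probability"
begin

text \<open>Let \<open>f = \<Sum>\<^sub>j f\<^sub>j\<close> be the Littlewood-Paley decomposition, \<open>s = d/u\<close>, \<open>N\<close> the norm of \<open>f\<close> and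
  \<open>S = sup\<^sub>j 2\<^bsup>js\<^esup> \<bar>f\<^sub>j\<bar>\<close>, so that the Morrey norm of \<open>S\<close> is at most \<open>N\<close>. Since \<open>f\<^sub>j\<close> is band-limited,
  a Nikolskii inequality on the cubes of side \<open>2\<^bsup>-j\<^esup>\<close> gives \<open>\<bar>f\<^sub>j\<bar> \<le> C N\<close>, whereas \<open>\<bar>f\<^sub>j\<bar> \<le> 2\<^bsup>-js\<^esup> S\<close>
  by definition. Using the first bound for \<open>j < J\<close> and interpolating both for \<open>j \<ge> J\<close> yields, for every
  \<open>\<alpha> \<in> (0,1]\<close>, the pointwise estimate \<open>\<Sum>\<^sub>j \<bar>f\<^sub>j\<bar> \<le> N (C J + K (2\<^bsup>-Js\<^esup> S/N)\<^sup>\<alpha>)\<close>. Its \<open>r\<close>-th power is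
  integrated over \<open>Q\<close> with \<open>\<alpha> = min 1 (p/r)\<close>, and \<open>J\<close> is the level of \<open>Q\<close> if the side of \<open>Q\<close> is at
  most \<open>1\<close>, and \<open>0\<close> otherwise.\<close>

section \<open>Smooth functions\<close>

text \<open>The exponent \<open>s = d/u\<close> is the one for which the Nikolskii bound does not
  depend on j: on a cube of side 2^-j the Morrey condition says that the mean of |f_j|^p is at most
  N^p, because |Q|^(-1/u) = 2^(js). Without decay in j every level below that of Q contributes a
  multiple of N, and this is the source of the logarithm. The higher levels are controlled through
  S, of which the Morrey norm integrates the power p only; hence \<alpha> r \<le> p, and the gain on
  large cubes is this exponent \<alpha>.

  For p < 1 the Nikolskii inequality is out of reach of Hoelder's inequality. It comes from a
  reproducing formula by absorbing a power of a weighted supremum, which must be known to be finite;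
  polynomial growth of f_j supplies that. Moreover \<open>f\<close> is a functional: f_j has to be
  exhibited as a concrete continuous function and the series has to be shown to represent
  \<open>f\<close>. This rests on taking a distribution inside a convolution integral
  (\<open>tempered_conv\<close>), on Fourier inversion and on the uniqueness of densities.\<close>

lemma partials_append: "partials (is @ js) f = partials is (partials js f)"
  by (induction "is") auto

lemma smooth_partials: "smooth f \<Longrightarrow> smooth (partials js f)"
  unfolding smooth_def by (simp flip: partials_append)

lemma has_derivative_partials:
  fixes f :: "real ^ 'd::finite \<Rightarrow> complex"
  assumes "f differentiable at x"
  shows "(f has_derivative (\<lambda>v. \<Sum>i\<in>UNIV. v $ i *\<^sub>R partials [i] f x)) (at x)"
proof -
  let ?D = "frechet_derivative f (at x)"
  have d: "(f has_derivative ?D) (at x)"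
    using assms frechet_derivative_works by blast
  then have lin: "linear ?D"
    using has_derivative_linear by blast
  have "?D v = (\<Sum>i\<in>UNIV. v $ i *\<^sub>R partials [i] f x)" for v
  proof -
    have "?D v = ?D (\<Sum>i\<in>UNIV. v $ i *\<^sub>R axis i 1)"
      using basis_expansion[of v] by (simp add: scalar_mult_eq_scaleR)
    also have "\<dots> = (\<Sum>i\<in>UNIV. v $ i *\<^sub>R partials [i] f x)"
      by (simp add: linear_sum[OF lin] linear_scale[OF lin])
    finally show ?thesis .
  qed
  with d show ?thesis by (metis (no_types, lifting) ext)
qed

lemma partials_eqI:
  fixes f :: "real ^ 'd::finite \<Rightarrow> complex"
  assumes "(f has_derivative f') (at x)"
  shows "partials [i] f x = f' (axis i 1)"
  using frechet_derivative_at[OF assms] by simp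

text \<open>Total derivatives are kept as sums over the coordinates, so that a partial derivative is
  read off as a coefficient.\<close>

lemma partials_eqI_sum:
  fixes f :: "real ^ 'd::finite \<Rightarrow> complex"
  assumes "(f has_derivative (\<lambda>v. \<Sum>j\<in>UNIV. v $ j *\<^sub>R a j)) (at x)"
  shows "partials [i] f x = a i"
proof -
  have "(\<Sum>j\<in>UNIV. axis i (1::real) $ j *\<^sub>R a j) = (\<Sum>j\<in>UNIV. if j = i then a j else 0)"
    by (intro sum.cong) (auto simp: axis_def)
  with partials_eqI[OF assms, of i] show ?thesis by simp
qed

lemma smooth_differentiable:
  assumes "smooth f"
  shows "f differentiable at x" "partials is f differentiable at x"
proof -
  show *: "partials is f differentiable at x" for "is"
    using assms unfolding smooth_def differentiable_on_def by auto
  from *[of "[]"] show "f differentiable at x" by simp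
qed

lemma smooth_has_derivative:
  fixes f :: "real ^ 'd::finite \<Rightarrow> complex"
  assumes "smooth f"
  shows "(f has_derivative (\<lambda>v. \<Sum>i\<in>UNIV. v $ i *\<^sub>R partials [i] f x)) (at x)"
  by (simp only: has_derivative_partials smooth_differentiable assms)

lemma smooth_continuous: "smooth f \<Longrightarrow> continuous_on S f"
  by (intro continuous_at_imp_continuous_on ballI differentiable_imp_continuous_within
      smooth_differentiable(1))

lemma smooth_measurable:
  fixes f :: "real ^ 'd::finite \<Rightarrow> complex"
  shows "smooth f \<Longrightarrow> f \<in> borel_measurable borel"
  by (intro borel_measurable_continuous_onI smooth_continuous)

text \<open>\<open>smooth\<close> is the largest class of differentiable functions closed under
  first partial derivatives, so it suffices to exhibit some class with these two properties. This
  spares explicit formulas for iterated derivatives of products and Fourier integrals.\<close>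

lemma smooth_coinduct:
  assumes "P f" and "\<And>f. P f \<Longrightarrow> (\<forall>x. f differentiable at x) \<and> (\<forall>i. P (partials [i] f))"
  shows "smooth f"
proof -
  have "P f \<Longrightarrow> P (partials is f)" for "is" f
    by (induction "is") (use assms(2) in auto)
  with assms show ?thesis
    unfolding smooth_def differentiable_on_def using differentiable_at_withinI by blast
qed

lemma partials_add:
  fixes f g :: "real ^ 'd::finite \<Rightarrow> complex"
  assumes "smooth f" "smooth g"
  shows "partials is (\<lambda>x. f x + g x) = (\<lambda>x. partials is f x + partials is g x)"
proof (induction "is")
  case (Cons i "is")
  have "partials [i] (\<lambda>x. partials is f x + partials is g x) x
     = partials (i # is) f x + partials (i # is) g x" for x
    using partials_eqI_sum[OF has_derivative_eq_rhs[OF has_derivative_add[OF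
        smooth_has_derivative[OF smooth_partials[OF assms(1)]]
        smooth_has_derivative[OF smooth_partials[OF assms(2)]]], of "is" x "is"
        "\<lambda>v. \<Sum>i\<in>UNIV. v $ i *\<^sub>R (partials (i # is) f x + partials (i # is) g x)"], of i]
    by (simp add: scaleR_add_right sum.distrib)
  with Cons show ?case by auto
qed auto

lemma smooth_add:
  fixes f g :: "real ^ 'd::finite \<Rightarrow> complex"
  assumes "smooth f" "smooth g"
  shows "smooth (\<lambda>x. f x + g x)"
proof -
  have "(\<lambda>x. partials is f x + partials is g x) differentiable at x" for "is" x
    by (intro differentiable_add smooth_differentiable assms)
  then show ?thesis
    unfolding smooth_def partials_add[OF assms] differentiable_on_def
    using differentiable_at_withinI by blast
qed

lemma partials_cmult:
  fixes f :: "real ^ 'd::finite \<Rightarrow> complex"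
  assumes "smooth f"
  shows "partials is (\<lambda>x. c * f x) = (\<lambda>x. c * partials is f x)"
proof (induction "is")
  case (Cons i "is")
  have "partials [i] (\<lambda>x. c * partials is f x) x = c * partials (i # is) f x" for x
    using partials_eqI_sum[OF has_derivative_eq_rhs[OF has_derivative_mult_right[OF
        smooth_has_derivative[OF smooth_partials[OF assms(1)]]], of c "is" x
        "\<lambda>v. \<Sum>i\<in>UNIV. v $ i *\<^sub>R (c * partials (i # is) f x)"], of i]
    by (simp add: sum_distrib_left)
  with Cons show ?case by auto
qed auto

lemma smooth_cmult:
  fixes f :: "real ^ 'd::finite \<Rightarrow> complex"
  assumes "smooth f"
  shows "smooth (\<lambda>x. c * f x)"
proof -
  have "(\<lambda>x. c * partials is f x) differentiable at x" for "is" x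
    by (intro differentiable_mult differentiable_const smooth_differentiable assms)
  then show ?thesis
    unfolding smooth_def partials_cmult[OF assms] differentiable_on_def
    using differentiable_at_withinI by blast
qed

lemma partials_cnj:
  fixes f :: "real ^ 'd::finite \<Rightarrow> complex"
  assumes "smooth f"
  shows "partials is (\<lambda>x. cnj (f x)) = (\<lambda>x. cnj (partials is f x))"
proof (induction "is")
  case (Cons i "is")
  have "partials [i] (\<lambda>x. cnj (partials is f x)) x = cnj (partials (i # is) f x)" for x
    using partials_eqI_sum[OF has_derivative_eq_rhs[OF has_derivative_cnj[OF
        smooth_has_derivative[OF smooth_partials[OF assms(1)]]], of "is" x
        "\<lambda>v. \<Sum>i\<in>UNIV. v $ i *\<^sub>R cnj (partials (i # is) f x)"], of i]
    by (simp add: scaleR_conv_of_real)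
  with Cons show ?case by auto
qed auto

lemma smooth_cnj:
  fixes f :: "real ^ 'd::finite \<Rightarrow> complex"
  assumes "smooth f"
  shows "smooth (\<lambda>x. cnj (f x))"
proof -
  have "(\<lambda>x. cnj (partials is f x)) differentiable at x" for "is" x
    using has_derivative_cnj[OF smooth_has_derivative[OF smooth_partials[OF assms]]]
    unfolding differentiable_def by blast
  then show ?thesis
    unfolding smooth_def partials_cnj[OF assms] differentiable_on_def
    using differentiable_at_withinI by blast
qed

lemma partials_affine:
  fixes f :: "real ^ 'd::finite \<Rightarrow> complex"
  assumes "smooth f"
  shows "partials is (\<lambda>x. f (c *\<^sub>R x - b)) = (\<lambda>x. c ^ length is *\<^sub>R partials is f (c *\<^sub>R x - b))"
proof (induction "is")
  case (Cons i "is")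
  have "((\<lambda>x. c ^ length is *\<^sub>R partials is f (c *\<^sub>R x - b)) has_derivative
          (\<lambda>v. \<Sum>i\<in>UNIV. v $ i *\<^sub>R (c ^ length (i # is) *\<^sub>R partials (i # is) f (c *\<^sub>R x - b)))) (at x)" for x
    by (rule has_derivative_eq_rhs, rule has_derivative_scaleR_right,
        rule has_derivative_compose[OF _ smooth_has_derivative[OF smooth_partials[OF assms]]],
        auto intro!: derivative_eq_intros ext simp: scaleR_sum_right mult_ac)
  from partials_eqI_sum[OF this, of i] Cons show ?case by auto
qed auto

lemma smooth_affine:
  fixes f :: "real ^ 'd::finite \<Rightarrow> complex"
  assumes "smooth f"
  shows "smooth (\<lambda>x. f (c *\<^sub>R x - b))"
proof -
  have "((\<lambda>x. partials is f (c *\<^sub>R x - b)) has_derivative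
          (\<lambda>v. \<Sum>i\<in>UNIV. (c *\<^sub>R v) $ i *\<^sub>R (partials [i] (partials is f) (c *\<^sub>R x - b)))) (at x)" for x "is"
    by (rule has_derivative_compose[OF _ smooth_has_derivative[OF smooth_partials[OF assms]]])
      (auto intro!: derivative_eq_intros)
  then have "(\<lambda>x. partials is f (c *\<^sub>R x - b)) differentiable at x" for "is" x
    unfolding differentiable_def by blast
  then show ?thesis
    unfolding smooth_def partials_affine[OF assms] differentiable_on_def
    by (auto intro!: differentiable_scaleR differentiable_at_withinI)
qed

text \<open>The class of finite sums of products of smooth functions is closed under \<open>\<partial>\<^sub>i\<close>, which
  avoids the general Leibniz formula.\<close>

inductive prod_sum :: "(real ^ 'd::finite \<Rightarrow> complex) \<Rightarrow> bool" where
  prod: "smooth f \<Longrightarrow> smooth g \<Longrightarrow> prod_sum (\<lambda>x. f x * g x)"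
| add: "prod_sum f \<Longrightarrow> prod_sum g \<Longrightarrow> prod_sum (\<lambda>x. f x + g x)"

lemma prod_sum_step: "prod_sum f \<Longrightarrow> (\<forall>x. f differentiable at x) \<and> (\<forall>i. prod_sum (partials [i] f))"
proof (induction rule: prod_sum.induct)
  case (prod f g)
  have d: "((\<lambda>x. f x * g x) has_derivative
     (\<lambda>v. \<Sum>i\<in>UNIV. v $ i *\<^sub>R (f x * partials [i] g x + partials [i] f x * g x))) (at x)" for x
    by (rule has_derivative_eq_rhs[OF has_derivative_mult[OF
        smooth_has_derivative[OF prod(1)] smooth_has_derivative[OF prod(2)]]])
      (simp add: sum.distrib sum_distrib_left sum_distrib_right scaleR_add_right)
  have "partials [i] (\<lambda>x. f x * g x) = (\<lambda>x. f x * partials [i] g x + partials [i] f x * g x)" for i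
    using partials_eqI_sum[OF d] by auto
  moreover have "prod_sum (\<lambda>x. f x * partials [i] g x + partials [i] f x * g x)" for i
    by (intro prod_sum.intros smooth_partials prod)
  ultimately show ?case
    using d unfolding differentiable_def by auto
next
  case (add f g)
  have d: "((\<lambda>x. f x + g x) has_derivative
     (\<lambda>v. \<Sum>i\<in>UNIV. v $ i *\<^sub>R (partials [i] f x + partials [i] g x))) (at x)" for x
    by (rule has_derivative_eq_rhs[OF has_derivative_add[OF
        has_derivative_partials has_derivative_partials]])
      (use add in \<open>auto simp: sum.distrib scaleR_add_right\<close>)
  have "partials [i] (\<lambda>x. f x + g x) = (\<lambda>x. partials [i] f x + partials [i] g x)" for i
    using partials_eqI_sum[OF d] by auto
  moreover have "prod_sum (\<lambda>x. partials [i] f x + partials [i] g x)" for i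
    using add by (intro prod_sum.intros) auto
  ultimately show ?case
    using d unfolding differentiable_def by auto
qed

lemma smooth_mult:
  fixes f g :: "real ^ 'd::finite \<Rightarrow> complex"
  assumes "smooth f" "smooth g"
  shows "smooth (\<lambda>x. f x * g x)"
  by (rule smooth_coinduct[of prod_sum]) (use prod_sum_step prod_sum.prod assms in auto)

lemma smooth_const: "smooth (\<lambda>x::real ^ 'd::finite. c :: complex)"
proof (rule smooth_coinduct[of "\<lambda>f. \<exists>c. f = (\<lambda>x. c)"])
  fix f :: "real ^ 'd \<Rightarrow> complex" assume "\<exists>c. f = (\<lambda>x. c)"
  then show "(\<forall>x. f differentiable at x) \<and> (\<forall>i. \<exists>c. partials [i] f = (\<lambda>x. c))"
    by auto
qed auto

lemma smooth_component: "smooth (\<lambda>x::real ^ 'd::finite. complex_of_real (x $ i))"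
proof (rule smooth_coinduct[of "\<lambda>f. (\<exists>c. f = (\<lambda>x. c)) \<or> f = (\<lambda>x. complex_of_real (x $ i))"])
  fix f :: "real ^ 'd \<Rightarrow> complex" assume f: "(\<exists>c. f = (\<lambda>x. c)) \<or> f = (\<lambda>x. complex_of_real (x $ i))"
  have d: "((\<lambda>x. complex_of_real (x $ i)) has_derivative (\<lambda>v. of_real (v $ i))) (at x)" for x
    by (intro bounded_linear_imp_has_derivative bounded_linear_compose[OF bounded_linear_of_real]
        bounded_linear_vec_nth)
  have "partials [j] (\<lambda>x. complex_of_real (x $ i)) = (\<lambda>x. of_real (axis j 1 $ i))" for j
    using partials_eqI[OF d] by auto
  with d f show "(\<forall>x. f differentiable at x) \<and>
      (\<forall>j. (\<exists>c. partials [j] f = (\<lambda>x. c)) \<or> partials [j] f = (\<lambda>x. complex_of_real (x $ i)))"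
    unfolding differentiable_def by (elim disjE) (auto intro: has_derivative_const)
qed auto

section \<open>Mean value and second-order Taylor estimates\<close>

lemma norm_sum_components_le:
  fixes v :: "real ^ 'd::finite" and a :: "'d \<Rightarrow> complex" and B :: real
  assumes "\<And>i. norm (a i) \<le> B"
  shows "norm (\<Sum>i\<in>UNIV. v $ i *\<^sub>R a i) \<le> CARD('d) * B * norm v"
proof -
  have "norm (\<Sum>i\<in>UNIV. v $ i *\<^sub>R a i) \<le> (\<Sum>i\<in>(UNIV::'d set). norm v * B)"
    by (rule sum_norm_le) (auto intro!: mult_mono component_le_norm_cart assms)
  then show ?thesis by (simp add: mult_ac)
qed

lemma norm_diff_le_partials:
  fixes f :: "real ^ 'd::finite \<Rightarrow> complex" and B :: real
  assumes "smooth f" and "\<And>i z. z \<in> closed_segment x y \<Longrightarrow> norm (partials [i] f z) \<le> B"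
  shows "norm (f y - f x) \<le> CARD('d) * B * norm (y - x)"
proof (rule differentiable_bound[of "closed_segment x y" f])
  fix z assume z: "z \<in> closed_segment x y"
  show "(f has_derivative (\<lambda>v. \<Sum>i\<in>UNIV. v $ i *\<^sub>R partials [i] f z)) (at z within closed_segment x y)"
    using smooth_has_derivative[OF assms(1)] has_derivative_at_withinI by blast
  \<comment> \<open>Any coordinate serves here; only the nonnegativity of \<open>B\<close> is
    extracted.\<close>
  have "0 \<le> norm (partials [undefined] f z)" by simp
  also have "\<dots> \<le> B" using assms(2) z by blast
  finally have "0 \<le> B" .
  then show "onorm (\<lambda>v. \<Sum>i\<in>UNIV. v $ i *\<^sub>R partials [i] f z) \<le> CARD('d) * B"
    by (intro onorm_bound norm_sum_components_le assms(2) z) auto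
qed auto

text \<open>The mean value inequality is applied twice: to the first partial derivatives, and then
  to \<open>f\<close> minus its linear part at \<open>x\<close>, whose derivative consists of
  differences of those partials.\<close>

lemma taylor_remainder_le:
  fixes f :: "real ^ 'd::finite \<Rightarrow> complex" and B :: real
  assumes f: "smooth f" and B: "\<And>i j z. norm (partials [i, j] f z) \<le> B"
  shows "norm (f (x + v) - f x - (\<Sum>i\<in>UNIV. v $ i *\<^sub>R partials [i] f x)) \<le> (norm v)\<^sup>2 * (CARD('d)\<^sup>2 * B)"
proof -
  let ?L = "\<lambda>v. \<Sum>i\<in>UNIV. v $ i *\<^sub>R partials [i] f x"
  let ?g = "\<lambda>z. f z - ?L (z - x)"
  let ?S = "closed_segment x (x + v)"
  have B0: "0 \<le> B" using B norm_ge_zero order_trans by blast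
  have bl: "bounded_linear ?L"
    using has_derivative_bounded_linear smooth_has_derivative[OF f] by blast
  have "norm (?g (x + v) - ?g x) \<le> (CARD('d) * (CARD('d) * B * norm v)) * norm ((x + v) - x)"
  proof (rule differentiable_bound[of ?S])
    fix z assume z: "z \<in> ?S"
    have "((\<lambda>z. ?L (z - x)) has_derivative ?L) (at z)"
      by (rule has_derivative_compose[OF _ bounded_linear_imp_has_derivative[OF bl]])
        (auto intro!: derivative_eq_intros)
    then have "(?g has_derivative (\<lambda>v. (\<Sum>i\<in>UNIV. v $ i *\<^sub>R partials [i] f z) - ?L v)) (at z)"
      by (rule has_derivative_diff[OF smooth_has_derivative[OF f]])
    moreover have "(\<lambda>v. (\<Sum>i\<in>UNIV. v $ i *\<^sub>R partials [i] f z) - ?L v)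
        = (\<lambda>v. \<Sum>i\<in>UNIV. v $ i *\<^sub>R (partials [i] f z - partials [i] f x))"
      by (simp add: sum_subtractf scaleR_diff_right)
    ultimately show "(?g has_derivative (\<lambda>v. \<Sum>i\<in>UNIV. v $ i *\<^sub>R (partials [i] f z - partials [i] f x))) (at z within ?S)"
      by (metis (no_types, lifting) has_derivative_at_withinI)
    have "norm (partials [i] f z - partials [i] f x) \<le> CARD('d) * B * norm v" for i
    proof -
      have "norm (partials [i] f z - partials [i] f x) \<le> CARD('d) * B * norm (z - x)"
        using norm_diff_le_partials[OF smooth_partials[OF f, of "[i]"], of x z B] B by simp
      also have "\<dots> \<le> CARD('d) * B * norm v"
        using segment_bound1[OF z] B0 by (intro mult_left_mono) auto
      finally show ?thesis .
    qed
    with B0 show "onorm (\<lambda>v. \<Sum>i\<in>UNIV. v $ i *\<^sub>R (partials [i] f z - partials [i] f x))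
       \<le> CARD('d) * (CARD('d) * B * norm v)"
      by (intro onorm_bound norm_sum_components_le) auto
  qed auto
  then show ?thesis
    by (simp add: algebra_simps power2_eq_square)
qed

section \<open>Differentiation under the integral sign\<close>

lemma norm_integral_le:
  fixes f :: "'a \<Rightarrow> 'b :: {banach, second_countable_topology}"
  assumes w: "integrable M w" and le: "\<And>z. norm (f z) \<le> w z"
  shows "norm (\<integral>z. f z \<partial>M) \<le> (\<integral>z. w z \<partial>M)"
proof -
  have "norm (\<integral>z. f z \<partial>M) \<le> (\<integral>z. norm (f z) \<partial>M)"
    by (rule integral_norm_bound)
  also have "\<dots> \<le> (\<integral>z. w z \<partial>M)"
    by (rule integral_mono') (use w le in \<open>auto intro: order_trans[OF norm_ge_zero]\<close>)
  finally show ?thesis .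
qed

text \<open>A quadratic remainder with an integrable factor \<open>w\<close> can be integrated
  directly, so no limit is interchanged with the integral. The restriction to
  \<open>norm v \<le> 1\<close> admits compactly supported integrands that are shifted by
  \<open>v\<close>, whose majorant lives on a neighbourhood of the support.\<close>

lemma has_derivative_integral_quadratic:
  fixes f :: "real ^ 'd::finite \<Rightarrow> 'b \<Rightarrow> complex"
  assumes f: "\<And>y. integrable M (f y)" and w: "integrable M w"
    and f': "\<And>i. integrable M (f' i)"
    and rem: "\<And>v z. norm v \<le> 1 \<Longrightarrow> norm (f (y + v) z - f y z - (\<Sum>i\<in>UNIV. v $ i *\<^sub>R f' i z)) \<le> (norm v)\<^sup>2 * w z"
  shows "((\<lambda>y. \<integral>z. f y z \<partial>M) has_derivative (\<lambda>v. \<Sum>i\<in>UNIV. v $ i *\<^sub>R (\<integral>z. f' i z \<partial>M))) (at y)"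
  unfolding has_derivative_at
proof
  let ?D = "\<lambda>v::real^'d. \<Sum>i\<in>UNIV. v $ i *\<^sub>R (\<integral>z. f' i z \<partial>M)"
  show "bounded_linear ?D"
    by (intro bounded_linear_sum bounded_linear_scaleR_const bounded_linear_vec_nth)
  have "norm ((\<integral>z. f (y + v) z \<partial>M) - (\<integral>z. f y z \<partial>M) - ?D v) \<le> (norm v)\<^sup>2 * (\<integral>z. w z \<partial>M)" if "norm v \<le> 1" for v
  proof -
    have "(\<integral>z. f (y + v) z \<partial>M) - (\<integral>z. f y z \<partial>M) - ?D v
      = (\<integral>z. f (y + v) z - f y z - (\<Sum>i\<in>UNIV. v $ i *\<^sub>R f' i z) \<partial>M)"
      using f f' by (subst Bochner_Integration.integral_diff Bochner_Integration.integral_sum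
           Bochner_Integration.integral_scaleR_right | simp)+
    also have "norm \<dots> \<le> (\<integral>z. (norm v)\<^sup>2 * w z \<partial>M)"
      by (rule norm_integral_le) (use w rem that in auto)
    finally show ?thesis by simp
  qed
  then have le: "norm (norm ((\<integral>z. f (y + v) z \<partial>M) - (\<integral>z. f y z \<partial>M) - ?D v) / norm v)
       \<le> norm v * (\<integral>z. w z \<partial>M)" if "norm v \<le> 1" for v
    using that by (cases "v = 0") (auto simp: divide_simps power2_eq_square mult_ac)
  have "\<forall>\<^sub>F v :: real ^ 'd in at 0. norm v \<le> 1"
    unfolding eventually_at by (intro exI[of _ 1]) auto
  then have "\<forall>\<^sub>F v in at 0. norm (norm ((\<integral>z. f (y + v) z \<partial>M) - (\<integral>z. f y z \<partial>M) - ?D v) / norm v)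
       \<le> norm v * (\<integral>z. w z \<partial>M)"
    by (rule eventually_mono) (rule le)
  moreover have "((\<lambda>v::real^'d. norm v * (\<integral>z. w z \<partial>M)) \<longlongrightarrow> 0) (at 0)"
    by (auto intro!: tendsto_eq_intros)
  ultimately show "((\<lambda>v. norm ((\<integral>z. f (y + v) z \<partial>M) - (\<integral>z. f y z \<partial>M) - ?D v) / norm v) \<longlongrightarrow> 0) (at 0)"
    by (rule Lim_null_comparison)
qed

section \<open>Schwartz functions and tempered distributions\<close>

definition bsmooth :: "(real ^ 'd::finite \<Rightarrow> complex) \<Rightarrow> bool" where
  "bsmooth f \<longleftrightarrow> smooth f \<and> (\<forall>is. \<exists>B. \<forall>x. norm (partials is f x) \<le> B)"

text \<open>The roles are asymmetric: all derivatives fall on \<open>h\<close>, whereas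
  \<open>k\<close> only has to be integrable, so that indicators of boxes are admissible.\<close>

definition conv :: "(real ^ 'd::finite \<Rightarrow> complex) \<Rightarrow> (real ^ 'd \<Rightarrow> complex) \<Rightarrow> real ^ 'd \<Rightarrow> complex" where
  "conv k h y = (\<integral>x. k x * h (y - x) \<partial>lborel)"

text \<open>Decay in the mean against every polynomial weight. This is what a kernel needs for its
  convolution with a Schwartz function to be a Schwartz function again.\<close>

definition rapid :: "(real ^ 'd::finite \<Rightarrow> complex) \<Rightarrow> bool" where
  "rapid k \<longleftrightarrow> k \<in> borel_measurable borel \<and>
     (\<forall>N. integrable lborel (\<lambda>x. (1 + norm x) ^ N * norm (k x)))"

lemma bsmoothD: "bsmooth f \<Longrightarrow> smooth f" "bsmooth f \<Longrightarrow> \<exists>B. \<forall>x. norm (partials is f x) \<le> B"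
  by (auto simp: bsmooth_def)

lemma bsmooth_partials: "bsmooth f \<Longrightarrow> bsmooth (partials js f)"
  unfolding bsmooth_def by (auto intro: smooth_partials simp flip: partials_append)

lemma integrable_mult_bounded:
  fixes k g :: "'a \<Rightarrow> complex"
  assumes "integrable M k" "g \<in> borel_measurable M" "\<And>x. norm (g x) \<le> B"
  shows "integrable M (\<lambda>x. k x * g x)"
proof (rule Bochner_Integration.integrable_bound)
  show "integrable M (\<lambda>x. B * norm (k x))"
    using assms(1) by auto
  show "(\<lambda>x. k x * g x) \<in> borel_measurable M"
    using assms borel_measurable_integrable by (intro borel_measurable_times) auto
  have "norm (k x * g x) \<le> norm (B * norm (k x))" for x
  proof -
    have "norm (k x) * norm (g x) \<le> norm (k x) * \<bar>B\<bar>"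
      by (rule mult_left_mono) (use assms(3)[of x] in auto)
    then show ?thesis by (simp add: norm_mult abs_mult mult_ac)
  qed
  then show "AE x in M. norm (k x * g x) \<le> norm (B * norm (k x))"
    by simp
qed

lemma measurable_reflect:
  fixes h :: "real ^ 'd::finite \<Rightarrow> complex"
  assumes "h \<in> borel_measurable borel"
  shows "(\<lambda>x. h (y - x)) \<in> borel_measurable lborel" "(\<lambda>x. h (y - x)) \<in> borel_measurable borel"
  using assms by measurable

lemma bsmooth_second_partials:
  fixes h :: "real ^ 'd::finite \<Rightarrow> complex"
  assumes h: "bsmooth h"
  shows "\<exists>B. \<forall>x i j. norm (partials [i, j] h x) \<le> B"
proof -
  obtain b where b: "\<And>i j x. norm (partials [i, j] h x) \<le> b i j"
    using bsmoothD(2)[OF h, of "[i, j]" for i j] by metis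
  have "norm (partials [i, j] h x) \<le> (\<Sum>(i,j)\<in>UNIV. \<bar>b i j\<bar>)" for i j x
  proof -
    have "norm (partials [i, j] h x) \<le> (case (i, j) of (i, j) \<Rightarrow> \<bar>b i j\<bar>)" using b[of i j x] by simp
    also have "\<dots> \<le> (\<Sum>(i,j)\<in>UNIV. \<bar>b i j\<bar>)"
      by (rule member_le_sum) auto
    finally show ?thesis .
  qed
  then show ?thesis by blast
qed

lemma conv_has_derivative:
  fixes h :: "real ^ 'd::finite \<Rightarrow> complex"
  assumes h: "bsmooth h" and k: "integrable lborel k"
  shows "(conv k h has_derivative (\<lambda>v. \<Sum>i\<in>UNIV. v $ i *\<^sub>R conv k (partials [i] h) y)) (at y)"
proof -
  obtain B where B: "\<And>x i j. norm (partials [i, j] h x) \<le> B"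
    using bsmooth_second_partials[OF h] by blast
  have sm: "smooth h" using h bsmoothD by blast
  have int: "integrable lborel (\<lambda>x. k x * partials is h (y - x))" for y "is"
  proof -
    obtain C where "\<And>x. norm (partials is h x) \<le> C"
      using bsmoothD(2)[OF h] by metis
    then show ?thesis
      by (intro integrable_mult_bounded[OF k] measurable_reflect smooth_measurable smooth_partials sm)
  qed
  show ?thesis
    unfolding conv_def
  proof (rule has_derivative_integral_quadratic)
    show "integrable lborel (\<lambda>x. k x * h (y - x))" for y
      using int[of "[]"] by simp
    show "integrable lborel (\<lambda>x. norm (k x) * (CARD('d)\<^sup>2 * B))"
      using k by auto
    show "integrable lborel (\<lambda>x. k x * partials [i] h (y - x))" for i
      by (rule int)
    fix v x
    have "k x * h (y + v - x) - k x * h (y - x) - (\<Sum>i\<in>UNIV. v $ i *\<^sub>R (k x * partials [i] h (y - x)))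
      = k x * (h ((y - x) + v) - h (y - x) - (\<Sum>i\<in>UNIV. v $ i *\<^sub>R partials [i] h (y - x)))"
      by (simp add: algebra_simps sum_distrib_left)
    also have "norm \<dots> \<le> norm (k x) * ((norm v)\<^sup>2 * (CARD('d)\<^sup>2 * B))"
      unfolding norm_mult by (intro mult_left_mono taylor_remainder_le sm B) auto
    finally show "norm (k x * h (y + v - x) - k x * h (y - x) - (\<Sum>i\<in>UNIV. v $ i *\<^sub>R (k x * partials [i] h (y - x))))
       \<le> (norm v)\<^sup>2 * (norm (k x) * (CARD('d)\<^sup>2 * B))"
      by (simp add: mult_ac)
  qed
qed

lemma partials_conv:
  assumes h: "bsmooth h" and k: "integrable lborel k"
  shows "partials is (conv k h) = conv k (partials is h)"
proof (induction "is")
  case (Cons i "is")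
  have "partials [i] (conv k (partials is h)) = conv k (partials [i] (partials is h))"
    using partials_eqI_sum[OF conv_has_derivative[OF bsmooth_partials[OF h] k]] by blast
  with Cons show ?case by auto
qed auto

lemma smooth_conv:
  assumes h: "bsmooth h" and k: "integrable lborel k"
  shows "smooth (conv k h)"
  unfolding smooth_def partials_conv[OF assms] differentiable_on_def
  using conv_has_derivative[OF bsmooth_partials[OF h] k] differentiable_def
    differentiable_at_withinI by blast

section \<open>Schwartz seminorms, linear operations and translations\<close>

lemma schwartz_iff:
  "f \<in> schwartz \<longleftrightarrow> smooth f \<and> (\<forall>N is. \<exists>B. \<forall>x. (1 + norm x) ^ N * norm (partials is f x) \<le> B)"
proof -
  have "norm (1 + complex_of_real (norm x)) = 1 + norm x" for x :: "real ^ 'a"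
    using norm_of_real[of "1 + norm x", where 'a = complex] by (simp del: norm_of_real)
  then show ?thesis
    unfolding schwartz_def by (simp add: bounded_iff norm_mult norm_power)
qed

lemma schwartz_smooth: "f \<in> schwartz \<Longrightarrow> smooth f"
  by (simp add: schwartz_def)

lemma schwartz_bsmooth: "f \<in> schwartz \<Longrightarrow> bsmooth f"
  unfolding schwartz_iff bsmooth_def by (metis mult_1 power_0)

lemma schwartz_norm_bdd:
  fixes f :: "real ^ 'd::finite \<Rightarrow> complex"
  assumes "f \<in> schwartz"
  shows "bdd_above ((\<lambda>(is, x). (1 + norm x) ^ N * norm (partials is f x)) ` ({is. length is \<le> N} \<times> UNIV))"
proof -
  have fin: "finite {is::'d list. length is \<le> N}"
    using finite_lists_length_le[of "UNIV::'d set" N] by simp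
  obtain B where B: "\<And>is x. (1 + norm x) ^ N * norm (partials is f x) \<le> B is"
    using assms unfolding schwartz_iff by metis
  have "(1 + norm x) ^ N * norm (partials is f x) \<le> (\<Sum>is | length is \<le> N. \<bar>B is\<bar>)" if "length is \<le> N" for "is" x
  proof -
    have "(1 + norm x) ^ N * norm (partials is f x) \<le> \<bar>B is\<bar>" using B[of x "is"] by simp
    also have "\<dots> \<le> (\<Sum>is | length is \<le> N. \<bar>B is\<bar>)"
      using that by (intro member_le_sum fin) auto
    finally show ?thesis .
  qed
  then show ?thesis
    by (intro bdd_aboveI2[where M = "\<Sum>is | length is \<le> N. \<bar>B is\<bar>"]) auto
qed

lemma schwartz_norm_ge:
  assumes "f \<in> schwartz" "length is \<le> N"
  shows "(1 + norm x) ^ N * norm (partials is f x) \<le> schwartz_norm N f"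
  unfolding schwartz_norm_def
  using cSUP_upper[OF _ schwartz_norm_bdd[OF assms(1), of N], of "(is, x)"] assms by auto

lemma schwartz_norm_le:
  fixes f :: "real ^ 'd::finite \<Rightarrow> complex"
  assumes "\<And>is x. length is \<le> N \<Longrightarrow> (1 + norm x) ^ N * norm (partials is f x) \<le> B"
  shows "schwartz_norm N f \<le> B"
  unfolding schwartz_norm_def
proof (rule cSUP_least)
  show "{is::'d list. length is \<le> N} \<times> (UNIV :: (real ^ 'd) set) \<noteq> {}"
    by (auto intro!: exI[of _ "[]"])
qed (use assms in auto)

lemma schwartz_norm_nonneg: "f \<in> schwartz \<Longrightarrow> 0 \<le> schwartz_norm N f"
  by (rule order_trans[OF _ schwartz_norm_ge[of f "[]" N 0]]) auto

lemma schwartz_add: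
  assumes "f \<in> schwartz" "g \<in> schwartz"
  shows "(\<lambda>x. f x + g x) \<in> schwartz"
  unfolding schwartz_iff
proof (intro conjI allI)
  show "smooth (\<lambda>x. f x + g x)" using assms schwartz_smooth smooth_add by blast
  fix N "is"
  obtain A B where AB: "\<And>x. (1 + norm x) ^ N * norm (partials is f x) \<le> A"
     "\<And>x. (1 + norm x) ^ N * norm (partials is g x) \<le> B"
    using assms unfolding schwartz_iff by metis
  have "(1 + norm x) ^ N * norm (partials is f x + partials is g x) \<le> A + B" for x
  proof -
    have "(1 + norm x) ^ N * norm (partials is f x + partials is g x)
       \<le> (1 + norm x) ^ N * (norm (partials is f x) + norm (partials is g x))"
      by (intro mult_left_mono norm_triangle_ineq) auto
    also have "\<dots> \<le> A + B"
      using add_mono[OF AB, of x x] by (simp add: distrib_left)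
    finally show ?thesis .
  qed
  then show "\<exists>B. \<forall>x. (1 + norm x) ^ N * norm (partials is (\<lambda>x. f x + g x) x) \<le> B"
    by (subst partials_add[OF schwartz_smooth[OF assms(1)] schwartz_smooth[OF assms(2)]]) blast
qed

lemma schwartz_cmult:
  assumes "f \<in> schwartz"
  shows "(\<lambda>x. c * f x) \<in> schwartz"
  unfolding schwartz_iff
proof (intro conjI allI)
  show "smooth (\<lambda>x. c * f x)" using assms schwartz_smooth smooth_cmult by blast
  fix N "is"
  obtain A where A: "\<And>x. (1 + norm x) ^ N * norm (partials is f x) \<le> A"
    using assms unfolding schwartz_iff by metis
  have "(1 + norm x) ^ N * norm (c * partials is f x) \<le> norm c * A" for x
    using mult_left_mono[OF A[of x], of "norm c"] by (simp add: norm_mult mult_ac)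
  then show "\<exists>B. \<forall>x. (1 + norm x) ^ N * norm (partials is (\<lambda>x. c * f x) x) \<le> B"
    using partials_cmult[of f] assms schwartz_smooth by metis
qed

lemma schwartz_diff:
  assumes "f \<in> schwartz" "g \<in> schwartz"
  shows "(\<lambda>x. f x - g x) \<in> schwartz"
  using schwartz_add[OF assms(1) schwartz_cmult[OF assms(2), of "-1"]] by simp

lemma smooth_diff:
  assumes "smooth f" "smooth (g :: real ^ 'd::finite \<Rightarrow> complex)"
  shows "smooth (\<lambda>x. f x - g x)"
  using smooth_add[OF assms(1) smooth_cmult[OF assms(2), of "-1"]] by simp

lemma partials_diff:
  assumes "smooth f" "smooth (g :: real ^ 'd::finite \<Rightarrow> complex)"
  shows "partials is (\<lambda>x. f x - g x) = (\<lambda>x. partials is f x - partials is g x)"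
  using partials_add[OF assms(1) smooth_cmult[OF assms(2), of "-1"], of "is"]
  unfolding partials_cmult[OF assms(2)] by simp

lemma schwartz_zero: "(\<lambda>x. 0) \<in> schwartz"
proof -
  have "partials is (\<lambda>x::real^'a. 0) = (\<lambda>x. 0)" for "is"
    by (induction "is") auto
  then show ?thesis unfolding schwartz_iff using smooth_const by auto
qed

lemma smooth_sum:
  assumes "finite S" "\<And>c. c \<in> S \<Longrightarrow> smooth (f c :: real ^ 'd::finite \<Rightarrow> complex)"
  shows "smooth (\<lambda>x. \<Sum>c\<in>S. f c x)"
  using assms by (induction S) (auto intro: smooth_add smooth_const)

lemma partials_sum:
  assumes "finite S" "\<And>c. c \<in> S \<Longrightarrow> smooth (f c :: real ^ 'd::finite \<Rightarrow> complex)"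
  shows "partials is (\<lambda>x. \<Sum>c\<in>S. f c x) = (\<lambda>x. \<Sum>c\<in>S. partials is (f c) x)"
  using assms
proof (induction S)
  case empty
  show ?case by (induction "is") auto
next
  case (insert c S)
  then have "partials is (\<lambda>x. f c x + (\<Sum>c\<in>S. f c x)) = (\<lambda>x. partials is (f c) x + partials is (\<lambda>x. \<Sum>c\<in>S. f c x) x)"
    by (intro partials_add smooth_sum) auto
  with insert show ?case by simp
qed

lemma schwartz_sum:
  assumes "finite S" "\<And>c. c \<in> S \<Longrightarrow> f c \<in> schwartz"
  shows "(\<lambda>x. \<Sum>c\<in>S. f c x) \<in> schwartz"
  using assms by (induction S) (auto intro: schwartz_add schwartz_zero)

text \<open>Peetre's inequality: the triangle inequality makes the weight submultiplicative, which
  moves weights from one point to another at the cost of a weight of the difference.\<close>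

lemma one_plus_norm_le:
  fixes x y :: "'a::real_normed_vector"
  shows "(1 + norm y) ^ N \<le> (1 + norm x) ^ N * (1 + norm (y - x)) ^ N"
proof -
  have "norm y \<le> norm x + norm (y - x)" using norm_triangle_sub by blast
  then have "1 + norm y \<le> (1 + norm x) * (1 + norm (y - x))"
    by (simp add: algebra_simps) (metis add.assoc add_increasing2 mult_nonneg_nonneg norm_ge_zero)
  then show ?thesis by (simp add: power_mono flip: power_mult_distrib)
qed

lemma smooth_translate:
  assumes "smooth (f :: real ^ 'd::finite \<Rightarrow> complex)"
  shows "smooth (\<lambda>y. f (y - x))" "partials is (\<lambda>y. f (y - x)) = (\<lambda>y. partials is f (y - x))"
  using smooth_affine[OF assms, of 1 x] partials_affine[OF assms, of "is" 1 x] by simp_all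

lemma schwartz_translate_weight:
  assumes f: "f \<in> schwartz" and "length is \<le> N"
  shows "(1 + norm y) ^ N * norm (partials is f (y - x)) \<le> (1 + norm x) ^ N * schwartz_norm N f"
proof -
  have "(1 + norm y) ^ N * norm (partials is f (y - x))
      \<le> ((1 + norm x) ^ N * (1 + norm (y - x)) ^ N) * norm (partials is f (y - x))"
    by (intro mult_right_mono one_plus_norm_le) auto
  also have "\<dots> \<le> (1 + norm x) ^ N * schwartz_norm N f"
    using schwartz_norm_ge[OF assms, of "y - x"] by (simp add: mult.assoc mult_left_mono)
  finally show ?thesis .
qed

lemma schwartz_translate:
  fixes f :: "real ^ 'd::finite \<Rightarrow> complex"
  assumes f: "f \<in> schwartz"
  shows "(\<lambda>y. f (y - x)) \<in> schwartz"
  unfolding schwartz_iff smooth_translate(2)[OF schwartz_smooth[OF f]]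
proof (intro conjI allI)
  show "smooth (\<lambda>y. f (y - x))" using smooth_translate f schwartz_smooth by blast
  fix N :: nat and "is" :: "'d list"
  let ?M = "max N (length is)"
  have "(1 + norm y) ^ N * norm (partials is f (y - x)) \<le> (1 + norm x) ^ ?M * schwartz_norm ?M f" for y
  proof -
    have "(1 + norm y) ^ N * norm (partials is f (y - x)) \<le> (1 + norm y) ^ ?M * norm (partials is f (y - x))"
      by (intro mult_right_mono power_increasing) auto
    also have "\<dots> \<le> (1 + norm x) ^ ?M * schwartz_norm ?M f"
      by (rule schwartz_translate_weight[OF f]) auto
    finally show ?thesis .
  qed
  then show "\<exists>B. \<forall>y. (1 + norm y) ^ N * norm (partials is f (y - x)) \<le> B" by blast
qed

text \<open>The mean value inequality on the segment from \<open>y - s\<close> to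
  \<open>y - x\<close>. Its points \<open>z\<close> satisfy
  \<open>norm (y - z) \<le> norm x + norm s\<close>, so the weight at \<open>y\<close> is comparable
  with the weight at \<open>z\<close>.\<close>

lemma schwartz_translate_diff_weight:
  fixes f :: "real ^ 'd::finite \<Rightarrow> complex"
  assumes f: "f \<in> schwartz" and len: "length is \<le> N"
  shows "(1 + norm y) ^ N * norm (partials is f (y - x) - partials is f (y - s))
     \<le> CARD('d) * schwartz_norm (Suc N) f * (norm (x - s) * (1 + norm x + norm s) ^ N)"
proof -
  let ?S = "schwartz_norm (Suc N) f"
  let ?W = "(1 + norm x + norm s) ^ N"
  have pos: "(1 + norm y) ^ N > 0" by (simp add: add_pos_nonneg)
  have "norm (partials is f (y - x) - partials is f (y - s)) \<le> CARD('d) * (?W * ?S / (1 + norm y) ^ N) * norm ((y - x) - (y - s))"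
  proof (rule norm_diff_le_partials)
    show "smooth (partials is f)" using f schwartz_smooth smooth_partials by blast
    fix i z assume z: "z \<in> closed_segment (y - s) (y - x)"
    obtain t where t: "0 \<le> t" "t \<le> 1" "z = (1 - t) *\<^sub>R (y - s) + t *\<^sub>R (y - x)"
      using z by (auto simp: in_segment)
    have "y - z = (1 - t) *\<^sub>R s + t *\<^sub>R x" using t(3) by (simp add: algebra_simps)
    then have "norm (y - z) \<le> (1 - t) * norm s + t * norm x"
      using norm_triangle_ineq[of "(1 - t) *\<^sub>R s" "t *\<^sub>R x"] t by simp
    also have "\<dots> \<le> norm s + norm x"
      using t by (intro add_mono mult_left_le_one_le) auto
    finally have "1 + norm (y - z) \<le> 1 + norm x + norm s" by simp
    then have "(1 + norm (y - z)) ^ N * (1 + norm z) ^ N \<le> ?W * (1 + norm z) ^ N"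
      by (intro mult_right_mono power_mono) auto
    then have w: "(1 + norm y) ^ N \<le> ?W * (1 + norm z) ^ N"
      using one_plus_norm_le[of y N "y - z"] by simp
    have "(1 + norm y) ^ N * norm (partials [i] (partials is f) z)
        \<le> (?W * (1 + norm z) ^ N) * norm (partials (i # is) f z)"
      using w by (simp add: mult_right_mono)
    \<comment> \<open>\<open>schwartz_norm\<close> has a single index for weight and order, so the
      extra derivative brings in an extra power of the weight.\<close>
    also have "\<dots> \<le> ?W * ((1 + norm z) ^ Suc N * norm (partials (i # is) f z))"
      unfolding mult.assoc by (intro mult_left_mono mult_right_mono power_increasing) auto
    also have "\<dots> \<le> ?W * ?S"
      using len by (intro mult_left_mono schwartz_norm_ge[OF f]) auto
    finally show "norm (partials [i] (partials is f) z) \<le> ?W * ?S / (1 + norm y) ^ N"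
      using pos by (simp add: field_simps)
  qed
  also have "norm ((y - x) - (y - s)) = norm (x - s)"
    by (simp add: norm_minus_commute)
  finally show ?thesis
    using pos by (simp add: field_simps)
qed

section \<open>Tempered distributions on translates of a Schwartz function\<close>

lemma tempered_linear:
  assumes "T \<in> tempered_distributions"
  shows "\<phi> \<in> schwartz \<Longrightarrow> \<psi> \<in> schwartz \<Longrightarrow> T (\<lambda>x. \<phi> x + \<psi> x) = T \<phi> + T \<psi>"
    and "\<phi> \<in> schwartz \<Longrightarrow> T (\<lambda>x. c * \<phi> x) = c * T \<phi>"
    and "\<phi> \<in> schwartz \<Longrightarrow> \<psi> \<in> schwartz \<Longrightarrow> T (\<lambda>x. \<phi> x - \<psi> x) = T \<phi> - T \<psi>"
    and "T (\<lambda>x. 0) = 0"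
proof -
  show add: "T (\<lambda>x. \<phi> x + \<psi> x) = T \<phi> + T \<psi>" if "\<phi> \<in> schwartz" "\<psi> \<in> schwartz" for \<phi> \<psi>
    using assms that by (auto simp: tempered_distributions_def)
  show cm: "T (\<lambda>x. c * \<phi> x) = c * T \<phi>" if "\<phi> \<in> schwartz" for c \<phi>
    using assms that by (auto simp: tempered_distributions_def)
  show "T (\<lambda>x. \<phi> x - \<psi> x) = T \<phi> - T \<psi>" if "\<phi> \<in> schwartz" "\<psi> \<in> schwartz" for \<phi> \<psi>
    using add[OF that(1) schwartz_cmult[OF that(2), of "-1"]] cm[OF that(2), of "-1"] by simp
  show "T (\<lambda>x. 0) = 0"
    using cm[OF schwartz_zero, of 0] by simp
qed

lemma tempered_sum:
  assumes T: "T \<in> tempered_distributions"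
    and "finite S" "\<And>c. c \<in> S \<Longrightarrow> f c \<in> schwartz"
  shows "T (\<lambda>x. \<Sum>c\<in>S. a c * f c x) = (\<Sum>c\<in>S. a c * T (f c))"
  using assms(2,3)
proof (induction S)
  case empty
  then show ?case using tempered_linear(4)[OF T] by simp
next
  case (insert c S)
  then show ?case
    using tempered_linear(1)[OF T schwartz_cmult schwartz_sum[OF _ schwartz_cmult], of "f c" S f "a c" a]
      tempered_linear(2)[OF T] by simp
qed

text \<open>Continuity is restated with an arbitrary uniform bound \<open>B\<close>, so that later
  estimates never handle the supremum. The constant of the definition may be negative, hence its
  absolute value.\<close>

lemma tempered_bound:
  assumes "T \<in> tempered_distributions"
  obtains N A where "0 \<le> A"
    "\<And>\<phi> B. \<phi> \<in> schwartz \<Longrightarrow>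
       (\<And>is x. length is \<le> N \<Longrightarrow> (1 + norm x) ^ N * norm (partials is \<phi> x) \<le> B) \<Longrightarrow> norm (T \<phi>) \<le> A * B"
proof -
  obtain N C where C: "\<And>\<phi>. \<phi> \<in> schwartz \<Longrightarrow> norm (T \<phi>) \<le> C * schwartz_norm N \<phi>"
    using assms unfolding tempered_distributions_def by blast
  show ?thesis
  proof (rule that[of "\<bar>C\<bar>" N])
    fix \<phi> :: "real ^ 'a \<Rightarrow> complex" and B assume \<phi>: "\<phi> \<in> schwartz"
      and B: "\<And>is x. length is \<le> N \<Longrightarrow> (1 + norm x) ^ N * norm (partials is \<phi> x) \<le> B"
    have "norm (T \<phi>) \<le> C * schwartz_norm N \<phi>" using C \<phi> by blast
    also have "\<dots> \<le> \<bar>C\<bar> * B"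
      using schwartz_norm_le[OF B] schwartz_norm_nonneg[OF \<phi>, of N] by (intro mult_mono) auto
    finally show "norm (T \<phi>) \<le> \<bar>C\<bar> * B" .
  qed auto
qed

lemma tempered_translate_growth:
  assumes T: "T \<in> tempered_distributions" and h: "h \<in> schwartz"
  obtains N A where "0 \<le> A" "\<And>x. norm (T (\<lambda>y. h (y - x))) \<le> A * (1 + norm x) ^ N"
proof -
  obtain N A where A: "0 \<le> A"
    and TA: "\<And>\<phi> B. \<phi> \<in> schwartz \<Longrightarrow>
       (\<And>is x. length is \<le> N \<Longrightarrow> (1 + norm x) ^ N * norm (partials is \<phi> x) \<le> B) \<Longrightarrow> norm (T \<phi>) \<le> A * B"
    by (rule tempered_bound[OF T]) blast
  show ?thesis
  proof (rule that[of "A * schwartz_norm N h" N])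
    show "norm (T (\<lambda>y. h (y - x))) \<le> A * schwartz_norm N h * (1 + norm x) ^ N" for x
      using TA[OF schwartz_translate[OF h], of x "(1 + norm x) ^ N * schwartz_norm N h"]
        schwartz_translate_weight[OF h, of _ N]
      by (simp add: smooth_translate(2)[OF schwartz_smooth[OF h]] mult_ac)
  qed (use A schwartz_norm_nonneg[OF h, of N] in auto)
qed

text \<open>This yields the continuity of the pairing in the translation parameter. As the Lipschitz
  constant grows only polynomially, it also gives an error that is integrable against a rapidly
  decreasing kernel when \<open>x\<close> is replaced by an approximation.\<close>

lemma tempered_translate_diff:
  assumes T: "T \<in> tempered_distributions" and h: "h \<in> schwartz"
  obtains N A where "0 \<le> A"
    "\<And>x s. norm (T (\<lambda>y. h (y - x)) - T (\<lambda>y. h (y - s))) \<le> A * (norm (x - s) * (1 + norm x + norm s) ^ N)"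
proof -
  obtain N A where A: "0 \<le> A"
    and TA: "\<And>\<phi> B. \<phi> \<in> schwartz \<Longrightarrow>
       (\<And>is x. length is \<le> N \<Longrightarrow> (1 + norm x) ^ N * norm (partials is \<phi> x) \<le> B) \<Longrightarrow> norm (T \<phi>) \<le> A * B"
    by (rule tempered_bound[OF T]) blast
  let ?C = "CARD('a) * schwartz_norm (Suc N) h"
  show ?thesis
  proof (rule that[of "A * ?C" N])
    fix x s
    have "norm (T (\<lambda>y. h (y - x) - h (y - s))) \<le> A * (?C * (norm (x - s) * (1 + norm x + norm s) ^ N))"
    proof (rule TA)
      show "(\<lambda>y. h (y - x) - h (y - s)) \<in> schwartz"
        by (intro schwartz_diff schwartz_translate h)
      show "(1 + norm y) ^ N * norm (partials is (\<lambda>y. h (y - x) - h (y - s)) y)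
         \<le> ?C * (norm (x - s) * (1 + norm x + norm s) ^ N)" if "length is \<le> N" for "is" y
        using schwartz_translate_diff_weight[OF h that]
        by (simp add: partials_diff smooth_translate[OF schwartz_smooth[OF h]])
    qed
    then show "norm (T (\<lambda>y. h (y - x)) - T (\<lambda>y. h (y - s))) \<le> A * ?C * (norm (x - s) * (1 + norm x + norm s) ^ N)"
      using tempered_linear(3)[OF T schwartz_translate[OF h] schwartz_translate[OF h]] by (simp add: mult_ac)
  qed (use A schwartz_norm_nonneg[OF h, of "Suc N"] in auto)
qed

lemma tempered_translate_continuous:
  fixes h :: "real ^ 'd::finite \<Rightarrow> complex"
  assumes T: "T \<in> tempered_distributions" and h: "h \<in> schwartz"
  shows "continuous_on S (\<lambda>x. T (\<lambda>y. h (y - x)))"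
proof -
  obtain N A where A: "0 \<le> A" and
    le: "\<And>x s. norm (T (\<lambda>y. h (y - x)) - T (\<lambda>y. h (y - s))) \<le> A * (norm (x - s) * (1 + norm x + norm s) ^ N)"
    by (rule tempered_translate_diff[OF assms]) blast
  have "((\<lambda>x. T (\<lambda>y. h (y - x))) \<longlongrightarrow> T (\<lambda>y. h (y - s))) (at s)" for s
  proof -
    have "((\<lambda>x. A * (norm (x - s) * (1 + norm x + norm s) ^ N)) \<longlongrightarrow> A * (norm (s - s) * (1 + norm s + norm s) ^ N)) (at s)"
      by (intro tendsto_intros)
    then have "((\<lambda>x. A * (norm (x - s) * (1 + norm x + norm s) ^ N)) \<longlongrightarrow> 0) (at s)" by simp
    then have "((\<lambda>x. T (\<lambda>y. h (y - x)) - T (\<lambda>y. h (y - s))) \<longlongrightarrow> 0) (at s)"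
      by (rule Lim_null_comparison[OF always_eventually[OF allI[OF le]]])
    then show ?thesis by (simp add: LIM_zero_iff)
  qed
  then show ?thesis
    by (simp add: continuous_at continuous_at_imp_continuous_on)
qed


section \<open>A distribution applied to a convolution\<close>

lemma rapid_integrable: "rapid k \<Longrightarrow> integrable lborel k"
proof -
  assume k: "rapid k"
  then have "integrable lborel (\<lambda>x. norm (k x))"
    unfolding rapid_def by (metis (no_types, lifting) mult_1 power_0 Bochner_Integration.integrable_cong)
  then show ?thesis
    using k by (subst (asm) integrable_norm_iff) (auto simp: rapid_def)
qed

lemma conv_weight_le:
  assumes k: "rapid k" and g: "\<And>z. (1 + norm z) ^ N * norm (g z) \<le> B"
  shows "(1 + norm y) ^ N * norm (conv k g y) \<le> B * (\<integral>x. (1 + norm x) ^ N * norm (k x) \<partial>lborel)"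
proof -
  have "(1 + norm y) ^ N * norm (conv k g y) = norm (\<integral>x. (1 + norm y) ^ N *\<^sub>R (k x * g (y - x)) \<partial>lborel)"
    by (simp add: conv_def)
  also have "\<dots> \<le> (\<integral>x. B * ((1 + norm x) ^ N * norm (k x)) \<partial>lborel)"
  proof (rule norm_integral_le)
    show "integrable lborel (\<lambda>x. B * ((1 + norm x) ^ N * norm (k x)))"
      using k by (auto simp: rapid_def)
    fix x
    have "norm ((1 + norm y) ^ N *\<^sub>R (k x * g (y - x))) = (1 + norm y) ^ N * norm (g (y - x)) * norm (k x)"
      by (simp add: norm_mult)
    also have "\<dots> \<le> ((1 + norm x) ^ N * (1 + norm (y - x)) ^ N) * norm (g (y - x)) * norm (k x)"
      by (intro mult_right_mono one_plus_norm_le) auto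
    also have "\<dots> = ((1 + norm (y - x)) ^ N * norm (g (y - x))) * ((1 + norm x) ^ N * norm (k x))"
      by (simp add: mult_ac)
    also have "\<dots> \<le> B * ((1 + norm x) ^ N * norm (k x))"
      by (intro mult_right_mono g) auto
    finally show "norm ((1 + norm y) ^ N *\<^sub>R (k x * g (y - x))) \<le> B * ((1 + norm x) ^ N * norm (k x))" .
  qed
  finally show ?thesis by simp
qed

lemma schwartz_conv:
  assumes k: "rapid k" and h: "h \<in> schwartz"
  shows "conv k h \<in> schwartz"
  unfolding schwartz_iff
proof (intro conjI allI)
  note bs = schwartz_bsmooth[OF h] and int = rapid_integrable[OF k]
  show "smooth (conv k h)" by (rule smooth_conv[OF bs int])
  fix N "is"
  obtain B where "\<And>x. (1 + norm x) ^ N * norm (partials is h x) \<le> B"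
    using h unfolding schwartz_iff by metis
  from conv_weight_le[OF k this]
  show "\<exists>B. \<forall>x. (1 + norm x) ^ N * norm (partials is (conv k h) x) \<le> B"
    unfolding partials_conv[OF bs int] by blast
qed

lemma simple_function_finite_range: "simple_function lborel s \<Longrightarrow> finite (range s)"
  by (simp add: simple_function_def)

text \<open>The coefficients do not depend on \<open>F\<close>. The same ones serve for the pairing
  of \<open>T\<close> with translates and for every derivative of the approximating sum, which is
  why both can be compared with one finite linear combination.\<close>

lemma integral_simple_compose:
  fixes k :: "'a::euclidean_space \<Rightarrow> complex" and F :: "'b \<Rightarrow> complex"
  assumes s: "simple_function lborel s" and k: "integrable lborel k"
  shows "(\<integral>x. k x * F (s x) \<partial>lborel) = (\<Sum>c\<in>range s. (\<integral>x. indicator (s -` {c}) x *\<^sub>R k x \<partial>lborel) * F c)"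
    and "integrable lborel (\<lambda>x. k x * F (s x))"
proof -
  note fin = simple_function_finite_range[OF s]
  have meas: "s -` {c} \<in> sets lborel" for c
    using simple_functionD(2)[OF s, of "{c}"] by simp
  have eq: "k x * F (s x) = (\<Sum>c\<in>range s. (indicator (s -` {c}) x *\<^sub>R k x) * F c)" for x
  proof -
    have "(\<Sum>c\<in>range s. (indicator (s -` {c}) x *\<^sub>R k x) * F c) = (\<Sum>c\<in>range s. if c = s x then k x * F c else 0)"
      by (intro sum.cong) (auto simp: indicator_def)
    then show ?thesis using fin by simp
  qed
  have int: "integrable lborel (\<lambda>x. (indicator (s -` {c}) x *\<^sub>R k x) * F c)" for c
    using integrable_mult_indicator[OF meas k] by (rule integrable_mult_left)
  show "integrable lborel (\<lambda>x. k x * F (s x))"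
    unfolding eq by (rule Bochner_Integration.integrable_sum) (rule int)
  show "(\<integral>x. k x * F (s x) \<partial>lborel) = (\<Sum>c\<in>range s. (\<integral>x. indicator (s -` {c}) x *\<^sub>R k x \<partial>lborel) * F c)"
    unfolding eq using int integrable_mult_indicator[OF meas k]
    by (subst Bochner_Integration.integral_sum) (auto simp del: mult_scaleR_left)
qed

lemma integrable_rapid_growth:
  fixes k g :: "real ^ 'd::finite \<Rightarrow> complex"
  assumes k: "rapid k" and g: "g \<in> borel_measurable borel" and le: "\<And>x. norm (g x) \<le> A * (1 + norm x) ^ N"
  shows "integrable lborel (\<lambda>x. k x * g x)"
proof (rule Bochner_Integration.integrable_bound)
  show "integrable lborel (\<lambda>x. A * ((1 + norm x) ^ N * norm (k x)))"
    using k by (auto simp: rapid_def)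
  show "(\<lambda>x. k x * g x) \<in> borel_measurable lborel"
    using k g by (auto simp: rapid_def)
  have "norm (k x * g x) \<le> norm (A * ((1 + norm x) ^ N * norm (k x)))" for x
    using mult_right_mono[OF order_trans[OF le abs_ge_self], of "norm (k x)" x]
    by (simp add: norm_mult abs_mult mult_ac)
  then show "AE x in lborel. norm (k x * g x) \<le> norm (A * ((1 + norm x) ^ N * norm (k x)))"
    by simp
qed

text \<open>The identity is a limit of simple functions \<open>s\<^sub>i\<close> with \<open>\<bar>s\<^sub>i x\<bar> \<le> 2 \<bar>x\<bar>\<close>, and both sides are
  finite sums when the translation by \<open>x\<close> is replaced by the translation by \<open>s\<^sub>i x\<close>.\<close>

theorem tempered_conv:
  fixes k h :: "real ^ 'd::finite \<Rightarrow> complex"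
  assumes T: "T \<in> tempered_distributions" and h: "h \<in> schwartz" and k: "rapid k"
  shows "T (conv k h) = (\<integral>x. k x * T (\<lambda>y. h (y - x)) \<partial>lborel)"
    and "integrable lborel (\<lambda>x. k x * T (\<lambda>y. h (y - x)))"
proof -
  define g where "g x = T (\<lambda>y. h (y - x))" for x
  have gcont: "continuous_on UNIV g"
    unfolding g_def by (rule tempered_translate_continuous[OF T h])
  have gmeas: "g \<in> borel_measurable borel"
    by (intro borel_measurable_continuous_onI gcont)
  obtain N0 A0 where "\<And>x. norm (g x) \<le> A0 * (1 + norm x) ^ N0"
    unfolding g_def using tempered_translate_growth[OF T h] by blast
  then have intg: "integrable lborel (\<lambda>x. k x * g x)"
    by (rule integrable_rapid_growth[OF k gmeas])
  then show "integrable lborel (\<lambda>x. k x * T (\<lambda>y. h (y - x)))"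
    by (simp add: g_def)
  obtain N1 A1 where A1: "0 \<le> A1" and
    diff: "\<And>x s. norm (g x - g s) \<le> A1 * (norm (x - s) * (1 + norm x + norm s) ^ N1)"
    unfolding g_def by (rule tempered_translate_diff[OF T h]) blast
  obtain N2 A2 where A2: "0 \<le> A2"
    and TA: "\<And>\<phi> B. \<phi> \<in> schwartz \<Longrightarrow>
       (\<And>is x. length is \<le> N2 \<Longrightarrow> (1 + norm x) ^ N2 * norm (partials is \<phi> x) \<le> B) \<Longrightarrow> norm (T \<phi>) \<le> A2 * B"
    by (rule tempered_bound[OF T]) blast
  define C where "C = CARD('d) * schwartz_norm (Suc N2) h"
  have C0: "0 \<le> C" unfolding C_def using schwartz_norm_nonneg[OF h] by simp
  have intk: "integrable lborel k" by (rule rapid_integrable[OF k])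
  have kmeas[measurable]: "k \<in> borel_measurable borel" using k by (simp add: rapid_def)
  obtain s :: "nat \<Rightarrow> real ^ 'd \<Rightarrow> real ^ 'd" where
    s: "\<And>i. simple_function lborel (s i)" "\<And>x. (\<lambda>i. s i x) \<longlonglongrightarrow> x" "\<And>i x. norm (s i x) \<le> 2 * norm x"
    using borel_measurable_implies_sequence_metric[of "\<lambda>x::real^'d. x" lborel 0] by auto
  \<comment> \<open>Common form of both errors: the Lipschitz bounds for translates of
    \<open>h\<close> and for \<open>g\<close> lead to it with different exponents \<open>M\<close>.
    By \<open>norm (s i x) \<le> 2 * norm x\<close> it has an integrable majorant that does not
    depend on \<open>i\<close>.\<close>
  define E where "E M i x = norm (k x) * (norm (x - s i x) * (1 + norm x + norm (s i x)) ^ M)" for M i x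
  have Emeas[measurable]: "E M i \<in> borel_measurable lborel" for M i
  proof -
    have [measurable]: "s i \<in> borel_measurable lborel"
      using s(1) borel_measurable_simple_function by blast
    show ?thesis unfolding E_def by measurable
  qed
  have Ebound: "norm (E M i x) \<le> 3 ^ Suc M * ((1 + norm x) ^ Suc M * norm (k x))" for M i x
  proof -
    have "norm (x - s i x) \<le> norm x + norm (s i x)" by (rule norm_triangle_ineq4)
    then have a: "norm (x - s i x) \<le> 3 * (1 + norm x)" "1 + norm x + norm (s i x) \<le> 3 * (1 + norm x)"
      using s(3)[of i x] norm_ge_zero[of x] by (simp_all add: algebra_simps)
    have "norm (x - s i x) * (1 + norm x + norm (s i x)) ^ M \<le> (3 * (1 + norm x)) * (3 * (1 + norm x)) ^ M"
      by (intro mult_mono power_mono a) auto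
    also have "\<dots> = 3 ^ Suc M * (1 + norm x) ^ Suc M"
      unfolding power_mult_distrib power_Suc by (simp add: mult_ac)
    finally have "norm (k x) * (norm (x - s i x) * (1 + norm x + norm (s i x)) ^ M)
        \<le> norm (k x) * (3 ^ Suc M * (1 + norm x) ^ Suc M)"
      by (rule mult_left_mono) simp
    then show ?thesis
      unfolding E_def by (simp add: abs_mult mult_ac)
  qed
  have Edom: "integrable lborel (\<lambda>x. 3 ^ Suc M * ((1 + norm x) ^ Suc M * norm (k x)))" for M
    using k unfolding rapid_def by (intro Bochner_Integration.integrable_mult_right) blast
  have Eint: "integrable lborel (E M i)" for M i
    by (rule Bochner_Integration.integrable_bound[OF Edom[of M]])
      (use Ebound in \<open>auto intro!: order_trans[OF Ebound]\<close>)
  have Elim: "(\<lambda>i. \<integral>x. E M i x \<partial>lborel) \<longlonglongrightarrow> 0" for M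
  proof -
    have "(\<lambda>i. \<integral>x. E M i x \<partial>lborel) \<longlonglongrightarrow> (\<integral>x. 0 \<partial>(lborel::(real^'d) measure))"
    proof (rule integral_dominated_convergence[OF _ _ Edom[of M]])
      have "(\<lambda>i. E M i x) \<longlonglongrightarrow> norm (k x) * (norm (x - x) * (1 + norm x + norm x) ^ M)" for x
        unfolding E_def by (intro tendsto_intros s)
      then show "AE x in lborel. (\<lambda>i. E M i x) \<longlonglongrightarrow> 0" by simp
    qed (use Ebound in auto)
    then show ?thesis by simp
  qed
  \<comment> \<open>The difference is split at \<open>T \<Phi>\<close>, where \<open>\<Phi>\<close>
    is the finite sum standing in for \<open>conv k h\<close>. Continuity of \<open>T\<close> bounds
    the first part; in the second, \<open>g (s i x)\<close> is compared with \<open>g x\<close>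
    under the integral.\<close>
  have bound: "norm (T (conv k h) - (\<integral>x. k x * g x \<partial>lborel))
      \<le> A2 * (C * (\<integral>x. E N2 i x \<partial>lborel)) + A1 * (\<integral>x. E N1 i x \<partial>lborel)" for i
  proof -
    define a where "a c = (\<integral>x. indicator (s i -` {c}) x *\<^sub>R k x \<partial>lborel)" for c
    define \<Phi> where "\<Phi> y = (\<Sum>c\<in>range (s i). a c * h (y - c))" for y
    note fin = simple_function_finite_range[OF s(1)[of i]]
    note comp = integral_simple_compose[OF s(1)[of i] intk, folded a_def]
    have hs: "(\<lambda>y. h (y - c)) \<in> schwartz" for c by (rule schwartz_translate[OF h])
    have hsm: "smooth h" using h schwartz_smooth by blast
    have \<Phi>S: "\<Phi> \<in> schwartz"
      unfolding \<Phi>_def by (intro schwartz_sum fin schwartz_cmult hs)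
    have T\<Phi>: "T \<Phi> = (\<integral>x. k x * g (s i x) \<partial>lborel)"
      unfolding \<Phi>_def comp(1) by (subst tempered_sum[OF T fin hs]) (simp add: g_def)
    have p\<Phi>: "partials is \<Phi> y = (\<integral>x. k x * partials is h (y - s i x) \<partial>lborel)" for "is" y
      unfolding \<Phi>_def comp(1)[of "\<lambda>c. partials is h (y - c)"]
      by (subst partials_sum[OF fin])
        (auto simp: partials_cmult smooth_translate[OF hsm] intro!: smooth_cmult)
    have "norm (T (\<lambda>y. conv k h y - \<Phi> y)) \<le> A2 * (C * (\<integral>x. E N2 i x \<partial>lborel))"
    proof (rule TA)
      show "(\<lambda>y. conv k h y - \<Phi> y) \<in> schwartz"
        by (intro schwartz_diff schwartz_conv k h \<Phi>S)
      fix "is" :: "'d list" and y :: "real ^ 'd" assume len: "length is \<le> N2"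
      have i1: "integrable lborel (\<lambda>x. k x * partials is h (y - x))"
      proof -
        obtain B where "\<And>x. norm (partials is h x) \<le> B"
          using bsmoothD(2)[OF schwartz_bsmooth[OF h]] by metis
        then show ?thesis
          by (intro integrable_mult_bounded[OF intk] measurable_reflect smooth_measurable smooth_partials hsm)
      qed
      have "partials is (\<lambda>y. conv k h y - \<Phi> y) y
          = (\<integral>x. k x * partials is h (y - x) \<partial>lborel) - (\<integral>x. k x * partials is h (y - s i x) \<partial>lborel)"
        using schwartz_smooth[OF \<Phi>S] schwartz_smooth[OF schwartz_conv[OF k h]]
        by (simp add: partials_diff p\<Phi> partials_conv[OF schwartz_bsmooth[OF h] intk])
          (simp add: conv_def)
      also have "\<dots> = (\<integral>x. k x * (partials is h (y - x) - partials is h (y - s i x)) \<partial>lborel)"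
        using i1 comp(2)[of "\<lambda>c. partials is h (y - c)"]
        by (simp add: right_diff_distrib)
      finally have "(1 + norm y) ^ N2 * norm (partials is (\<lambda>y. conv k h y - \<Phi> y) y)
         = norm (\<integral>x. (1 + norm y) ^ N2 *\<^sub>R (k x * (partials is h (y - x) - partials is h (y - s i x))) \<partial>lborel)"
        by simp
      also have "\<dots> \<le> (\<integral>x. C * E N2 i x \<partial>lborel)"
      proof (rule norm_integral_le)
        show "integrable lborel (\<lambda>x. C * E N2 i x)" using Eint by simp
        fix x
        have "norm ((1 + norm y) ^ N2 *\<^sub>R (k x * (partials is h (y - x) - partials is h (y - s i x))))
          = norm (k x) * ((1 + norm y) ^ N2 * norm (partials is h (y - x) - partials is h (y - s i x)))"
          by (simp add: norm_mult)
        also have "\<dots> \<le> norm (k x) * (C * (norm (x - s i x) * (1 + norm x + norm (s i x)) ^ N2))"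
          unfolding C_def by (intro mult_left_mono schwartz_translate_diff_weight[OF h len]) auto
        finally show "norm ((1 + norm y) ^ N2 *\<^sub>R (k x * (partials is h (y - x) - partials is h (y - s i x))))
          \<le> C * E N2 i x" by (simp add: E_def mult_ac)
      qed
      finally show "(1 + norm y) ^ N2 * norm (partials is (\<lambda>y. conv k h y - \<Phi> y) y) \<le> C * (\<integral>x. E N2 i x \<partial>lborel)"
        by simp
    qed
    then have 1: "norm (T (conv k h) - T \<Phi>) \<le> A2 * (C * (\<integral>x. E N2 i x \<partial>lborel))"
      using tempered_linear(3)[OF T schwartz_conv[OF k h] \<Phi>S] by simp
    have "T \<Phi> - (\<integral>x. k x * g x \<partial>lborel) = (\<integral>x. k x * (g (s i x) - g x) \<partial>lborel)"
      unfolding T\<Phi> using comp(2)[of g] intg by (simp add: right_diff_distrib)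
    also have "norm \<dots> \<le> (\<integral>x. A1 * E N1 i x \<partial>lborel)"
    proof (rule norm_integral_le)
      show "integrable lborel (\<lambda>x. A1 * E N1 i x)" using Eint by simp
      show "norm (k x * (g (s i x) - g x)) \<le> A1 * E N1 i x" for x
        using mult_left_mono[OF diff[of x "s i x"], of "norm (k x)"]
        by (simp add: E_def norm_mult norm_minus_commute mult_ac)
    qed
    finally have 2: "norm (T \<Phi> - (\<integral>x. k x * g x \<partial>lborel)) \<le> A1 * (\<integral>x. E N1 i x \<partial>lborel)"
      by simp
    have "norm (T (conv k h) - (\<integral>x. k x * g x \<partial>lborel))
        \<le> norm (T (conv k h) - T \<Phi>) + norm (T \<Phi> - (\<integral>x. k x * g x \<partial>lborel))"
      by norm
    with 1 2 show ?thesis by linarith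
  qed
  have "(\<lambda>i. A2 * (C * (\<integral>x. E N2 i x \<partial>lborel)) + A1 * (\<integral>x. E N1 i x \<partial>lborel)) \<longlonglongrightarrow> A2 * (C * 0) + A1 * 0"
    by (intro tendsto_intros Elim)
  then have "norm (T (conv k h) - (\<integral>x. k x * g x \<partial>lborel)) \<le> A2 * (C * 0) + A1 * 0"
    by (rule LIMSEQ_le_const) (use bound in blast)
  then show "T (conv k h) = (\<integral>x. k x * T (\<lambda>y. h (y - x)) \<partial>lborel)"
    by (simp add: g_def)
qed

section \<open>Integrability of Schwartz functions\<close>

lemma integrable_inverse_one_plus_square: "integrable lborel (\<lambda>x::real. inverse (1 + x\<^sup>2))"
  using integrable_inverse_1_plus_square by (simp add: set_integrable_def einterval_def)

text \<open>Since each coordinate is bounded by \<open>norm x\<close>, the power (1 + |x|)^(2d)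
  dominates the product of the factors 1 + x_b^2, and the integral splits into integrals over the
  line. This is the origin of the exponent \<open>2 * CARD('d)\<close> throughout.\<close>

lemma integrable_one_plus_norm:
  "integrable lborel (\<lambda>x::real ^ 'd::finite. inverse ((1 + norm x) ^ (2 * CARD('d))))"
proof (rule integrableI_bounded)
  have "(\<integral>\<^sup>+(x::real^'d). ennreal (norm (inverse ((1 + norm x) ^ (2 * CARD('d))))) \<partial>lborel)
     \<le> (\<integral>\<^sup>+(x::real^'d). (\<Prod>b\<in>Basis. ennreal (inverse (1 + (x \<bullet> b)\<^sup>2))) \<partial>lborel)"
  proof (rule nn_integral_mono)
    fix x :: "real ^ 'd"
    have "(\<Prod>b\<in>(Basis::(real^'d) set). 1 + (x \<bullet> b)\<^sup>2) \<le> (\<Prod>b\<in>(Basis::(real^'d) set). (1 + norm x)\<^sup>2)"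
    proof (rule prod_mono, intro conjI)
      fix b :: "real ^ 'd" assume "b \<in> Basis"
      then have "\<bar>x \<bullet> b\<bar> \<le> norm x" by (rule Basis_le_norm)
      then have "(x \<bullet> b)\<^sup>2 \<le> (norm x)\<^sup>2" by (metis abs_le_square_iff abs_norm_cancel)
      then have "1 + (x \<bullet> b)\<^sup>2 \<le> 1 + (norm x)\<^sup>2 + 2 * norm x"
        using norm_ge_zero[of x] by linarith
      then show "1 + (x \<bullet> b)\<^sup>2 \<le> (1 + norm x)\<^sup>2" by (simp add: power2_eq_square algebra_simps)
    qed auto
    also have "\<dots> = (1 + norm x) ^ (2 * CARD('d))"
      by (simp add: power_mult)
    finally have "(\<Prod>b\<in>(Basis::(real^'d) set). 1 + (x \<bullet> b)\<^sup>2) \<le> (1 + norm x) ^ (2 * CARD('d))" .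
    moreover have "0 < (\<Prod>b\<in>(Basis::(real^'d) set). 1 + (x \<bullet> b)\<^sup>2)"
      by (rule prod_pos) (auto intro: add_pos_nonneg)
    ultimately have "inverse ((1 + norm x) ^ (2 * CARD('d))) \<le> (\<Prod>b\<in>Basis. inverse (1 + (x \<bullet> b)\<^sup>2))"
      using le_imp_inverse_le prod_inversef[of "\<lambda>b. 1 + (x \<bullet> b)\<^sup>2" Basis] by (simp add: o_def)
    then show "ennreal (norm (inverse ((1 + norm x) ^ (2 * CARD('d))))) \<le> (\<Prod>b\<in>Basis. ennreal (inverse (1 + (x \<bullet> b)\<^sup>2)))"
      by (subst prod_ennreal) (auto intro!: ennreal_leI)
  qed
  also have "\<dots> = (\<Prod>b\<in>(Basis::(real^'d) set). \<integral>\<^sup>+x. ennreal (inverse (1 + x\<^sup>2)) \<partial>lborel)"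
    by (rule nn_integral_lborel_prod) auto
  also have "\<dots> < \<infinity>"
    using integrable_inverse_one_plus_square
    by (simp add: integrable_iff_bounded less_top[symmetric] power_eq_top_ennreal)
  finally show "(\<integral>\<^sup>+(x::real^'d). ennreal (norm (inverse ((1 + norm x) ^ (2 * CARD('d))))) \<partial>lborel) < \<infinity>" .
qed auto

text \<open>A Schwartz function can spare \<open>2 * CARD('d)\<close> further powers of the weight,
  and these pay for the integrability.\<close>

lemma schwartz_rapid:
  fixes f :: "real ^ 'd::finite \<Rightarrow> complex"
  assumes f: "f \<in> schwartz"
  shows "rapid f"
  unfolding rapid_def
proof (intro conjI allI)
  show m: "f \<in> borel_measurable borel" using f schwartz_smooth smooth_measurable by blast
  fix N
  let ?D = "2 * CARD('d)"
  obtain B where B: "\<And>x. (1 + norm x) ^ (N + ?D) * norm (partials [] f x) \<le> B"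
    using f unfolding schwartz_iff by metis
  show "integrable lborel (\<lambda>x. (1 + norm x) ^ N * norm (f x))"
  proof (rule Bochner_Integration.integrable_bound)
    show "integrable lborel (\<lambda>x::real^'d. B * inverse ((1 + norm x) ^ ?D))"
      using integrable_one_plus_norm by (rule Bochner_Integration.integrable_mult_right)
    show "(\<lambda>x. (1 + norm x) ^ N * norm (f x)) \<in> borel_measurable lborel" using m by auto
    have le: "(1 + norm x) ^ N * norm (f x) \<le> B * inverse ((1 + norm x) ^ ?D)" for x
    proof -
      have "(1 + norm x) ^ ?D > 0" by (simp add: add_pos_nonneg)
      then show ?thesis using B[of x] by (simp add: power_add field_simps)
    qed
    then have "\<bar>(1 + norm x) ^ N * norm (f x)\<bar> \<le> \<bar>B * inverse ((1 + norm x) ^ ?D)\<bar>" for x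
    proof -
      have "0 \<le> (1 + norm x) ^ N * norm (f x)" by simp
      with le[of x] show ?thesis by linarith
    qed
    then have "norm ((1 + norm x) ^ N * norm (f x)) \<le> norm (B * inverse ((1 + norm x) ^ ?D))" for x
      unfolding real_norm_def .
    then show "AE x in lborel. norm ((1 + norm x) ^ N * norm (f x)) \<le> norm (B * inverse ((1 + norm x) ^ ?D))"
      by (intro always_eventually allI)
  qed
qed

section \<open>The Fourier transform of test functions\<close>

lemma integral_lborel_affine:
  fixes f :: "'a::euclidean_space \<Rightarrow> 'b::{banach, second_countable_topology}"
  assumes [measurable]: "f \<in> borel_measurable borel" and c: "c \<noteq> 0"
  shows "(\<integral>x. f x \<partial>lborel) = \<bar>c\<bar> ^ DIM('a) *\<^sub>R (\<integral>x. f (t + c *\<^sub>R x) \<partial>lborel)"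
  by (subst lborel_affine[OF c, of t]) (simp add: integral_density integral_distr)

lemma nn_integral_lborel_affine:
  fixes f :: "'a::euclidean_space \<Rightarrow> ennreal"
  assumes [measurable]: "f \<in> borel_measurable borel" and c: "c \<noteq> 0"
  shows "(\<integral>\<^sup>+x. f x \<partial>lborel) = ennreal (\<bar>c\<bar> ^ DIM('a)) * (\<integral>\<^sup>+x. f (t + c *\<^sub>R x) \<partial>lborel)"
  by (subst lborel_affine[OF c, of t])
    (simp add: nn_integral_density nn_integral_distr nn_integral_cmult ennreal_power)

lemma integrable_lborel_affine:
  fixes f :: "'a::euclidean_space \<Rightarrow> 'b::{banach, second_countable_topology}"
  assumes f: "integrable lborel f" and c: "c \<noteq> 0"
  shows "integrable lborel (\<lambda>x. f (t + c *\<^sub>R x))"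
proof -
  have [measurable]: "f \<in> borel_measurable borel" using f by auto
  have pos: "\<bar>c\<bar> ^ DIM('a) > 0" using c by simp
  have "(\<integral>\<^sup>+x. ennreal (norm (f x)) \<partial>lborel) < \<infinity>" using f by (simp add: integrable_iff_bounded)
  then have "(\<integral>\<^sup>+x. ennreal (norm (f (t + c *\<^sub>R x))) \<partial>lborel) < \<infinity>"
    using pos by (subst (asm) nn_integral_lborel_affine[OF _ c, of _ t])
      (auto simp: ennreal_mult_less_top)
  then show ?thesis by (simp add: integrable_iff_bounded)
qed

lemma test_functions_iff:
  fixes f :: "real ^ 'd::finite \<Rightarrow> complex"
  shows "f \<in> test_functions \<longleftrightarrow> smooth f \<and> (\<exists>R. \<forall>x. R < norm x \<longrightarrow> f x = 0)"
proof (intro iffI conjI)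
  assume f: "f \<in> test_functions"
  then show "smooth f" by (simp add: test_functions_def)
  from f have "bounded (supp f)" by (simp add: test_functions_def compact_imp_bounded)
  then obtain R where R: "\<And>x. x \<in> supp f \<Longrightarrow> norm x \<le> R" by (auto simp: bounded_iff)
  have "f x = 0" if "R < norm x" for x
    using R[of x] closure_subset[of "{x. f x \<noteq> 0}"] that by (fastforce simp: supp_def)
  then show "\<exists>R. \<forall>x. R < norm x \<longrightarrow> f x = 0" by blast
next
  assume f: "smooth f \<and> (\<exists>R. \<forall>x. R < norm x \<longrightarrow> f x = 0)"
  then obtain R where R: "\<And>x. R < norm x \<Longrightarrow> f x = 0" by blast
  have "{x. f x \<noteq> 0} \<subseteq> cball 0 R" using R by force
  then have "bounded {x. f x \<noteq> 0}" using bounded_cball bounded_subset by blast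
  with f show "f \<in> test_functions"
    by (simp add: test_functions_def supp_def compact_closure)
qed

lemma test_smooth: "f \<in> test_functions \<Longrightarrow> smooth f"
  by (simp add: test_functions_def)

lemma test_support:
  fixes f :: "real ^ 'd::finite \<Rightarrow> complex"
  assumes "f \<in> test_functions"
  obtains R where "0 < R" "\<And>x. R < norm x \<Longrightarrow> f x = 0"
proof -
  obtain R where "\<And>x. R < norm x \<Longrightarrow> f x = 0" using assms test_functions_iff by metis
  then show ?thesis by (intro that[of "max R 1"]) auto
qed

lemma partials_zero_outside:
  fixes f :: "real ^ 'd::finite \<Rightarrow> complex"
  assumes R: "\<And>x. R < norm x \<Longrightarrow> f x = 0"
  shows "R < norm x \<Longrightarrow> partials is f x = 0"
proof (induction "is" arbitrary: x)
  case (Cons i "is")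
  have "(partials is f has_derivative (\<lambda>v. 0)) (at x)"
  proof (rule has_derivative_transform_within_open[where s = "{x. R < norm x}"])
    show "((\<lambda>x. 0) has_derivative (\<lambda>v. 0)) (at x)" by simp
    show "open {x::real^'d. R < norm x}" by (intro open_Collect_less continuous_intros)
  qed (use Cons in auto)
  from partials_eqI[OF this, of i] show ?case by simp
qed (use R in auto)

lemma test_partials:
  fixes f :: "real ^ 'd::finite \<Rightarrow> complex"
  shows "f \<in> test_functions \<Longrightarrow> partials is f \<in> test_functions"
  unfolding test_functions_iff using smooth_partials partials_zero_outside by metis

lemma test_schwartz:
  fixes f :: "real ^ 'd::finite \<Rightarrow> complex"
  assumes f: "f \<in> test_functions"
  shows "f \<in> schwartz"
  unfolding schwartz_iff
proof (intro conjI allI)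
  show "smooth f" by (rule test_smooth[OF f])
  fix N :: nat and "is" :: "'d list"
  let ?g = "\<lambda>x. (1 + norm x) ^ N * norm (partials is f x)"
  obtain R where R: "0 < R" "\<And>x. R < norm x \<Longrightarrow> f x = 0" using test_support[OF f] by blast
  have "continuous_on (cball 0 R) ?g"
    by (intro continuous_intros smooth_continuous smooth_partials test_smooth f)
  then have "bounded (?g ` cball 0 R)"
    by (intro compact_imp_bounded compact_continuous_image) auto
  then obtain B where "\<And>x. x \<in> cball 0 R \<Longrightarrow> norm (?g x) \<le> B"
    unfolding bounded_iff by blast
  then have B: "?g x \<le> B" if "norm x \<le> R" for x
    using that by (metis abs_ge_self mem_cball_0 order_trans real_norm_def)
  have "?g x \<le> \<bar>B\<bar>" for x
    using B[of x] partials_zero_outside[of R f x "is", OF R(2)] by (cases "norm x \<le> R") auto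
  then show "\<exists>B. \<forall>x. ?g x \<le> B" by blast
qed

lemma test_mult:
  fixes f m :: "real ^ 'd::finite \<Rightarrow> complex"
  shows "f \<in> test_functions \<Longrightarrow> smooth m \<Longrightarrow> (\<lambda>x. m x * f x) \<in> test_functions"
  unfolding test_functions_iff using smooth_mult mult_zero_right by metis

lemma test_cmult:
  fixes f :: "real ^ 'd::finite \<Rightarrow> complex"
  shows "f \<in> test_functions \<Longrightarrow> (\<lambda>x. c * f x) \<in> test_functions"
  using test_mult smooth_const by blast

lemma test_diff:
  fixes f g :: "real ^ 'd::finite \<Rightarrow> complex"
  assumes f: "f \<in> test_functions" and g: "g \<in> test_functions"
  shows "(\<lambda>x. f x - g x) \<in> test_functions"
proof -
  obtain R R' where "\<And>x. R < norm x \<Longrightarrow> f x = 0" "\<And>x. R' < norm x \<Longrightarrow> g x = 0"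
    using f g test_support by metis
  then have "f x - g x = 0" if "max R R' < norm x" for x using that by auto
  then show ?thesis
    unfolding test_functions_iff using smooth_diff[OF test_smooth[OF f] test_smooth[OF g]] by blast
qed

lemma test_scale:
  fixes f :: "real ^ 'd::finite \<Rightarrow> complex"
  assumes f: "f \<in> test_functions" and c: "0 < c"
  shows "(\<lambda>x. f (c *\<^sub>R x)) \<in> test_functions"
proof -
  obtain R where "\<And>x. R < norm x \<Longrightarrow> f x = 0" using test_support[OF f] by metis
  then have "f (c *\<^sub>R x) = 0" if "R / c < norm x" for x
    using that c by (simp add: field_simps)
  then show ?thesis
    unfolding test_functions_iff using smooth_affine[OF test_smooth[OF f], of c 0] by auto
qed

section \<open>The Fourier integral without the normalising constant\<close>

definition FI :: "(real ^ 'd::finite \<Rightarrow> complex) \<Rightarrow> real ^ 'd \<Rightarrow> complex" where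
  "FI g \<xi> = (\<integral>x. exp (- \<i> * complex_of_real (x \<bullet> \<xi>)) * g x \<partial>lborel)"

lemma norm_exp_i [simp]: "norm (exp (- (\<i> * complex_of_real t))) = 1" "norm (exp (\<i> * complex_of_real t)) = 1"
  by (simp_all add: norm_exp_eq_Re)

lemma test_integrable:
  fixes g :: "real ^ 'd::finite \<Rightarrow> complex"
  shows "g \<in> test_functions \<Longrightarrow> integrable lborel g"
  by (rule rapid_integrable[OF schwartz_rapid[OF test_schwartz]])

lemma test_measurable:
  fixes g :: "real ^ 'd::finite \<Rightarrow> complex"
  shows "g \<in> test_functions \<Longrightarrow> g \<in> borel_measurable borel"
  by (rule smooth_measurable[OF test_smooth])

lemma integrable_exp_mult:
  fixes g :: "real ^ 'd::finite \<Rightarrow> complex"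
  assumes "integrable lborel g"
  shows "integrable lborel (\<lambda>x. exp (- \<i> * complex_of_real (x \<bullet> \<xi>)) * g x)"
proof -
  have "integrable lborel (\<lambda>x. g x * exp (- \<i> * complex_of_real (x \<bullet> \<xi>)))"
    by (rule integrable_mult_bounded[OF assms, where B = 1]) auto
  then show ?thesis by (simp add: mult.commute)
qed

lemma exp_i_taylor:
  "norm (exp (- \<i> * complex_of_real t) - 1 + \<i> * complex_of_real t) \<le> t\<^sup>2"
proof -
  have "norm (exp (\<i> * complex_of_real (- t)) - (\<Sum>k\<le>1. (\<i> * complex_of_real (- t)) ^ k / fact k))
     \<le> \<bar>- t\<bar> ^ Suc 1 / fact (Suc 1)"
    by (rule iexp_approx1)
  also have "\<dots> \<le> t\<^sup>2"
    by (simp add: power2_eq_square fact_numeral) 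
  finally show ?thesis by (simp add: algebra_simps)
qed

text \<open>The phase satisfies |exp(-it) - 1 + it| \<le> t^2, so a second moment of
  \<open>g\<close> dominates the remainder.\<close>

lemma FI_has_derivative:
  fixes g :: "real ^ 'd::finite \<Rightarrow> complex"
  assumes g: "g \<in> test_functions"
  shows "(FI g has_derivative (\<lambda>v. \<Sum>i\<in>UNIV. v $ i *\<^sub>R FI (\<lambda>x. (- \<i> * complex_of_real (x $ i)) * g x) \<xi>)) (at \<xi>)"
  unfolding FI_def
proof (rule has_derivative_integral_quadratic)
  let ?e = "\<lambda>x \<xi>. exp (- \<i> * complex_of_real (x \<bullet> \<xi>))"
  show "integrable lborel (\<lambda>x. ?e x \<xi> * g x)" for \<xi>
    by (intro integrable_exp_mult test_integrable g)
  have "rapid g" by (intro schwartz_rapid test_schwartz g)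
  then show "integrable lborel (\<lambda>x. (1 + norm x)\<^sup>2 * norm (g x))" by (simp add: rapid_def)
  show "integrable lborel (\<lambda>x. ?e x \<xi> * ((- \<i> * complex_of_real (x $ i)) * g x))" for i
    by (intro integrable_exp_mult test_integrable test_mult g smooth_cmult smooth_component)
  fix v x :: "real ^ 'd"
  have "x \<bullet> v = (\<Sum>i\<in>UNIV. v $ i * x $ i)"
    by (simp add: inner_vec_def mult.commute)
  then have "\<i> * complex_of_real (x \<bullet> v) = (\<Sum>i\<in>UNIV. v $ i *\<^sub>R (\<i> * complex_of_real (x $ i)))"
    by (simp add: sum_distrib_left scaleR_conv_of_real mult_ac)
  then have "?e x (\<xi> + v) * g x - ?e x \<xi> * g x - (\<Sum>i\<in>UNIV. v $ i *\<^sub>R (?e x \<xi> * ((- \<i> * complex_of_real (x $ i)) * g x)))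
     = ?e x \<xi> * g x * (exp (- \<i> * complex_of_real (x \<bullet> v)) - 1 + \<i> * complex_of_real (x \<bullet> v))"
    by (simp add: inner_add_right distrib_left exp_add[symmetric] sum_distrib_left sum_distrib_right
        sum_negf algebra_simps flip: exp_add)
  also have "norm \<dots> \<le> norm (g x) * (x \<bullet> v)\<^sup>2"
    using mult_left_mono[OF exp_i_taylor[of "x \<bullet> v"], of "norm (g x)"] by (simp add: norm_mult)
  also have "norm (g x) * (x \<bullet> v)\<^sup>2 \<le> norm (g x) * (norm x * norm v)\<^sup>2"
    using Cauchy_Schwarz_ineq2[of x v]
    by (intro mult_left_mono) (metis abs_le_square_iff abs_mult abs_norm_cancel, simp)
  also have "norm (g x) * (norm x * norm v)\<^sup>2 \<le> norm (g x) * ((1 + norm x) * norm v)\<^sup>2"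
    by (intro mult_left_mono power_mono mult_right_mono) auto
  also have "\<dots> = (norm v)\<^sup>2 * ((1 + norm x)\<^sup>2 * norm (g x))"
    by (simp add: power_mult_distrib mult_ac)
  finally show "norm (?e x (\<xi> + v) * g x - ?e x \<xi> * g x - (\<Sum>i\<in>UNIV. v $ i *\<^sub>R (?e x \<xi> * ((- \<i> * complex_of_real (x $ i)) * g x))))
     \<le> (norm v)\<^sup>2 * ((1 + norm x)\<^sup>2 * norm (g x))" .
qed

text \<open>Differentiation multiplies \<open>g\<close> by linear factors and so stays within
  Fourier integrals of test functions. Smoothness and decay of all derivatives thus reduce to
  statements of order zero.\<close>

lemma FI_partials_ex:
  fixes g :: "real ^ 'd::finite \<Rightarrow> complex"
  shows "g \<in> test_functions \<Longrightarrow> \<exists>g'\<in>test_functions. partials is (FI g) = FI g'"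
proof (induction "is")
  case (Cons i "is")
  then obtain g' where g': "g' \<in> test_functions" "partials is (FI g) = FI g'" by blast
  have "partials [i] (FI g') = FI (\<lambda>x. (- \<i> * complex_of_real (x $ i)) * g' x)"
    using partials_eqI_sum[OF FI_has_derivative[OF g'(1)]] by blast
  moreover have "(\<lambda>x. (- \<i> * complex_of_real (x $ i)) * g' x) \<in> test_functions"
    by (intro test_mult g' smooth_cmult smooth_component)
  ultimately show ?case using g' by auto
qed auto

lemma smooth_FI:
  fixes g :: "real ^ 'd::finite \<Rightarrow> complex"
  assumes g: "g \<in> test_functions"
  shows "smooth (FI g)"
proof (rule smooth_coinduct[of "\<lambda>f. \<exists>g\<in>test_functions. f = FI g"])
  fix f :: "real ^ 'd \<Rightarrow> complex" assume "\<exists>g\<in>test_functions. f = FI g"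
  then obtain g where g: "g \<in> test_functions" "f = FI g" by blast
  then show "(\<forall>x. f differentiable at x) \<and> (\<forall>i. \<exists>g\<in>test_functions. partials [i] f = FI g)"
    using FI_has_derivative[OF g(1)] FI_partials_ex[OF g(1)] unfolding differentiable_def by blast
qed (use g in blast)

text \<open>Both sides are the \<open>i\<close>-th derivative at \<open>0\<close> of
  \<open>y \<mapsto> \<integral> e\<^bsup>-ix\<xi>\<^esup> g(x + y) dx = e\<^bsup>iy\<xi>\<^esup> FI g \<xi>\<close>.\<close>

lemma FI_partial:
  fixes g :: "real ^ 'd::finite \<Rightarrow> complex"
  assumes g: "g \<in> test_functions"
  shows "FI (partials [i] g) \<xi> = \<i> * complex_of_real (\<xi> $ i) * FI g \<xi>"
proof -
  let ?e = "\<lambda>x. exp (- \<i> * complex_of_real (x \<bullet> \<xi>))"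
  let ?J = "\<lambda>y. \<integral>x. ?e x * g (x + y) \<partial>lborel"
  obtain R where R: "0 < R" "\<And>x. R < norm x \<Longrightarrow> g x = 0" using test_support[OF g] by blast
  obtain B where B: "\<And>i j x. norm (partials [i, j] g x) \<le> B"
    using bsmooth_second_partials[OF schwartz_bsmooth[OF test_schwartz[OF g]]] by blast
  have tr: "(\<lambda>x. g (x + y)) \<in> borel_measurable borel" "integrable lborel (\<lambda>x. g (x + y))" for y
    using test_measurable[OF g] integrable_lborel_affine[OF test_integrable[OF g], of 1 y]
    by (auto simp: add.commute)
  have "((\<lambda>y. \<integral>x. ?e x * g (x + y) \<partial>lborel) has_derivative
      (\<lambda>v. \<Sum>i\<in>UNIV. v $ i *\<^sub>R (\<integral>x. ?e x * partials [i] g x \<partial>lborel))) (at 0)"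
  proof (rule has_derivative_integral_quadratic)
    show "integrable lborel (\<lambda>x. ?e x * g (x + y))" for y
      by (intro integrable_exp_mult tr)
    show "integrable lborel (\<lambda>x. ?e x * partials [i] g x)" for i
      by (intro integrable_exp_mult test_integrable test_partials g)
    \<comment> \<open>The radius is enlarged by 1 because \<open>norm v \<le> 1\<close>: outside
      this ball \<open>g\<close> vanishes at \<open>x\<close> and at \<open>x + v\<close>.\<close>
    show "integrable lborel (\<lambda>x::real^'d. indicator (cball 0 (R + 1)) x * (CARD('d)\<^sup>2 * B))"
      using emeasure_lborel_cball_finite[of "0::real^'d" "R + 1"]
      by (intro integrable_mult_left integrable_real_indicator) auto
    fix v x :: "real ^ 'd" assume v: "norm v \<le> 1"
    have "?e x * g (x + (0 + v)) - ?e x * g (x + 0) - (\<Sum>i\<in>UNIV. v $ i *\<^sub>R (?e x * partials [i] g x))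
      = ?e x * (g (x + v) - g x - (\<Sum>i\<in>UNIV. v $ i *\<^sub>R partials [i] g x))"
      by (simp add: algebra_simps sum_distrib_left)
    also have "norm \<dots> = norm (g (x + v) - g x - (\<Sum>i\<in>UNIV. v $ i *\<^sub>R partials [i] g x))"
      by (simp add: norm_mult)
    also have "\<dots> \<le> (norm v)\<^sup>2 * (indicator (cball 0 (R + 1)) x * (CARD('d)\<^sup>2 * B))"
    proof (cases "norm x \<le> R + 1")
      case True
      then show ?thesis using taylor_remainder_le[OF test_smooth[OF g] B] by simp
    next
      case False
      then have "R < norm x" "R < norm (x + v)"
        using norm_diff_ineq[of x v] v by auto
      then have "g x = 0" "g (x + v) = 0" "\<And>i. partials [i] g x = 0"
        using R partials_zero_outside[of R g x "[i]" for i, OF R(2)] by blast+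
      then show ?thesis using False by (simp del: partials.simps)
    qed
    finally show "norm (?e x * g (x + (0 + v)) - ?e x * g (x + 0) - (\<Sum>i\<in>UNIV. v $ i *\<^sub>R (?e x * partials [i] g x)))
      \<le> (norm v)\<^sup>2 * (indicator (cball 0 (R + 1)) x * (CARD('d)\<^sup>2 * B))" .
  qed
  from partials_eqI_sum[OF this, of i]
  have 1: "partials [i] ?J 0 = FI (partials [i] g) \<xi>" by (simp add: FI_def)
  have J: "?J y = exp (\<i> * complex_of_real (y \<bullet> \<xi>)) * FI g \<xi>" for y
  proof -
    have "FI g \<xi> = (\<integral>x. ?e (y + x) * g (y + x) \<partial>lborel)"
      unfolding FI_def using test_measurable[OF g]
      by (subst integral_lborel_affine[where c = 1 and t = y]) auto
    also have "\<dots> = (\<integral>x. ?e y * (?e x * g (x + y)) \<partial>lborel)"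
      by (intro Bochner_Integration.integral_cong)
        (auto simp: inner_add_left distrib_left exp_add[symmetric] add.commute algebra_simps)
    also have "\<dots> = ?e y * ?J y" by simp
    finally show ?thesis by (simp add: exp_minus field_simps)
  qed
  have "((\<lambda>y. \<i> * complex_of_real (y \<bullet> \<xi>)) has_derivative (\<lambda>v. \<i> * complex_of_real (v \<bullet> \<xi>))) (at 0)"
    by (auto intro!: derivative_eq_intros)
  from has_derivative_compose[OF this DERIV_exp[unfolded has_field_derivative_def]]
  have "((\<lambda>y. exp (\<i> * complex_of_real (y \<bullet> \<xi>))) has_derivative (\<lambda>v. \<i> * complex_of_real (v \<bullet> \<xi>))) (at 0)"
    by simp
  then have "(?J has_derivative (\<lambda>v. \<i> * complex_of_real (v \<bullet> \<xi>) * FI g \<xi>)) (at 0)"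
    unfolding J by (rule has_derivative_mult_left)
  from partials_eqI[OF this, of i]
  have "partials [i] ?J 0 = \<i> * complex_of_real (\<xi> $ i) * FI g \<xi>"
    by (simp add: inner_axis')
  with 1 show ?thesis by simp
qed

text \<open>Each further factor \<open>1 + norm \<xi>\<close> is at most 1 plus the sum of the
  |\<xi>_i|, and |\<xi>_i| is absorbed by passing from \<open>g\<close> to its \<open>i\<close>-th
  derivative.\<close>

lemma FI_decay:
  fixes g :: "real ^ 'd::finite \<Rightarrow> complex"
  assumes "g \<in> test_functions"
  shows "\<exists>B. \<forall>\<xi>. (1 + norm \<xi>) ^ N * norm (FI g \<xi>) \<le> B"
  using assms
proof (induction N arbitrary: g)
  case 0
  have "norm (FI g \<xi>) \<le> (\<integral>x. norm (g x) \<partial>lborel)" for \<xi>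
    unfolding FI_def using test_integrable[OF 0]
    by (intro norm_integral_le) (auto simp: norm_mult)
  then show ?case by auto
next
  case (Suc N)
  obtain B where B: "\<And>\<xi>. (1 + norm \<xi>) ^ N * norm (FI g \<xi>) \<le> B"
    using Suc by blast
  obtain b where b: "\<And>i \<xi>. (1 + norm \<xi>) ^ N * norm (FI (partials [i] g) \<xi>) \<le> b i"
    using Suc.IH[OF test_partials[OF Suc.prems], of "[i]" for i] by metis
  have "(1 + norm \<xi>) ^ Suc N * norm (FI g \<xi>) \<le> B + (\<Sum>i\<in>UNIV. b i)" for \<xi>
  proof -
    have "(1 + norm \<xi>) ^ Suc N * norm (FI g \<xi>) = (1 + norm \<xi>) * ((1 + norm \<xi>) ^ N * norm (FI g \<xi>))"
      by simp
    also have "\<dots> \<le> (1 + (\<Sum>i\<in>UNIV. \<bar>\<xi> $ i\<bar>)) * ((1 + norm \<xi>) ^ N * norm (FI g \<xi>))"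
      using norm_le_l1_cart[of \<xi>] by (intro mult_right_mono) auto
    also have "\<dots> = (1 + norm \<xi>) ^ N * norm (FI g \<xi>)
        + (\<Sum>i\<in>UNIV. \<bar>\<xi> $ i\<bar> * ((1 + norm \<xi>) ^ N * norm (FI g \<xi>)))"
      by (simp only: distrib_right sum_distrib_right mult_1_left)
    also have "\<dots> = (1 + norm \<xi>) ^ N * norm (FI g \<xi>)
        + (\<Sum>i\<in>UNIV. (1 + norm \<xi>) ^ N * norm (FI (partials [i] g) \<xi>))"
      by (simp add: FI_partial[OF Suc.prems] norm_mult mult_ac del: partials.simps)
    also have "\<dots> \<le> B + (\<Sum>i\<in>UNIV. b i)"
      by (intro add_mono sum_mono B b)
    finally show ?thesis .
  qed
  then show ?case by blast
qed

lemma FI_schwartz: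
  fixes g :: "real ^ 'd::finite \<Rightarrow> complex"
  assumes g: "g \<in> test_functions"
  shows "FI g \<in> schwartz"
  unfolding schwartz_iff
proof (intro conjI allI)
  fix N and "is" :: "'d list"
  obtain g' where "g' \<in> test_functions" "partials is (FI g) = FI g'"
    using FI_partials_ex[OF g] by blast
  then show "\<exists>B. \<forall>x. (1 + norm x) ^ N * norm (partials is (FI g) x) \<le> B"
    using FI_decay by metis
qed (rule smooth_FI[OF g])


section \<open>Gaussians and Fourier inversion\<close>

lemma integral_lborel_prod:
  fixes f :: "'a::euclidean_space \<Rightarrow> real \<Rightarrow> complex"
  assumes "\<And>b. b \<in> Basis \<Longrightarrow> integrable lborel (f b)"
  shows "(\<integral>x. (\<Prod>b\<in>Basis. f b (x \<bullet> b)) \<partial>lborel) = (\<Prod>b\<in>Basis. (\<integral>x. f b x \<partial>lborel))"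
    and "integrable lborel (\<lambda>x. \<Prod>b\<in>Basis. f b (x \<bullet> b))"
proof -
  interpret product_sigma_finite "\<lambda>_::'a. lborel :: real measure"
    by standard
  have [measurable]: "b \<in> Basis \<Longrightarrow> f b \<in> borel_measurable borel" for b
    using assms borel_measurable_integrable by fastforce
  have m: "(\<lambda>f. \<Sum>b\<in>Basis. f b *\<^sub>R b) \<in> (\<Pi>\<^sub>M b\<in>(Basis::'a set). lborel) \<rightarrow>\<^sub>M borel"
    by measurable
  have mp: "(\<lambda>x. \<Prod>b\<in>Basis. f b (x \<bullet> b)) \<in> borel_measurable borel"
    by measurable
  have eq: "(\<Prod>b\<in>Basis. f b ((\<Sum>b\<in>Basis. w b *\<^sub>R b) \<bullet> b)) = (\<Prod>b\<in>Basis. f b (w b))" for w :: "'a \<Rightarrow> real"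
    by (intro prod.cong) auto
  show "(\<integral>x. (\<Prod>b\<in>Basis. f b (x \<bullet> b)) \<partial>lborel) = (\<Prod>b\<in>Basis. (\<integral>x. f b x \<partial>lborel))"
    by (subst lborel_eq, subst integral_distr[OF m mp], unfold eq, rule product_integral_prod)
      (use assms in auto)
  show "integrable lborel (\<lambda>x. \<Prod>b\<in>Basis. f b (x \<bullet> b))"
    by (subst lborel_eq, subst integrable_distr_eq[OF m mp], unfold eq, rule product_integrable_prod)
      (use assms in auto)
qed

text \<open>The characteristic function of the standard normal distribution, freed from the
  normalisation of its density.\<close>

lemma gaussian_fourier_1:
  fixes t :: real
  shows "integrable lborel (\<lambda>x. exp (\<i> * complex_of_real (x * t)) * complex_of_real (exp (- x\<^sup>2 / 2)))" (is "integrable _ ?f")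
    and "(\<integral>x. exp (\<i> * complex_of_real (x * t)) * complex_of_real (exp (- x\<^sup>2 / 2)) \<partial>lborel)
      = complex_of_real (sqrt (2 * pi) * exp (- t\<^sup>2 / 2))"
proof -
  let ?c = "sqrt (2 * pi)"
  have c: "?c > 0" by simp
  have dens: "exp (- x\<^sup>2 / 2) = ?c * std_normal_density x" for x
    using c by (simp add: std_normal_density_def)
  have "integrable lborel (\<lambda>x. complex_of_real (std_normal_density x))"
    using integrable_normal_density[of 1 0] by (simp add: integrable_of_real)
  then have "integrable lborel (\<lambda>x. complex_of_real (std_normal_density x) * exp (\<i> * complex_of_real (x * t)))"
    by (rule integrable_mult_bounded[where B = 1]) auto
  then show i: "integrable lborel ?f"
    unfolding dens using integrable_mult_right[of "complex_of_real ?c"] by (fastforce simp: mult_ac)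
  have "complex_of_real (exp (- t\<^sup>2 / 2)) = char std_normal_distribution t"
    by (simp add: char_std_normal_distribution)
  also have "\<dots> = (\<integral>x. std_normal_density x *\<^sub>R exp (\<i> * complex_of_real (t * x)) \<partial>lborel)"
    unfolding char_def by (rule integral_density) auto
  finally have "complex_of_real ?c * complex_of_real (exp (- t\<^sup>2 / 2))
     = (\<integral>x. complex_of_real ?c * (std_normal_density x *\<^sub>R exp (\<i> * complex_of_real (t * x))) \<partial>lborel)"
    by (simp only: integral_mult_right_zero)
  also have "\<dots> = (\<integral>x. ?f x \<partial>lborel)"
    unfolding dens by (intro Bochner_Integration.integral_cong) (auto simp: scaleR_conv_of_real mult_ac)
  finally show "(\<integral>x. ?f x \<partial>lborel) = complex_of_real (sqrt (2 * pi) * exp (- t\<^sup>2 / 2))"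
    by simp
qed

definition gauss :: "'a::euclidean_space \<Rightarrow> complex" where
  "gauss x = complex_of_real (exp (- (norm x)\<^sup>2 / 2))"

lemma gauss_prod: "gauss x = (\<Prod>b\<in>Basis. complex_of_real (exp (- (x \<bullet> b)\<^sup>2 / 2)))"
proof -
  have "(norm x)\<^sup>2 = (\<Sum>b\<in>Basis. (x \<bullet> b)\<^sup>2)"
    unfolding power2_norm_eq_inner by (subst euclidean_inner) (simp add: power2_eq_square)
  then show ?thesis
    unfolding gauss_def by (simp add: exp_sum[symmetric] sum_negf sum_divide_distrib flip: of_real_prod)
qed

lemma gaussian_fourier:
  fixes z :: "'a::euclidean_space"
  shows "integrable lborel (\<lambda>x. exp (\<i> * complex_of_real (x \<bullet> z)) * gauss x)"
    and "(\<integral>x. exp (\<i> * complex_of_real (x \<bullet> z)) * gauss x \<partial>lborel)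
      = complex_of_real (sqrt (2 * pi) ^ DIM('a)) * gauss z"
proof -
  let ?f = "\<lambda>b x. exp (\<i> * complex_of_real (x * (z \<bullet> b))) * complex_of_real (exp (- x\<^sup>2 / 2))"
  have eq: "exp (\<i> * complex_of_real (x \<bullet> z)) * gauss x = (\<Prod>b\<in>Basis. ?f b (x \<bullet> b))" for x
    unfolding gauss_prod prod.distrib
    by (subst euclidean_inner[of x z]) (simp add: exp_sum sum_distrib_left)
  show "integrable lborel (\<lambda>x. exp (\<i> * complex_of_real (x \<bullet> z)) * gauss x)"
    unfolding eq by (rule integral_lborel_prod) (rule gaussian_fourier_1)
  show "(\<integral>x. exp (\<i> * complex_of_real (x \<bullet> z)) * gauss x \<partial>lborel)
      = complex_of_real (sqrt (2 * pi) ^ DIM('a)) * gauss z"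
    unfolding eq by (subst integral_lborel_prod(1), rule gaussian_fourier_1)
      (simp only: gaussian_fourier_1(2), simp add: gauss_prod prod.distrib)
qed

lemma gauss_measurable [measurable]: "gauss \<in> borel_measurable borel"
  unfolding gauss_def[abs_def] by measurable

lemma gauss_integrable: "integrable lborel (gauss :: 'a::euclidean_space \<Rightarrow> complex)"
  using gaussian_fourier(1)[of 0] by simp

lemma gauss_integral: "(\<integral>x. gauss (x::'a::euclidean_space) \<partial>lborel) = complex_of_real (sqrt (2 * pi) ^ DIM('a))"
  using gaussian_fourier(2)[of "0::'a"] by (simp add: gauss_def)

lemma integrable_pair_bound:
  fixes f :: "'a::euclidean_space \<times> 'b::euclidean_space \<Rightarrow> complex"
  assumes f [measurable]: "f \<in> borel_measurable (lborel \<Otimes>\<^sub>M lborel)"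
    and a: "integrable lborel a" and b: "integrable lborel b"
    and le: "\<And>x y. norm (f (x, y)) \<le> a x * (b y :: real)"
  shows "integrable (lborel \<Otimes>\<^sub>M lborel) f"
proof (rule lborel_pair.Fubini_integrable)
  have fx: "integrable lborel (\<lambda>y. f (x, y))" for x
    by (rule Bochner_Integration.integrable_bound[OF integrable_mult_right[OF b, of "a x"]])
      (use le in \<open>auto intro: order_trans[OF le abs_ge_self]\<close>)
  then show "AE x in lborel. integrable lborel (\<lambda>y. f (x, y))" by simp
  have "(\<integral>y. norm (f (x, y)) \<partial>lborel) \<le> a x * (\<integral>y. b y \<partial>lborel)" for x
    using fx b le by (subst integral_mult_right_zero[symmetric]) (intro integral_mono, auto)
  then have "norm (\<integral>y. norm (f (x, y)) \<partial>lborel) \<le> norm (a x * (\<integral>y. b y \<partial>lborel))" for x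
    unfolding real_norm_def by (subst abs_of_nonneg) (auto intro: order_trans[OF _ abs_ge_self])
  then show "integrable lborel (\<lambda>x. \<integral>y. norm (f (x, y)) \<partial>lborel)"
    by (intro Bochner_Integration.integrable_bound[OF integrable_mult_left[OF a, of "\<integral>y. b y \<partial>lborel"]]) auto
qed (rule f)

text \<open>The double integral behind the left-hand side does not converge absolutely in general,
  so a Gaussian factor in \<epsilon> y is inserted. Fubini then turns the inner integral into a
  narrow Gaussian around \<open>\<eta>\<close>. As \<epsilon> tends to 0, dominated convergence
  gives one limit by the integrability of \<open>FI g\<close> and the other by the continuity and
  boundedness of \<open>g\<close>.\<close>

theorem FI_inversion:
  fixes g :: "real ^ 'd::finite \<Rightarrow> complex"
  assumes g: "g \<in> test_functions"
  shows "(\<integral>y. exp (\<i> * complex_of_real (y \<bullet> \<eta>)) * FI g y \<partial>lborel) = complex_of_real ((2 * pi) ^ CARD('d)) * g \<eta>"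
proof -
  let ?e = "\<lambda>y \<eta>. exp (\<i> * complex_of_real (y \<bullet> \<eta>))"
  define \<epsilon> where "\<epsilon> n = inverse (real (Suc n))" for n
  have \<epsilon>: "\<epsilon> n > 0" for n by (simp add: \<epsilon>_def)
  have \<epsilon>lim: "\<epsilon> \<longlonglongrightarrow> 0" unfolding \<epsilon>_def by (rule LIMSEQ_inverse_real_of_nat)
  have gi: "integrable lborel g" and gm[measurable]: "g \<in> borel_measurable borel"
    by (rule test_integrable[OF g], rule test_measurable[OF g])
  have FIi: "integrable lborel (FI g)"
    by (rule rapid_integrable[OF schwartz_rapid[OF FI_schwartz[OF g]]])
  have FIm[measurable]: "FI g \<in> borel_measurable borel"
    using FIi by auto
  have gcont: "continuous_on UNIV g" by (rule smooth_continuous[OF test_smooth[OF g]])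
  define I where "I n = (\<integral>y. gauss (\<epsilon> n *\<^sub>R y) * (?e y \<eta> * FI g y) \<partial>lborel)" for n
  have norm_gauss: "norm (gauss x) \<le> 1" for x :: "real ^ 'd" by (simp add: gauss_def)
  have gauss_scaled: "integrable lborel (\<lambda>y::real^'d. gauss (\<epsilon> n *\<^sub>R y))" for n
    using integrable_lborel_affine[OF gauss_integrable, of "\<epsilon> n" 0] \<epsilon>[of n] by simp
  have l1: "I \<longlonglongrightarrow> (\<integral>y. ?e y \<eta> * FI g y \<partial>lborel)"
    unfolding I_def
  proof (rule integral_dominated_convergence[where w = "\<lambda>y. norm (FI g y)"])
    have "(\<lambda>n. gauss (\<epsilon> n *\<^sub>R y) * (?e y \<eta> * FI g y)) \<longlonglongrightarrow> 1 * (?e y \<eta> * FI g y)" for y :: "real ^ 'd"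
    proof (intro tendsto_mult tendsto_const)
      have "(\<lambda>n. gauss (\<epsilon> n *\<^sub>R y)) \<longlonglongrightarrow> complex_of_real (exp (- (norm (0 *\<^sub>R y))\<^sup>2 / 2))"
        unfolding gauss_def by (intro tendsto_intros \<epsilon>lim) auto
      then show "(\<lambda>n. gauss (\<epsilon> n *\<^sub>R y)) \<longlonglongrightarrow> 1" by simp
    qed
    then show "AE y in lborel. (\<lambda>n. gauss (\<epsilon> n *\<^sub>R y) * (?e y \<eta> * FI g y)) \<longlonglongrightarrow> ?e y \<eta> * FI g y"
      by simp
    show "AE y in lborel. norm (gauss (\<epsilon> n *\<^sub>R y) * (?e y \<eta> * FI g y)) \<le> norm (FI g y)" for n
      using norm_gauss by (auto simp: norm_mult intro!: mult_left_le_one_le)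
  qed (use FIi in auto)
  have "I n = complex_of_real (sqrt (2 * pi) ^ CARD('d)) * (\<integral>w. g (\<eta> + \<epsilon> n *\<^sub>R w) * gauss w \<partial>lborel)" for n
  proof -
    let ?F = "\<lambda>y x. gauss (\<epsilon> n *\<^sub>R y) * (?e y \<eta> * (exp (- \<i> * complex_of_real (x \<bullet> y)) * g x))"
    have "I n = (\<integral>y. (\<integral>x. ?F y x \<partial>lborel) \<partial>lborel)"
      unfolding I_def FI_def by simp
    also have "\<dots> = (\<integral>x. (\<integral>y. ?F y x \<partial>lborel) \<partial>lborel)"
    proof (rule lborel_pair.Fubini_integral[symmetric], rule integrable_pair_bound)
      show "integrable lborel (\<lambda>y::real^'d. norm (gauss (\<epsilon> n *\<^sub>R y) :: complex))"
        by (rule integrable_norm[OF gauss_scaled])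
      show "integrable lborel (\<lambda>x. norm (g x))" using gi by simp
    qed (auto simp: norm_mult)
    also have "\<dots> = (\<integral>x. g x * (\<integral>y. ?e y (\<eta> - x) * gauss (\<epsilon> n *\<^sub>R y) \<partial>lborel) \<partial>lborel)"
      by (subst integral_mult_right_zero[symmetric])
        (intro Bochner_Integration.integral_cong,
         auto simp: inner_diff_right right_diff_distrib exp_diff exp_minus inner_commute field_simps)
    also have "\<dots> = (\<integral>x. g x * (complex_of_real (sqrt (2 * pi) ^ CARD('d)) *
        ((1 / \<epsilon> n) ^ CARD('d) *\<^sub>R gauss ((1 / \<epsilon> n) *\<^sub>R (\<eta> - x)))) \<partial>lborel)"
    proof -
      have "(\<integral>y. ?e y z * gauss (\<epsilon> n *\<^sub>R y) \<partial>lborel) = complex_of_real (sqrt (2 * pi) ^ CARD('d)) *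
        ((1 / \<epsilon> n) ^ CARD('d) *\<^sub>R gauss ((1 / \<epsilon> n) *\<^sub>R z))" for z :: "real ^ 'd"
        using gaussian_fourier(2)[of "(1 / \<epsilon> n) *\<^sub>R z"] \<epsilon>[of n]
        by (subst integral_lborel_affine[where c = "1 / \<epsilon> n" and t = 0]) auto
      then show ?thesis by simp
    qed
    also have "\<dots> = complex_of_real (sqrt (2 * pi) ^ CARD('d)) *
        (\<integral>x. (1 / \<epsilon> n) ^ CARD('d) *\<^sub>R (g x * gauss ((1 / \<epsilon> n) *\<^sub>R (\<eta> - x))) \<partial>lborel)"
      by (subst integral_mult_right_zero[symmetric])
        (intro Bochner_Integration.integral_cong, auto)
    also have "(\<integral>x. (1 / \<epsilon> n) ^ CARD('d) *\<^sub>R (g x * gauss ((1 / \<epsilon> n) *\<^sub>R (\<eta> - x))) \<partial>lborel)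
        = (\<integral>w. g (\<eta> + \<epsilon> n *\<^sub>R w) * gauss w \<partial>lborel)"
      using \<epsilon>[of n]
      by (subst integral_lborel_affine[where c = "\<epsilon> n" and t = \<eta>])
        (auto simp: gauss_def power_divide)
    finally show ?thesis .
  qed
  then have I: "I = (\<lambda>n. complex_of_real (sqrt (2 * pi) ^ CARD('d)) * (\<integral>w. g (\<eta> + \<epsilon> n *\<^sub>R w) * gauss w \<partial>lborel))"
    by (rule ext)
  have l2: "(\<lambda>n. \<integral>w. g (\<eta> + \<epsilon> n *\<^sub>R w) * gauss w \<partial>lborel) \<longlonglongrightarrow> (\<integral>w. g \<eta> * gauss (w::real^'d) \<partial>lborel)"
  proof -
    obtain B where B: "\<And>x. norm (g x) \<le> B"
      using bsmoothD(2)[OF schwartz_bsmooth[OF test_schwartz[OF g]], of "[]"] by auto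
    show ?thesis
    proof (rule integral_dominated_convergence[where w = "\<lambda>w. B * norm (gauss w :: complex)"])
      have "(\<lambda>n. g (\<eta> + \<epsilon> n *\<^sub>R w) * gauss w) \<longlonglongrightarrow> g (\<eta> + 0 *\<^sub>R w) * gauss w" for w :: "real ^ 'd"
        by (intro tendsto_intros isCont_tendsto_compose[of _ g] \<epsilon>lim)
          (use gcont in \<open>auto simp: continuous_on_eq_continuous_at\<close>)
      then show "AE w in lborel. (\<lambda>n. g (\<eta> + \<epsilon> n *\<^sub>R w) * gauss w) \<longlonglongrightarrow> g \<eta> * gauss w" by simp
      show "AE w in lborel. norm (g (\<eta> + \<epsilon> n *\<^sub>R w) * gauss w) \<le> B * norm (gauss w :: complex)" for n
        using B by (auto simp: norm_mult intro!: mult_right_mono)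
      show "integrable lborel (\<lambda>w::real^'d. B * norm (gauss w :: complex))"
        using gauss_integrable by auto
    qed auto
  qed
  have "(\<integral>y. ?e y \<eta> * FI g y \<partial>lborel)
      = complex_of_real (sqrt (2 * pi) ^ CARD('d)) * (\<integral>w. g \<eta> * gauss (w::real^'d) \<partial>lborel)"
    by (rule LIMSEQ_unique[OF l1[unfolded I] tendsto_mult_left[OF l2]])
  \<comment> \<open>One power of sqrt(2 pi) stems from transforming the Gaussian, the other from its
    total mass.\<close>
  also have "\<dots> = complex_of_real ((sqrt (2 * pi) * sqrt (2 * pi)) ^ CARD('d)) * g \<eta>"
    by (simp add: gauss_integral power_mult_distrib mult_ac del: real_sqrt_mult_self)
  finally show ?thesis by simp
qed

section \<open>Uniqueness of regular distributions\<close>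

text \<open>The measures whose densities are the positive and the negative part of \<open>h\<close>
  are finite and equal on boxes. Boxes form a generator stable under intersection and exhaust the
  space, so the measures coincide, and so do their densities almost everywhere.\<close>

lemma AE_eq_0_if_box_integrals_eq_0:
  fixes h :: "'a::euclidean_space \<Rightarrow> real"
  assumes [measurable]: "h \<in> borel_measurable borel"
    and int: "\<And>a b. integrable lborel (\<lambda>x. indicator (box a b) x * h x)"
    and zero: "\<And>a b. (\<integral>x. indicator (box a b) x * h x \<partial>lborel) = 0"
  shows "AE x in lborel. h x = 0"
proof -
  let ?p = "\<lambda>x. ennreal (h x)" and ?m = "\<lambda>x. ennreal (- h x)"
  have aux: "a = b" if "a < \<infinity>" "b < \<infinity>" "enn2real a - enn2real b = 0" for a b :: ennreal
  proof -
    have "ennreal (enn2real a) = ennreal (enn2real b)" using that(3) by simp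
    then show ?thesis
      by (simp only: ennreal_enn2real that(1,2)[unfolded infinity_ennreal_def])
  qed
  have em: "emeasure (density lborel ?p) (box a b) = emeasure (density lborel ?m) (box a b)"
    "emeasure (density lborel ?p) (box a b) \<noteq> \<infinity>" for a b
  proof -
    let ?h = "\<lambda>x. indicator (box a b) x * h x"
    have fin: "(\<integral>\<^sup>+x. ennreal (?h x) \<partial>lborel) < \<infinity>" "(\<integral>\<^sup>+x. ennreal (- ?h x) \<partial>lborel) < \<infinity>"
      using int[of a b] unfolding real_integrable_def by (auto simp: less_top)
    have "enn2real (\<integral>\<^sup>+x. ennreal (?h x) \<partial>lborel) - enn2real (\<integral>\<^sup>+x. ennreal (- ?h x) \<partial>lborel) = 0"
      using real_lebesgue_integral_def[OF int[of a b]] zero[of a b] by simp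
    then have eq: "(\<integral>\<^sup>+x. ennreal (?h x) \<partial>lborel) = (\<integral>\<^sup>+x. ennreal (- ?h x) \<partial>lborel)"
      using fin aux by blast
    have "emeasure (density lborel ?p) (box a b) = (\<integral>\<^sup>+x. ennreal (?h x) \<partial>lborel)"
      "emeasure (density lborel ?m) (box a b) = (\<integral>\<^sup>+x. ennreal (- ?h x) \<partial>lborel)"
      by (auto simp: emeasure_density intro!: nn_integral_cong split: split_indicator)
    with eq fin show "emeasure (density lborel ?p) (box a b) = emeasure (density lborel ?m) (box a b)"
      "emeasure (density lborel ?p) (box a b) \<noteq> \<infinity>" by auto
  qed
  have "density lborel ?p = density lborel ?m"
  proof (rule measure_eqI_generator_eq)
    let ?E = "range (\<lambda>(a, b). box a b::'a set)"
    show "Int_stable ?E"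
      by (auto simp: Int_stable_def box_Int_box)
    show "?E \<subseteq> Pow UNIV" "sets (density lborel ?p) = sigma_sets UNIV ?E" "sets (density lborel ?m) = sigma_sets UNIV ?E"
      by (simp_all add: borel_eq_box)
    let ?A = "\<lambda>n::nat. box (- (real n *\<^sub>R One)) (real n *\<^sub>R One) :: 'a set"
    show "range ?A \<subseteq> ?E" "(\<Union>i. ?A i) = UNIV"
      unfolding UN_box_eq_UNIV by auto
    show "emeasure (density lborel ?p) (?A i) \<noteq> \<infinity>" for i by (rule em)
    show "emeasure (density lborel ?p) X = emeasure (density lborel ?m) X" if "X \<in> ?E" for X
      using that em(1) by auto
  qed
  then have "AE x in lborel. ?p x = ?m x"
    by (intro sigma_finite_measure.density_unique[OF sigma_finite_lborel]) auto
  then show ?thesis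
    by eventually_elim (metis ennreal_eq_0_iff ennreal_inj linorder_le_cases neg_0_le_iff_le neg_le_0_iff_le order_antisym)
qed

lemma continuous_AE_zero:
  fixes g :: "'a::euclidean_space \<Rightarrow> 'b::real_normed_vector"
  assumes g: "continuous_on UNIV g" and ae: "AE x in lebesgue. g x = 0"
  shows "g x = 0"
proof -
  have "closed {x. g x = 0}"
    using continuous_closed_preimage_constant[OF g closed_UNIV, of 0] by simp
  then have "x \<in> {x. g x = 0}"
    by (rule mem_closed_if_AE_lebesgue) (use ae in auto)
  then show ?thesis by simp
qed

text \<open>The bump is taken from the resolution itself: |\<phi>(2x)|^2 is smooth, nonnegative and
  supported in the unit ball, and its integral is positive because \<phi>(0) = 1. This is why the
  uniqueness results below carry a \<open>resolution_generator\<close>.\<close>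

lemma bump_exists:
  fixes \<phi> :: "real ^ 'd::finite \<Rightarrow> complex"
  assumes \<phi>: "resolution_generator \<phi>"
  obtains r :: "real ^ 'd \<Rightarrow> real" where "(\<lambda>x. complex_of_real (r x)) \<in> test_functions" "\<And>x. 0 \<le> r x"
    "integrable lborel r" "(\<integral>x. r x \<partial>lborel) = 1" "\<And>x. 1 < norm x \<Longrightarrow> r x = 0"
proof -
  define q where "q x = (norm (\<phi> (2 *\<^sub>R x)))\<^sup>2" for x
  have sm: "smooth \<phi>" using \<phi> by (simp add: resolution_generator_def schwartz_smooth)
  have out: "\<phi> x = 0" if "2 < norm x" for x
    using \<phi> that closure_subset[of "{x. \<phi> x \<noteq> 0}"] by (fastforce simp: resolution_generator_def supp_def)
  have q0: "q x = 0" if "1 < norm x" for x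
    unfolding q_def using out[of "2 *\<^sub>R x"] that by simp
  have q_eq: "complex_of_real (q x) = \<phi> (2 *\<^sub>R x) * cnj (\<phi> (2 *\<^sub>R x))" for x
    unfolding q_def by (rule complex_norm_square)
  have "smooth (\<lambda>x. \<phi> (2 *\<^sub>R x))" using smooth_affine[OF sm, of 2 0] by simp
  then have "smooth (\<lambda>x. complex_of_real (q x))"
    unfolding q_eq by (intro smooth_mult smooth_cnj)
  then have qt: "(\<lambda>x. complex_of_real (q x)) \<in> test_functions"
    unfolding test_functions_iff using q0 by (auto intro!: exI[of _ 1])
  have "integrable lborel (\<lambda>x. norm (complex_of_real (q x)))"
    by (intro integrable_norm test_integrable qt)
  moreover have "norm (complex_of_real (q x)) = q x" for x
    by (simp add: q_def del: of_real_power)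
  ultimately have qi: "integrable lborel q" by simp
  define c where "c = (\<integral>x. q x \<partial>lborel)"
  have "c \<noteq> 0"
  proof
    assume "c = 0"
    then have "AE x in lborel. q x = 0"
      unfolding c_def using integral_nonneg_eq_0_iff_AE[OF qi] by (simp add: q_def)
    then have "AE x in lebesgue. complex_of_real (q x) = 0"
      using AE_completion by auto
    then have "complex_of_real (q 0) = 0"
      by (rule continuous_AE_zero[OF smooth_continuous[OF test_smooth[OF qt]]])
    then show False using \<phi> by (simp add: q_def resolution_generator_def)
  qed
  moreover have "0 \<le> c" unfolding c_def by (rule Bochner_Integration.integral_nonneg) (simp add: q_def)
  ultimately have c: "0 < c" by simp
  show ?thesis
  proof (rule that[of "\<lambda>x. q x / c"])
    show "(\<lambda>x. complex_of_real (q x / c)) \<in> test_functions"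
      using test_cmult[OF qt, of "complex_of_real (1 / c)"] by simp
    show "0 \<le> q x / c" for x using c by (simp add: q_def)
    show "integrable lborel (\<lambda>x. q x / c)" using qi by simp
    show "(\<integral>x. q x / c \<partial>lborel) = 1" using c by (simp add: c_def)
    show "q x / c = 0" if "1 < norm x" for x using q0[OF that] by simp
  qed
qed

section \<open>Densities are determined by test functions\<close>

lemma locally_integrableD:
  assumes "locally_integrable f" "compact K"
  shows "integrable lebesgue (\<lambda>x. indicator K x *\<^sub>R f x)"
  using assms by (simp add: locally_integrable_def set_integrable_def)

lemma locally_integrable_measurable:
  fixes f :: "real ^ 'd::finite \<Rightarrow> complex"
  assumes f: "locally_integrable f"
  shows "f \<in> borel_measurable lebesgue"
proof (rule borel_measurable_LIMSEQ_metric)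
  show "(\<lambda>x. indicator (cball 0 (real n)) x *\<^sub>R f x) \<in> borel_measurable lebesgue" for n
    using locally_integrableD[OF f] by (intro borel_measurable_integrable) auto
  fix x :: "real ^ 'd"
  obtain n :: nat where n: "norm x \<le> real n" using real_arch_simple by blast
  have "\<forall>\<^sub>F m in sequentially. indicator (cball 0 (real m)) x *\<^sub>R f x = f x"
    using eventually_ge_at_top[of n] by eventually_elim (use n in auto)
  then show "(\<lambda>n. indicator (cball 0 (real n)) x *\<^sub>R f x) \<longlonglongrightarrow> f x"
    by (rule tendsto_eventually)
qed

text \<open>Off the boundary of the box, which is a null set, the mollified indicator eventually
  equals the indicator, namely once the bump is narrower than the distance to the boundary. The
  uniform bound and the common support prepare dominated convergence.\<close>

lemma box_mollification:
  fixes \<phi> :: "real ^ 'd::finite \<Rightarrow> complex" and a b :: "real ^ 'd"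
  assumes \<phi>: "resolution_generator \<phi>"
  obtains \<psi> R where "\<And>n::nat. \<psi> n \<in> test_functions" "\<And>n x. norm (\<psi> n x) \<le> 1"
    "\<And>n x. R < norm x \<Longrightarrow> \<psi> n x = 0"
    "AE x in lebesgue. (\<lambda>n. \<psi> n x) \<longlonglongrightarrow> indicator (box a b) x"
proof -
  obtain r :: "real ^ 'd \<Rightarrow> real" where r: "(\<lambda>x. complex_of_real (r x)) \<in> test_functions" "\<And>x. 0 \<le> r x"
    "integrable lborel r" "(\<integral>x. r x \<partial>lborel) = 1" "\<And>x. 1 < norm x \<Longrightarrow> r x = 0"
    by (rule bump_exists[OF \<phi>]) blast
  have rm[measurable]: "r \<in> borel_measurable borel" using r(3) by auto
  define l where "l n = real (Suc n)" for n
  have l: "l n > 0" "l n \<ge> 1" for n by (auto simp: l_def)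
  define h where "h n x = l n ^ CARD('d) * r (l n *\<^sub>R x)" for n x
  have hm[measurable]: "h n \<in> borel_measurable borel" for n unfolding h_def by measurable
  have h0: "0 \<le> h n x" for n x using l[of n] r(2) by (simp add: h_def)
  have hout: "h n x = 0" if "1 / l n < norm x" for n x
    using r(5)[of "l n *\<^sub>R x"] that l[of n] by (simp add: h_def field_simps)
  have ht: "(\<lambda>x. complex_of_real (h n x)) \<in> test_functions" for n
    using test_cmult[OF test_scale[OF r(1) l(1)[of n]], of "complex_of_real (l n ^ CARD('d))"]
    by (simp add: h_def)
  have hi: "integrable lborel (\<lambda>x. h n (y - x))" "(\<integral>x. h n (y - x) \<partial>lborel) = 1" for n y
  proof -
    have "integrable lborel (h n)"
      unfolding h_def[abs_def] using integrable_lborel_affine[OF r(3), of "l n" 0] l[of n] by simp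
    from integrable_lborel_affine[OF this, of "-1" y]
    show "integrable lborel (\<lambda>x. h n (y - x))" by simp
    have "(\<integral>x. h n (y - x) \<partial>lborel) = (\<integral>x. h n x \<partial>lborel)"
      by (subst (2) integral_lborel_affine[where c = "-1" and t = y]) auto
    also have "\<dots> = (\<integral>x. r x \<partial>lborel)"
      using l[of n] integral_lborel_affine[OF rm, of "l n" 0] by (simp add: h_def)
    finally show "(\<integral>x. h n (y - x) \<partial>lborel) = 1" using r(4) by simp
  qed
  define k where "k x = complex_of_real (indicator (box a b) x)" for x
  have ki: "integrable lborel k"
    unfolding k_def by (intro integrable_of_real integrable_real_indicator) (auto simp: emeasure_lborel_box_eq)
  define \<psi> where "\<psi> n = conv k (\<lambda>x. complex_of_real (h n x))" for n
  obtain M where M: "\<And>x. x \<in> box a b \<Longrightarrow> norm x \<le> M"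
    using bounded_box[of a b] by (auto simp: bounded_iff)
  \<comment> \<open>All bumps are supported in the unit ball, so convolution enlarges the support by
    at most 1.\<close>
  have \<psi>out: "\<psi> n x = 0" if "M + 1 < norm x" for n x
  proof -
    have kz: "k z * complex_of_real (h n (x - z)) = 0" for z
    proof (cases "z \<in> box a b")
      case True
      then have "norm z \<le> M" by (rule M)
      then have "1 < norm (x - z)" using that norm_triangle_ineq2[of x z] by linarith
      moreover have "1 / l n \<le> 1" using l[of n] by simp
      ultimately show ?thesis using hout[of n "x - z"] by simp
    qed (simp add: k_def)
    show ?thesis unfolding \<psi>_def conv_def kz by simp
  qed
  show ?thesis
  proof (rule that[of \<psi> "M + 1"])
    show "\<psi> n \<in> test_functions" for n
      unfolding test_functions_iff \<psi>_def
      using smooth_conv[OF schwartz_bsmooth[OF test_schwartz[OF ht]] ki] \<psi>out[unfolded \<psi>_def] by blast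
    show "norm (\<psi> n x) \<le> 1" for n x
    proof -
      have "norm (\<psi> n x) \<le> (\<integral>z. h n (x - z) \<partial>lborel)"
        unfolding \<psi>_def conv_def
        by (rule norm_integral_le[OF hi(1)])
          (use h0 in \<open>auto simp: norm_mult k_def split: split_indicator\<close>)
      then show ?thesis by (simp add: hi)
    qed
    show "\<psi> n x = 0" if "M + 1 < norm x" for n x by (rule \<psi>out[OF that])
    have "AE x in lborel. x \<notin> cbox a b - box a b"
      by (rule AE_not_in[OF null_sets_cbox_Diff_box])
    then have "AE x in lborel. (\<lambda>n. \<psi> n x) \<longlonglongrightarrow> indicator (box a b) x"
    proof eventually_elim
      case (elim x)
      have ev: "\<forall>\<^sub>F n in sequentially. 1 / l n < e" if "0 < e" for e
      proof -
        have "(\<lambda>n. 1 / l n) \<longlonglongrightarrow> 0"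
          unfolding l_def using LIMSEQ_inverse_real_of_nat by (simp add: inverse_eq_divide)
        then show ?thesis using that by (rule order_tendstoD)
      qed
      show ?case
      proof (cases "x \<in> box a b")
        case True
        then obtain e where e: "0 < e" "ball x e \<subseteq> box a b"
          using open_box open_contains_ball by blast
        have "\<psi> n x = 1" if n: "1 / l n < e" for n
        proof -
          have kz: "k z * complex_of_real (h n (x - z)) = complex_of_real (h n (x - z))" for z
          proof (cases "dist x z < e")
            case True
            then show ?thesis using e by (auto simp: k_def)
          next
            case False
            then show ?thesis using hout[of n "x - z"] n by (simp add: dist_norm)
          qed
          show ?thesis
            unfolding \<psi>_def conv_def kz by (simp add: hi)
        qed
        then have "\<forall>\<^sub>F n in sequentially. \<psi> n x = indicator (box a b) x"
          using eventually_mono[OF ev[OF e(1)]] True by simp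
        then show ?thesis by (rule tendsto_eventually)
      next
        case False
        with elim have "x \<in> - cbox a b" by simp
        then obtain e where e: "0 < e" "ball x e \<subseteq> - cbox a b"
          using open_Compl[OF closed_cbox] open_contains_ball by metis
        have "\<psi> n x = 0" if n: "1 / l n < e" for n
        proof -
          have kz: "k z * complex_of_real (h n (x - z)) = 0" for z
          proof (cases "dist x z < e")
            case True
            then have "z \<notin> box a b" using e box_subset_cbox by fastforce
            then show ?thesis by (simp add: k_def)
          next
            case False
            then show ?thesis using hout[of n "x - z"] n by (simp add: dist_norm)
          qed
          show ?thesis unfolding \<psi>_def conv_def kz by simp
        qed
        then have "\<forall>\<^sub>F n in sequentially. \<psi> n x = indicator (box a b) x"
          using eventually_mono[OF ev[OF e(1)]] False by simp
        then show ?thesis by (rule tendsto_eventually)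
      qed
    qed
    then show "AE x in lebesgue. (\<lambda>n. \<psi> n x) \<longlonglongrightarrow> indicator (box a b) x"
      by (rule AE_completion)
  qed
qed

lemma locally_integrable_mult_test:
  fixes f :: "real ^ 'd::finite \<Rightarrow> complex"
  assumes f: "locally_integrable f" and \<psi>: "\<psi> \<in> test_functions"
  shows "integrable lebesgue (\<lambda>x. f x * \<psi> x)"
proof -
  obtain R where R: "\<And>x. R < norm x \<Longrightarrow> \<psi> x = 0" using test_support[OF \<psi>] by blast
  obtain B where B: "\<And>x. norm (\<psi> x) \<le> B"
    using bsmoothD(2)[OF schwartz_bsmooth[OF test_schwartz[OF \<psi>]], of "[]"] by auto
  have "integrable lebesgue (\<lambda>x. (indicator (cball 0 R) x *\<^sub>R f x) * \<psi> x)"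
    using locally_integrableD[OF f] test_measurable[OF \<psi>] B
    by (intro integrable_mult_bounded) (auto intro: measurable_completion)
  moreover have "(indicator (cball 0 R) x *\<^sub>R f x) * \<psi> x = f x * \<psi> x" for x
    using R[of x] by (cases "norm x \<le> R") auto
  ultimately show ?thesis by simp
qed

text \<open>Test functions approximating the indicator of a box turn the hypothesis into vanishing
  box integrals. Real and imaginary part are then treated through Borel versions, since
  \<open>f\<close> is only Lebesgue measurable.\<close>

theorem locally_integrable_null:
  fixes \<phi> f :: "real ^ 'd::finite \<Rightarrow> complex"
  assumes \<phi>: "resolution_generator \<phi>" and f: "locally_integrable f"
    and zero: "\<And>\<psi>. \<psi> \<in> test_functions \<Longrightarrow> (\<integral>x. f x * \<psi> x \<partial>lebesgue) = 0"
  shows "AE x in lebesgue. f x = 0"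
proof -
  note fm = locally_integrable_measurable[OF f]
  have box: "(\<integral>x. indicator (box a b) x *\<^sub>R f x \<partial>lebesgue) = 0" "integrable lebesgue (\<lambda>x. indicator (box a b) x *\<^sub>R f x)" for a b
  proof -
    have i: "integrable lebesgue (\<lambda>x. indicator (box a b) x *\<^sub>R (indicator (cbox a b) x *\<^sub>R f x))"
      by (rule integrable_mult_indicator) (auto intro: locally_integrableD[OF f])
    have e: "indicator (box a b) x *\<^sub>R (indicator (cbox a b) x *\<^sub>R f x) = indicator (box a b) x *\<^sub>R f x" for x
      using box_subset_cbox[of a b] by (auto split: split_indicator)
    show "integrable lebesgue (\<lambda>x. indicator (box a b) x *\<^sub>R f x)" by (rule i[unfolded e])
    obtain \<psi> R where \<psi>: "\<And>n::nat. \<psi> n \<in> test_functions" "\<And>n x. norm (\<psi> n x) \<le> 1"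
      "\<And>n x. R < norm x \<Longrightarrow> \<psi> n x = 0"
      "AE x in lebesgue. (\<lambda>n. \<psi> n x) \<longlonglongrightarrow> indicator (box a b) x"
      by (rule box_mollification[OF \<phi>]) blast
    have "(\<lambda>n. \<integral>x. f x * \<psi> n x \<partial>lebesgue) \<longlonglongrightarrow> (\<integral>x. f x * indicator (box a b) x \<partial>lebesgue)"
    proof (rule integral_dominated_convergence)
      show "integrable lebesgue (\<lambda>x. norm (indicator (cball 0 R) x *\<^sub>R f x))"
        by (intro integrable_norm locally_integrableD[OF f]) auto
      show "AE x in lebesgue. (\<lambda>n. f x * \<psi> n x) \<longlonglongrightarrow> f x * indicator (box a b) x"
        using \<psi>(4) by eventually_elim (intro tendsto_intros)
      have "norm (f x * \<psi> n x) \<le> norm (indicator (cball 0 R) x *\<^sub>R f x)" for n x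
        using \<psi>(2)[of n x] \<psi>(3)[of x n] by (cases "norm x \<le> R") (auto simp: norm_mult mult_left_le)
      then show "AE x in lebesgue. norm (f x * \<psi> n x) \<le> norm (indicator (cball 0 R) x *\<^sub>R f x)" for n
        by simp
      show "(\<lambda>x. f x * \<psi> n x) \<in> borel_measurable lebesgue" for n
        using fm test_measurable[OF \<psi>(1)[of n]] by (intro borel_measurable_times) (auto intro: measurable_completion)
      show "(\<lambda>x. f x * indicator (box a b) x) \<in> borel_measurable lebesgue"
        using fm by (intro borel_measurable_times borel_measurable_indicator) auto
    qed
    then have "(\<integral>x. f x * indicator (box a b) x \<partial>lebesgue) = 0"
      using zero[OF \<psi>(1)] by (simp add: LIMSEQ_const_iff)
    moreover have e: "f x * indicator (box a b) x = indicator (box a b) x *\<^sub>R f x" for x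
      by (simp split: split_indicator)
    ultimately show "(\<integral>x. indicator (box a b) x *\<^sub>R f x \<partial>lebesgue) = 0"
      unfolding e by blast
  qed
  have part: "AE x in lebesgue. L (f x) = 0" if L: "bounded_linear L" for L :: "complex \<Rightarrow> real"
  proof -
    have Lm: "(\<lambda>x. L (f x)) \<in> borel_measurable lebesgue"
      using measurable_compose[OF fm] L by (metis borel_measurable_continuous_onI linear_continuous_on)
    then obtain h where h[measurable]: "h \<in> borel_measurable lborel" and ae: "AE x in lborel. L (f x) = h x"
      using completion_ex_borel_measurable_real by blast
    have ae': "AE x in lebesgue. L (f x) = h x" using ae by (rule AE_completion)
    have hm: "(\<lambda>x. indicator (box a b) x * h x) \<in> borel_measurable lborel" for a b by measurable
    have "integrable lebesgue (\<lambda>x. indicator (box a b) x * h x) \<and> (\<integral>x. indicator (box a b) x * h x \<partial>lebesgue) = 0" for a b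
    proof -
      have eq: "L (indicator (box a b) x *\<^sub>R f x) = indicator (box a b) x * L (f x)" for x
        using L by (simp add: linear_simps)
      have i: "integrable lebesgue (\<lambda>x. indicator (box a b) x * L (f x))"
        using integrable_bounded_linear[OF L box(2)[of a b]] by (simp add: eq)
      have z: "(\<integral>x. indicator (box a b) x * L (f x) \<partial>lebesgue) = 0"
        using integral_bounded_linear[OF L box(2)[of a b]] box(1)[of a b] L by (simp add: eq linear_simps)
      have c: "AE x in lebesgue. indicator (box a b) x * L (f x) = indicator (box a b) x * h x"
        using ae' by eventually_elim simp
      note m = measurable_completion[OF hm[of a b]]
      show ?thesis
        using integrable_cong_AE_imp[OF i m c] integral_cong_AE[OF borel_measurable_integrable[OF i] m c] z
        by simp
    qed
    then have "AE x in lborel. h x = 0"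
      using hm by (intro AE_eq_0_if_box_integrals_eq_0)
       (auto simp: integrable_completion integral_completion)
    with ae have "AE x in lborel. L (f x) = 0" by eventually_elim simp
    then show ?thesis by (rule AE_completion)
  qed
  from part[OF bounded_linear_Re] part[OF bounded_linear_Im]
  show ?thesis by eventually_elim (simp add: complex_eq_iff)
qed

lemma continuous_locally_integrable:
  fixes g :: "real ^ 'd::finite \<Rightarrow> complex"
  shows "continuous_on UNIV g \<Longrightarrow> locally_integrable g"
  unfolding locally_integrable_def
  by (meson absolutely_integrable_continuous compact_cbox continuous_on_subset top_greatest
      bounded_subset_cbox_symmetric compact_imp_bounded set_integrable_subset lmeasurable_compact fmeasurableD)

lemma represents_unique:
  fixes \<phi> f g :: "real ^ 'd::finite \<Rightarrow> complex"
  assumes \<phi>: "resolution_generator \<phi>" and f: "represents f T" and g: "represents g T"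
  shows "AE x in lebesgue. f x = g x"
proof -
  have li: "locally_integrable f" "locally_integrable g" using f g by (auto simp: represents_def)
  have "locally_integrable (\<lambda>x. f x - g x)"
    using li by (simp add: locally_integrable_def set_integral_diff)
  moreover have "(\<integral>x. (f x - g x) * \<psi> x \<partial>lebesgue) = 0" if \<psi>: "\<psi> \<in> test_functions" for \<psi>
    using f g \<psi> locally_integrable_mult_test[OF _ \<psi>] li
    by (simp add: left_diff_distrib represents_def)
  ultimately have "AE x in lebesgue. f x - g x = 0" by (rule locally_integrable_null[OF \<phi>])
  then show ?thesis by simp
qed

lemma represents_unique_continuous:
  fixes \<phi> f g :: "real ^ 'd::finite \<Rightarrow> complex"
  assumes \<phi>: "resolution_generator \<phi>" and f: "represents f T" "continuous_on UNIV f"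
    and g: "represents g T" "continuous_on UNIV g"
  shows "f = g"
proof
  fix x
  have "AE x in lebesgue. f x - g x = 0" using represents_unique[OF \<phi> f(1) g(1)] by simp
  from continuous_AE_zero[OF continuous_on_diff[OF f(2) g(2)] this, of x] show "f x = g x" by simp
qed

section \<open>Littlewood-Paley blocks\<close>

lemma integrable_nonneg_le:
  fixes f g :: "'a \<Rightarrow> real"
  assumes g: "integrable M g" and f: "f \<in> borel_measurable M"
    and le: "\<And>x. f x \<le> g x" and nonneg: "\<And>x. 0 \<le> f x"
  shows "integrable M f"
proof (rule Bochner_Integration.integrable_bound[OF g f])
  have "norm (f x) \<le> norm (g x)" for x using le[of x] nonneg[of x] by simp
  then show "AE x in M. norm (f x) \<le> norm (g x)" by simp
qed

text \<open>Up to the factor (2 pi)^(-d/2) this is the inverse Fourier transform of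
  \<open>m\<close>, reflected at the origin. The reflection makes F^-1(m F T) at \<open>x\<close>
  equal to \<open>T (\<lambda>y. ikernel m (y - x))\<close>.\<close>

definition ikernel :: "(real ^ 'd::finite \<Rightarrow> complex) \<Rightarrow> real ^ 'd \<Rightarrow> complex" where
  "ikernel m z = complex_of_real (1 / (2 * pi) ^ CARD('d)) * FI m z"

lemma ikernel_schwartz: "m \<in> test_functions \<Longrightarrow> ikernel m \<in> schwartz"
  unfolding ikernel_def[abs_def] by (intro schwartz_cmult FI_schwartz)

lemma ikernel_inversion:
  fixes m :: "real ^ 'd::finite \<Rightarrow> complex"
  assumes "m \<in> test_functions"
  shows "(\<integral>y. exp (\<i> * complex_of_real (y \<bullet> \<eta>)) * ikernel m y \<partial>lborel) = m \<eta>"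
proof -
  have "(\<integral>y. exp (\<i> * complex_of_real (y \<bullet> \<eta>)) * ikernel m y \<partial>lborel)
     = (\<integral>y. complex_of_real (1 / (2 * pi) ^ CARD('d)) * (exp (\<i> * complex_of_real (y \<bullet> \<eta>)) * FI m y) \<partial>lborel)"
    unfolding ikernel_def by (intro Bochner_Integration.integral_cong) (auto simp: mult_ac)
  also have "\<dots> = m \<eta>"
    unfolding integral_mult_right_zero FI_inversion[OF assms] by simp
  finally show ?thesis .
qed

lemma FI_diff:
  fixes f g :: "real ^ 'd::finite \<Rightarrow> complex"
  assumes "integrable lborel f" "integrable lborel g"
  shows "FI (\<lambda>x. f x - g x) \<xi> = FI f \<xi> - FI g \<xi>"
  unfolding FI_def using integrable_exp_mult[OF assms(1)] integrable_exp_mult[OF assms(2)]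
  by (simp add: right_diff_distrib)

text \<open>The multiplier is transposed onto the test function; applying \<open>T\<close> then
  leads to a convolution, from which the block is read off as a function.\<close>

lemma fourier_mult_inv_fourier:
  fixes m \<psi> :: "real ^ 'd::finite \<Rightarrow> complex"
  assumes m: "m \<in> test_functions" and \<psi>: "\<psi> \<in> test_functions"
  shows "fourier (\<lambda>\<xi>. m \<xi> * inv_fourier \<psi> \<xi>) = conv \<psi> (ikernel m)"
proof
  fix y
  let ?c = "complex_of_real ((2 * pi) powr (- real CARD('d) / 2))"
  \<comment> \<open>The symmetric normalisations of \<open>fourier\<close> and
    \<open>inv_fourier\<close> combine to the constant of \<open>ikernel\<close>.\<close>
  have c2: "?c * ?c = complex_of_real (1 / (2 * pi) ^ CARD('d))"
    by (simp flip: of_real_mult powr_add) (simp add: powr_minus powr_realpow divide_inverse)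
  note [measurable] = test_measurable[OF m] test_measurable[OF \<psi>]
  let ?F = "\<lambda>\<xi> x. exp (- \<i> * complex_of_real (\<xi> \<bullet> y)) * (m \<xi> * (exp (\<i> * complex_of_real (\<xi> \<bullet> x)) * \<psi> x))"
  have "exp (- \<i> * complex_of_real (\<xi> \<bullet> y)) * (m \<xi> * inv_fourier \<psi> \<xi>) = ?c * (\<integral>x. ?F \<xi> x \<partial>lborel)" for \<xi>
    unfolding integral_mult_right_zero inv_fourier_def by (simp only: mult_ac)
  then have "fourier (\<lambda>\<xi>. m \<xi> * inv_fourier \<psi> \<xi>) y
    = ?c * (\<integral>\<xi>. ?c * (\<integral>x. ?F \<xi> x \<partial>lborel) \<partial>lborel)"
    by (simp only: fourier_def)
  also have "\<dots> = (?c * ?c) * (\<integral>\<xi>. (\<integral>x. ?F \<xi> x \<partial>lborel) \<partial>lborel)"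
    by (simp only: integral_mult_right_zero mult.assoc)
  also have "(\<integral>\<xi>. (\<integral>x. ?F \<xi> x \<partial>lborel) \<partial>lborel) = (\<integral>x. (\<integral>\<xi>. ?F \<xi> x \<partial>lborel) \<partial>lborel)"
  proof (rule lborel_pair.Fubini_integral[symmetric], rule integrable_pair_bound)
    show "integrable lborel (\<lambda>\<xi>. norm (m \<xi>))" "integrable lborel (\<lambda>x. norm (\<psi> x))"
      by (intro integrable_norm test_integrable m \<psi>)+
  qed (auto simp: norm_mult)
  also have "\<dots> = (\<integral>x. \<psi> x * FI m (y - x) \<partial>lborel)"
    unfolding FI_def integral_mult_right_zero[symmetric]
    by (intro Bochner_Integration.integral_cong)
      (auto simp: inner_diff_right right_diff_distrib exp_diff exp_minus field_simps)
  also have "?c * ?c * \<dots> = conv \<psi> (ikernel m) y"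
    unfolding conv_def ikernel_def c2 integral_mult_right_zero[symmetric]
    by (intro Bochner_Integration.integral_cong) (auto simp: mult_ac)
  finally show "fourier (\<lambda>\<xi>. m \<xi> * inv_fourier \<psi> \<xi>) y = conv \<psi> (ikernel m) y" .
qed

text \<open>After Fubini the integral over \<open>w\<close> is the inversion formula for
  \<open>n\<close> at \<open>\<eta>\<close>, so convolution of kernels becomes multiplication of
  multipliers.\<close>

lemma conv_ikernel:
  fixes m n :: "real ^ 'd::finite \<Rightarrow> complex"
  assumes m: "m \<in> test_functions" and n: "n \<in> test_functions"
  shows "conv (ikernel n) (ikernel m) = ikernel (\<lambda>\<eta>. m \<eta> * n \<eta>)"
proof
  fix z
  let ?c = "complex_of_real (1 / (2 * pi) ^ CARD('d))"
  let ?F = "\<lambda>w \<eta>. ikernel n w * (exp (- \<i> * complex_of_real (\<eta> \<bullet> (z - w))) * m \<eta>)"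
  note [measurable] = test_measurable[OF m] smooth_measurable[OF schwartz_smooth[OF ikernel_schwartz[OF n]]]
  have "conv (ikernel n) (ikernel m) z = ?c * (\<integral>w. (\<integral>\<eta>. ?F w \<eta> \<partial>lborel) \<partial>lborel)"
    unfolding conv_def ikernel_def[of m] FI_def integral_mult_right_zero[symmetric]
    by (simp only: mult_ac)
  also have "(\<integral>w. (\<integral>\<eta>. ?F w \<eta> \<partial>lborel) \<partial>lborel) = (\<integral>\<eta>. (\<integral>w. ?F w \<eta> \<partial>lborel) \<partial>lborel)"
  proof (rule lborel_pair.Fubini_integral[symmetric], rule integrable_pair_bound)
    show "integrable lborel (\<lambda>w. norm (ikernel n w))"
      by (intro integrable_norm rapid_integrable schwartz_rapid ikernel_schwartz n)
    show "integrable lborel (\<lambda>\<eta>. norm (m \<eta>))"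
      by (intro integrable_norm test_integrable m)
  qed (auto simp: norm_mult)
  also have "\<dots> = (\<integral>\<eta>. exp (- \<i> * complex_of_real (\<eta> \<bullet> z)) * (m \<eta> * n \<eta>) \<partial>lborel)"
  proof (intro Bochner_Integration.integral_cong refl)
    fix \<eta>
    have "(\<integral>w. ?F w \<eta> \<partial>lborel) = (\<integral>w. exp (- \<i> * complex_of_real (\<eta> \<bullet> z)) * m \<eta> *
        (exp (\<i> * complex_of_real (w \<bullet> \<eta>)) * ikernel n w) \<partial>lborel)"
      by (intro Bochner_Integration.integral_cong)
        (auto simp: inner_diff_right right_diff_distrib exp_diff exp_minus inner_commute field_simps)
    also have "\<dots> = exp (- \<i> * complex_of_real (\<eta> \<bullet> z)) * m \<eta> * n \<eta>"
      unfolding integral_mult_right_zero ikernel_inversion[OF n] ..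
    finally show "(\<integral>w. ?F w \<eta> \<partial>lborel) = exp (- \<i> * complex_of_real (\<eta> \<bullet> z)) * (m \<eta> * n \<eta>)"
      by (simp only: mult.assoc)
  qed
  also have "?c * \<dots> = ikernel (\<lambda>\<eta>. m \<eta> * n \<eta>) z"
    by (simp only: ikernel_def FI_def)
  finally show "conv (ikernel n) (ikernel m) z = ikernel (\<lambda>\<eta>. m \<eta> * n \<eta>) z" .
qed

lemma conv_commute:
  fixes k h :: "real ^ 'd::finite \<Rightarrow> complex"
  assumes [measurable]: "k \<in> borel_measurable borel" "h \<in> borel_measurable borel"
  shows "conv k h = conv h k"
proof
  fix y
  show "conv k h y = conv h k y"
    unfolding conv_def
    by (subst integral_lborel_affine[where c = "-1" and t = y]) (auto simp: mult.commute)
qed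

section \<open>The blocks belonging to a fixed resolution of unity\<close>

locale littlewood_paley =
  fixes \<phi> :: "real ^ 'd::finite \<Rightarrow> complex"
  assumes generator: "resolution_generator \<phi>"
begin

text \<open>Low-pass multipliers: every member of the resolution beyond the first is a difference of
  two consecutive ones, so the sums of blocks telescope.\<close>

definition dil :: "nat \<Rightarrow> real ^ 'd \<Rightarrow> complex" where
  "dil m x = \<phi> ((1 / 2 ^ m) *\<^sub>R x)"

definition ker :: "nat \<Rightarrow> real ^ 'd \<Rightarrow> complex" where
  "ker m = ikernel (dil m)"

text \<open>An explicit candidate for the function that \<open>lp_block\<close> selects by
  uniqueness. As a pairing with translates it is continuous and of polynomial growth.\<close>

definition blk :: "nat \<Rightarrow> 'd functional \<Rightarrow> real ^ 'd \<Rightarrow> complex" where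
  "blk j T x = T (\<lambda>y. ikernel (resolution \<phi> j) (y - x))"

lemma phi_zero: "2 < norm x \<Longrightarrow> \<phi> x = 0"
  using generator closure_subset[of "{x. \<phi> x \<noteq> 0}"]
  by (fastforce simp: resolution_generator_def supp_def)

lemma phi_one: "norm x \<le> 1 \<Longrightarrow> \<phi> x = 1"
  using generator by (simp add: resolution_generator_def)

lemma phi_test: "\<phi> \<in> test_functions"
  unfolding test_functions_iff using phi_zero generator schwartz_smooth
  by (auto simp: resolution_generator_def)

lemma dil_test: "dil m \<in> test_functions"
  unfolding dil_def[abs_def] by (rule test_scale[OF phi_test]) auto

lemma dil_zero: "2 * 2 ^ m < norm x \<Longrightarrow> dil m x = 0"
  unfolding dil_def by (rule phi_zero) (simp add: field_simps)

lemma dil_one: "norm x \<le> 2 ^ m \<Longrightarrow> dil m x = 1"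
  unfolding dil_def by (rule phi_one) (simp add: field_simps)

lemma resolution_dil:
  "resolution \<phi> 0 = dil 0" "resolution \<phi> (Suc j) = (\<lambda>x. dil (Suc j) x - dil j x)"
  by (auto simp: resolution_def dil_def fun_eq_iff power_int_minus power_int_add_1 power_int_diff
      power_int_def nat_add_distrib inverse_eq_divide power_one_over)

lemma resolution_test: "resolution \<phi> j \<in> test_functions"
  by (cases j) (auto simp: resolution_dil intro: dil_test test_diff)

lemma resolution_kernel:
  "ikernel (resolution \<phi> 0) = ker 0"
  "ikernel (resolution \<phi> (Suc j)) = (\<lambda>z. ker (Suc j) z - ker j z)"
  by (auto simp: resolution_dil ker_def ikernel_def FI_diff test_integrable dil_test right_diff_distrib fun_eq_iff)

lemma kernel_schwartz: "ikernel (resolution \<phi> j) \<in> schwartz"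
  by (rule ikernel_schwartz[OF resolution_test])

lemma ker_schwartz: "ker m \<in> schwartz"
  unfolding ker_def by (rule ikernel_schwartz[OF dil_test])

lemma ker_measurable [measurable]: "ker m \<in> borel_measurable borel"
  by (rule smooth_measurable[OF schwartz_smooth[OF ker_schwartz]])

lemma ker_scale: "ker m z = 2 ^ (m * CARD('d)) * ker 0 (2 ^ m *\<^sub>R z)"
proof -
  have "FI (dil m) z = (2 ^ m) ^ CARD('d) *\<^sub>R FI (dil 0) (2 ^ m *\<^sub>R z)"
    unfolding FI_def using test_measurable[OF phi_test]
    by (subst integral_lborel_affine[where c = "2 ^ m" and t = 0]) (auto simp: dil_def)
  then show ?thesis
    by (simp add: ker_def ikernel_def power_mult scaleR_conv_of_real mult_ac)
qed

text \<open>By inversion the mass is the value of the multiplier at 0. It makes the kernels an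
  approximate identity.\<close>

lemma ker_integral: "(\<integral>z. ker m z \<partial>lborel) = 1"
  using ikernel_inversion[OF dil_test[of m], of 0] dil_one[of 0 m] by (simp add: ker_def)

text \<open>\<open>dil (Suc j)\<close> equals 1 wherever \<open>resolution \<phi> j\<close> does not
  vanish, since the latter is 0 for \<open>norm \<eta> > 2 ^ Suc j\<close>. This is where band
  limitation enters.\<close>

lemma conv_kernel: "conv (ker (Suc j)) (ikernel (resolution \<phi> j)) = ikernel (resolution \<phi> j)"
proof -
  have eq: "resolution \<phi> j \<eta> * dil (Suc j) \<eta> = resolution \<phi> j \<eta>" for \<eta>
  proof (cases "norm \<eta> \<le> 2 ^ Suc j")
    case False
    then have out: "dil i \<eta> = 0" if "i \<le> j" for i
    proof -
      have "(2::real) * 2 ^ i \<le> 2 ^ Suc j" using that by simp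
      with False show ?thesis by (intro dil_zero) linarith
    qed
    show ?thesis
    proof (cases j)
      case 0
      then show ?thesis using out[of 0] by (simp add: resolution_dil)
    next
      case (Suc i)
      then show ?thesis using out[of i] out[of "Suc i"] by (simp add: resolution_dil)
    qed
  qed (simp add: dil_one)
  show ?thesis
    unfolding ker_def conv_ikernel[OF resolution_test dil_test] eq ..
qed

lemma blk_continuous: "T \<in> tempered_distributions \<Longrightarrow> continuous_on S (blk j T)"
  unfolding blk_def[abs_def] by (rule tempered_translate_continuous[OF _ kernel_schwartz])

lemma blk_represents:
  assumes T: "T \<in> tempered_distributions"
  shows "represents (blk j T) (inv_fourier_distr (mult_distr (resolution \<phi> j) (fourier_distr T)))"
  unfolding represents_def
proof (intro conjI ballI)
  show "locally_integrable (blk j T)"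
    by (rule continuous_locally_integrable[OF blk_continuous[OF T]])
  fix \<psi> :: "real ^ 'd \<Rightarrow> complex" assume \<psi>: "\<psi> \<in> test_functions"
  have m: "(\<lambda>x. blk j T x * \<psi> x) \<in> borel_measurable lborel"
    using borel_measurable_continuous_onI[OF blk_continuous[OF T]] test_measurable[OF \<psi>] by simp
  have "inv_fourier_distr (mult_distr (resolution \<phi> j) (fourier_distr T)) \<psi>
      = T (conv \<psi> (ikernel (resolution \<phi> j)))"
    by (simp add: inv_fourier_distr_def mult_distr_def fourier_distr_def
        fourier_mult_inv_fourier[OF resolution_test \<psi>])
  also have "\<dots> = (\<integral>x. \<psi> x * blk j T x \<partial>lborel)"
    unfolding blk_def by (rule tempered_conv(1)[OF T kernel_schwartz schwartz_rapid[OF test_schwartz[OF \<psi>]]])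
  also have "\<dots> = (\<integral>x. blk j T x * \<psi> x \<partial>lebesgue)"
    using integral_completion[OF m] by (simp add: mult.commute)
  finally show "inv_fourier_distr (mult_distr (resolution \<phi> j) (fourier_distr T)) \<psi>
      = (\<integral>x. blk j T x * \<psi> x \<partial>lebesgue)" .
qed

lemma lp_block_eq:
  assumes T: "T \<in> tempered_distributions"
  shows "lp_block \<phi> j T = blk j T"
  unfolding lp_block_def
proof (rule the_equality)
  show "continuous_on UNIV (blk j T) \<and>
     represents (blk j T) (inv_fourier_distr (mult_distr (resolution \<phi> j) (fourier_distr T)))"
    using blk_continuous[OF T] blk_represents[OF T] by blast
  then show "g = blk j T" if "continuous_on UNIV g \<and>
     represents g (inv_fourier_distr (mult_distr (resolution \<phi> j) (fourier_distr T)))" for g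
    using that represents_unique_continuous[OF generator] by blast
qed

lemma sum_blk:
  assumes T: "T \<in> tempered_distributions"
  shows "(\<Sum>j\<le>m. blk j T x) = T (\<lambda>y. ker m (y - x))"
proof (induction m)
  case (Suc m)
  have "blk (Suc m) T x = T (\<lambda>y. ker (Suc m) (y - x)) - T (\<lambda>y. ker m (y - x))"
    unfolding blk_def resolution_kernel
    by (intro tempered_linear(3)[OF T] schwartz_translate ker_schwartz)
  with Suc show ?case by simp
qed (simp add: blk_def resolution_kernel)

text \<open>\<open>conv_kernel\<close> transferred to the block: the translation by \<open>x\<close>
  is put into the first factor of the convolution, and \<open>T\<close> is then taken inside the
  integral.\<close>

lemma blk_reproducing:
  assumes T: "T \<in> tempered_distributions"
  shows "blk j T x = (\<integral>v. ker (Suc j) (v - x) * blk j T v \<partial>lborel)"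
proof -
  have [measurable]: "ikernel (resolution \<phi> j) \<in> borel_measurable borel"
    by (rule smooth_measurable[OF schwartz_smooth[OF kernel_schwartz]])
  have "ikernel (resolution \<phi> j) (y - x) = conv (\<lambda>v. ker (Suc j) (v - x)) (ikernel (resolution \<phi> j)) y" for y
  proof -
    have "ikernel (resolution \<phi> j) (y - x) = conv (ker (Suc j)) (ikernel (resolution \<phi> j)) (y - x)"
      by (simp add: conv_kernel)
    also have "\<dots> = conv (\<lambda>v. ker (Suc j) (v - x)) (ikernel (resolution \<phi> j)) y"
      unfolding conv_def
      by (subst integral_lborel_affine[where c = 1 and t = "-x"]) (auto simp: algebra_simps)
    finally show ?thesis .
  qed
  then have "blk j T x = T (conv (\<lambda>v. ker (Suc j) (v - x)) (ikernel (resolution \<phi> j)))"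
    unfolding blk_def by simp
  also have "\<dots> = (\<integral>v. ker (Suc j) (v - x) * blk j T v \<partial>lborel)"
    unfolding blk_def
    by (rule tempered_conv(1)[OF T kernel_schwartz schwartz_rapid[OF schwartz_translate[OF ker_schwartz]]])
  finally show ?thesis .
qed

text \<open>By telescoping, the pairing of the partial sum with \<open>\<psi>\<close> is
  \<open>T (conv (ker m) \<psi>)\<close>. The kernel has mass 1 and its weighted first moment is of
  order 2^-m, so the convolutions tend to \<open>\<psi>\<close> in every seminorm at this
  rate.\<close>

lemma partial_sums_tendsto:
  assumes T: "T \<in> tempered_distributions" and \<psi>: "\<psi> \<in> test_functions"
  shows "(\<lambda>m. \<integral>x. \<psi> x * (\<Sum>j\<le>m. blk j T x) \<partial>lborel) \<longlonglongrightarrow> T \<psi>"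
proof -
  note \<psi>S = test_schwartz[OF \<psi>]
  obtain N A where A: "0 \<le> A"
    and TA: "\<And>\<phi> B. \<phi> \<in> schwartz \<Longrightarrow>
       (\<And>is x. length is \<le> N \<Longrightarrow> (1 + norm x) ^ N * norm (partials is \<phi> x) \<le> B) \<Longrightarrow> norm (T \<phi>) \<le> A * B"
    by (rule tempered_bound[OF T]) blast
  define C where "C = CARD('d) * schwartz_norm (Suc N) \<psi>"
  have C0: "0 \<le> C" unfolding C_def using schwartz_norm_nonneg[OF \<psi>S] by simp
  define D where "D = (\<integral>v. (1 + norm v) ^ Suc N * norm (ker 0 v) \<partial>lborel)"
  have kr: "rapid (ker m)" for m by (rule schwartz_rapid[OF ker_schwartz])
  have ki: "integrable lborel (ker m)" for m by (rule rapid_integrable[OF kr])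
  have Dint: "integrable lborel (\<lambda>v. (1 + norm v) ^ Suc N * norm (ker m v))" for m
    using kr[of m] unfolding rapid_def by blast
  have ws: "norm w * (1 + norm w) ^ N \<le> (1 + norm w) ^ Suc N" for w :: "real ^ 'd"
    by (simp add: mult_right_mono)
  have wint: "integrable lborel (\<lambda>w. norm (ker m w) * (norm w * (1 + norm w) ^ N))" for m
  proof (rule integrable_nonneg_le[OF Dint[of m]])
    show "norm (ker m w) * (norm w * (1 + norm w) ^ N) \<le> (1 + norm w) ^ Suc N * norm (ker m w)" for w
      using mult_left_mono[OF ws, of "norm (ker m w)" w] by (simp only: mult_ac norm_ge_zero simp_thms)
  qed auto
  \<comment> \<open>Substituting w = 2^-m v gives 2^-m from the factor \<open>norm w\<close>; in the
    remaining weight 2^-m is simply bounded by 1.\<close>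
  have wD: "(\<integral>w. norm (ker m w) * (norm w * (1 + norm w) ^ N) \<partial>lborel) \<le> (1 / 2) ^ m * D" for m
  proof -
    have "(\<integral>w. norm (ker m w) * (norm w * (1 + norm w) ^ N) \<partial>lborel)
       = (\<integral>v. norm (ker 0 v) * (((1 / 2) ^ m * norm v) * (1 + (1 / 2) ^ m * norm v) ^ N) \<partial>lborel)"
      by (subst integral_lborel_affine[where c = "(1 / 2) ^ m" and t = 0])
        (auto simp: ker_scale[of m] norm_mult norm_power power_mult power_divide mult_ac
          simp flip: integral_mult_right_zero power_mult_distrib)
    also have "\<dots> \<le> (\<integral>v. (1 / 2) ^ m * ((1 + norm v) ^ Suc N * norm (ker 0 v)) \<partial>lborel)"
    proof (rule integral_mono')
      show "integrable lborel (\<lambda>v. (1 / 2) ^ m * ((1 + norm v) ^ Suc N * norm (ker 0 v)))"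
        using Dint by simp
      fix v :: "real ^ 'd"
      have p: "(1 / 2) ^ m \<le> (1 :: real)" by (simp add: power_le_one)
      have "((1 / 2) ^ m * norm v) * (1 + (1 / 2) ^ m * norm v) ^ N \<le> ((1 / 2) ^ m * norm v) * (1 + norm v) ^ N"
        using p by (intro mult_left_mono power_mono add_left_mono mult_left_le_one_le) auto
      also have "\<dots> \<le> (1 / 2) ^ m * (1 + norm v) ^ Suc N"
        using ws[of v] by (simp add: mult.assoc mult_left_mono)
      finally have "norm (ker 0 v) * (((1 / 2) ^ m * norm v) * (1 + (1 / 2) ^ m * norm v) ^ N)
        \<le> norm (ker 0 v) * ((1 / 2) ^ m * (1 + norm v) ^ Suc N)"
        by (rule mult_left_mono) simp
      then show "norm (ker 0 v) * (((1 / 2) ^ m * norm v) * (1 + (1 / 2) ^ m * norm v) ^ N)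
        \<le> (1 / 2) ^ m * ((1 + norm v) ^ Suc N * norm (ker 0 v))"
        by (simp only: mult_ac)
    qed auto
    finally show ?thesis unfolding D_def by simp
  qed
  have eq: "(\<integral>x. \<psi> x * (\<Sum>j\<le>m. blk j T x) \<partial>lborel) = T (conv (ker m) \<psi>)" for m
    unfolding sum_blk[OF T] conv_commute[OF ker_measurable test_measurable[OF \<psi>]]
    by (rule tempered_conv(1)[OF T ker_schwartz schwartz_rapid[OF \<psi>S], symmetric])
  have le: "norm (T (conv (ker m) \<psi>) - T \<psi>) \<le> A * (C * ((1 / 2) ^ m * D))" for m
  proof -
    have cS: "conv (ker m) \<psi> \<in> schwartz" by (rule schwartz_conv[OF kr \<psi>S])
    have "norm (T (\<lambda>y. conv (ker m) \<psi> y - \<psi> y)) \<le> A * (C * ((1 / 2) ^ m * D))"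
    proof (rule TA)
      show "(\<lambda>y. conv (ker m) \<psi> y - \<psi> y) \<in> schwartz" by (intro schwartz_diff cS \<psi>S)
      fix "is" :: "'d list" and y :: "real ^ 'd" assume len: "length is \<le> N"
      obtain B where B: "\<And>x. norm (partials is \<psi> x) \<le> B"
        using bsmoothD(2)[OF schwartz_bsmooth[OF \<psi>S]] by metis
      have i1: "integrable lborel (\<lambda>w. ker m w * partials is \<psi> (y - w))"
        by (intro integrable_mult_bounded[OF ki _ B] measurable_reflect smooth_measurable smooth_partials test_smooth \<psi>)
      \<comment> \<open>Unit mass writes the derivative of \<open>\<psi>\<close> at \<open>y\<close>
        as an integral against the kernel. The shift by 0 below makes the difference an instance of
        \<open>schwartz_translate_diff_weight\<close>.\<close>
      have "partials is (\<lambda>y. conv (ker m) \<psi> y - \<psi> y) y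
         = (\<integral>w. ker m w * partials is \<psi> (y - w) \<partial>lborel) - (\<integral>w. ker m w * partials is \<psi> y \<partial>lborel)"
        using schwartz_smooth[OF cS] test_smooth[OF \<psi>]
        by (simp add: partials_diff partials_conv[OF schwartz_bsmooth[OF \<psi>S] ki] ker_integral)
          (simp add: conv_def)
      also have "\<dots> = (\<integral>w. ker m w * (partials is \<psi> (y - w) - partials is \<psi> (y - 0)) \<partial>lborel)"
        using i1 ki by (simp add: right_diff_distrib)
      finally have "(1 + norm y) ^ N * norm (partials is (\<lambda>y. conv (ker m) \<psi> y - \<psi> y) y)
        = norm (\<integral>w. (1 + norm y) ^ N *\<^sub>R (ker m w * (partials is \<psi> (y - w) - partials is \<psi> (y - 0))) \<partial>lborel)"
        by simp
      also have "\<dots> \<le> (\<integral>w. C * (norm (ker m w) * (norm w * (1 + norm w) ^ N)) \<partial>lborel)"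
      proof (rule norm_integral_le)
        show "integrable lborel (\<lambda>w. C * (norm (ker m w) * (norm w * (1 + norm w) ^ N)))"
          using wint by simp
        fix w
        have "norm ((1 + norm y) ^ N *\<^sub>R (ker m w * (partials is \<psi> (y - w) - partials is \<psi> (y - 0))))
          = norm (ker m w) * ((1 + norm y) ^ N * norm (partials is \<psi> (y - w) - partials is \<psi> (y - 0)))"
          by (simp add: norm_mult)
        also have "\<dots> \<le> norm (ker m w) * (C * (norm (w - 0) * (1 + norm w + norm (0::real^'d)) ^ N))"
          unfolding C_def by (intro mult_left_mono schwartz_translate_diff_weight[OF \<psi>S len]) auto
        finally show "norm ((1 + norm y) ^ N *\<^sub>R (ker m w * (partials is \<psi> (y - w) - partials is \<psi> (y - 0))))
          \<le> C * (norm (ker m w) * (norm w * (1 + norm w) ^ N))" by (simp add: mult_ac)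
      qed
      also have "\<dots> \<le> C * ((1 / 2) ^ m * D)"
        using mult_left_mono[OF wD C0] by simp
      finally show "(1 + norm y) ^ N * norm (partials is (\<lambda>y. conv (ker m) \<psi> y - \<psi> y) y) \<le> C * ((1 / 2) ^ m * D)" .
    qed
    then show ?thesis using tempered_linear(3)[OF T cS \<psi>S] by simp
  qed
  have "(\<lambda>m. A * (C * ((1 / 2) ^ m * D))) \<longlonglongrightarrow> A * (C * (0 * D))"
    by (intro tendsto_intros LIMSEQ_power_zero) auto
  then have "(\<lambda>m. A * (C * ((1 / 2) ^ m * D))) \<longlonglongrightarrow> 0" by simp
  then have "(\<lambda>m. T (conv (ker m) \<psi>) - T \<psi>) \<longlonglongrightarrow> 0"
    by (rule Lim_null_comparison[OF always_eventually[OF allI[OF le]]])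
  then show ?thesis
    unfolding eq by (simp add: LIM_zero_iff)
qed

end

section \<open>The Nikolskii inequality\<close>

lemma dyadic_cube_eq:
  "dyadic_cube j k = {y :: real ^ 'd::finite. \<forall>i. of_int (k $ i) \<le> 2 powi j * y $ i \<and> 2 powi j * y $ i < of_int (k $ i) + 1}"
proof (intro set_eqI iffI)
  fix y :: "real ^ 'd" assume "y \<in> dyadic_cube j k"
  then obtain z where z: "\<And>i. 0 \<le> z $ i \<and> z $ i < 1" "y = (2 powi (- j)) *\<^sub>R (z + (\<chi> i. of_int (k $ i)))"
    by (auto simp: dyadic_cube_def)
  have "2 powi j * y $ i = z $ i + of_int (k $ i)" for i
    unfolding z(2) by (simp add: power_int_minus)
  with z(1) show "y \<in> {y. \<forall>i. of_int (k $ i) \<le> 2 powi j * y $ i \<and> 2 powi j * y $ i < of_int (k $ i) + 1}"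
    by (auto simp: algebra_simps)
next
  fix y :: "real ^ 'd"
  assume y: "y \<in> {y. \<forall>i. of_int (k $ i) \<le> 2 powi j * y $ i \<and> 2 powi j * y $ i < of_int (k $ i) + 1}"
  let ?z = "(2 powi j) *\<^sub>R y - (\<chi> i. of_int (k $ i))"
  have "y = (2 powi (- j)) *\<^sub>R (?z + (\<chi> i. of_int (k $ i)))"
    by (simp add: power_int_minus)
  moreover have "?z \<in> {y. \<forall>i. 0 \<le> y $ i \<and> y $ i < 1}"
    using y by (auto simp: algebra_simps)
  ultimately show "y \<in> dyadic_cube j k"
    unfolding dyadic_cube_def by (rule image_eqI)
qed

lemma dyadic_cube_borel [measurable]: "dyadic_cube j k \<in> sets (borel :: (real ^ 'd::finite) measure)"
  unfolding dyadic_cube_eq by measurable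

lemma emeasure_dyadic_cube:
  "emeasure lborel (dyadic_cube j k :: (real ^ 'd::finite) set) = ennreal (2 powr (- real_of_int j * CARD('d)))"
proof -
  let ?a = "(\<chi> i. 2 powi (- j) * of_int (k $ i)) :: real ^ 'd"
  let ?b = "(\<chi> i. 2 powi (- j) * (of_int (k $ i) + 1)) :: real ^ 'd"
  have p: "(2::real) powi j > 0" by simp
  have 1: "box ?a ?b \<subseteq> dyadic_cube j k"
    using p by (auto simp: dyadic_cube_eq mem_box_cart power_int_minus field_simps intro: less_imp_le)
  have 2: "dyadic_cube j k \<subseteq> cbox ?a ?b"
    using p by (auto simp: dyadic_cube_eq mem_box_cart power_int_minus field_simps) (meson less_imp_le)
  have le: "?a \<bullet> b \<le> ?b \<bullet> b" if "b \<in> Basis" for b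
    using that by (auto simp: Basis_vec_def inner_axis)
  have "(\<Prod>b\<in>Basis. (?b - ?a) \<bullet> b) = (\<Prod>b\<in>(Basis::(real^'d) set). 2 powi (- j))"
    by (rule prod.cong) (auto simp: Basis_vec_def inner_axis algebra_simps)
  also have "\<dots> = (2 powr (- real_of_int j)) ^ CARD('d)"
    by (simp add: powr_real_of_int' powr_minus power_int_minus)
  also have "\<dots> = 2 powr (- real_of_int j * CARD('d))"
    by (simp add: powr_powr flip: powr_realpow)
  finally have pr: "(\<Prod>b\<in>Basis. (?b - ?a) \<bullet> b) = 2 powr (- real_of_int j * CARD('d))" .
  have "emeasure lborel (box ?a ?b) \<le> emeasure lborel (dyadic_cube j k)"
    by (rule emeasure_mono[OF 1]) simp
  moreover have "emeasure lborel (dyadic_cube j k) \<le> emeasure lborel (cbox ?a ?b)"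
    by (rule emeasure_mono[OF 2]) simp
  ultimately show ?thesis
    using emeasure_lborel_box[OF le] emeasure_lborel_cbox[OF le] pr by simp
qed

lemma measure_dyadic_cube:
  "measure lebesgue (dyadic_cube j k :: (real ^ 'd::finite) set) = 2 powr (- real_of_int j * CARD('d))"
  using emeasure_dyadic_cube[of j k] by (simp add: measure_def)

definition cube_index :: "real ^ 'd::finite \<Rightarrow> int ^ 'd" where
  "cube_index v = (\<chi> i. \<lfloor>v $ i\<rfloor>)"

lemma mem_unit_cube: "v \<in> dyadic_cube 0 k \<longleftrightarrow> k = cube_index v"
proof -
  have "v \<in> dyadic_cube 0 k \<longleftrightarrow> (\<forall>i. \<lfloor>v $ i\<rfloor> = k $ i)"
    unfolding dyadic_cube_eq by (simp add: floor_eq_iff)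
  then show ?thesis by (auto simp: cube_index_def vec_eq_iff)
qed

text \<open>The unit cubes partition the space. Their sum is written as an integral over the
  counting measure, which can be exchanged with the Lebesgue integral.\<close>

lemma nn_integral_unit_cubes:
  fixes a :: "real ^ 'd::finite \<Rightarrow> ennreal"
  assumes [measurable]: "a \<in> borel_measurable borel"
  shows "(\<integral>\<^sup>+v. a v \<partial>lborel) = (\<integral>\<^sup>+k. (\<integral>\<^sup>+v. a v * indicator (dyadic_cube 0 k) v \<partial>lborel) \<partial>count_space UNIV)"
proof -
  have "(\<integral>\<^sup>+k. a v * indicator (dyadic_cube 0 k) v \<partial>count_space UNIV) = a v" for v
  proof -
    have "indicator (dyadic_cube 0 k) v = (indicator {cube_index v} k :: ennreal)" for k
      by (auto simp: indicator_def mem_unit_cube)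
    then show ?thesis by (simp add: nn_integral_cmult)
  qed
  then have "(\<integral>\<^sup>+v. a v \<partial>lborel) = (\<integral>\<^sup>+v. (\<integral>\<^sup>+k. a v * indicator (dyadic_cube 0 k) v \<partial>count_space UNIV) \<partial>lborel)"
    by simp
  also have "\<dots> = (\<integral>\<^sup>+k. (\<integral>\<^sup>+v. a v * indicator (dyadic_cube 0 k) v \<partial>lborel) \<partial>count_space UNIV)"
    by (rule nn_integral_count_space_nn_integral) auto
  finally show ?thesis .
qed

text \<open>A divergent integral would be sent to 0 by \<open>enn2real\<close>; the exponent
  \<open>2 * CARD('d)\<close> is safe by \<open>weight_integral_finite\<close>. The first argument
  only transports the dimension.\<close>

definition weight_integral :: "'d::finite itself \<Rightarrow> nat \<Rightarrow> real" where
  "weight_integral _ M = enn2real (\<integral>\<^sup>+(z::real^'d). ennreal (inverse ((1 + norm z) ^ M)) \<partial>lborel)"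

text \<open>The weight varies by at most the factor \<open>(1 + d)\<^sup>M\<close> on a unit cube.\<close>

lemma weighted_integral_le:
  fixes a :: "real ^ 'd::finite \<Rightarrow> ennreal"
  assumes [measurable]: "a \<in> borel_measurable borel"
    and B: "\<And>k. (\<integral>\<^sup>+v. a v * indicator (dyadic_cube 0 k) v \<partial>lborel) \<le> B"
  shows "(\<integral>\<^sup>+v. a v * ennreal (inverse ((1 + norm (v - x)) ^ M)) \<partial>lborel)
    \<le> ennreal ((1 + real CARD('d)) ^ M) * B * (\<integral>\<^sup>+(z::real^'d). ennreal (inverse ((1 + norm z) ^ M)) \<partial>lborel)"
proof -
  let ?w = "\<lambda>v. ennreal (inverse ((1 + norm (v - x)) ^ M))"
  let ?c = "ennreal ((1 + real CARD('d)) ^ M)"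
  let ?Q = "dyadic_cube 0 :: int ^ 'd \<Rightarrow> _"
  have cmp: "?w v \<le> ?c * ?w v'" if "v \<in> ?Q k" "v' \<in> ?Q k" for v v' k
  proof -
    have "norm (v' - v) \<le> (\<Sum>i\<in>UNIV. \<bar>(v' - v) $ i\<bar>)" by (rule norm_le_l1_cart)
    also have "\<dots> \<le> (\<Sum>i\<in>(UNIV::'d set). 1)"
    proof (rule sum_mono)
      fix i
      have "of_int (k $ i) \<le> v $ i" "v $ i < of_int (k $ i) + 1" "of_int (k $ i) \<le> v' $ i" "v' $ i < of_int (k $ i) + 1"
        using that by (auto simp: dyadic_cube_eq)
      then show "\<bar>(v' - v) $ i\<bar> \<le> 1" by simp
    qed
    finally have n: "norm (v' - v) \<le> CARD('d)" by simp
    have "1 + norm (v' - x) \<le> (1 + real CARD('d)) * (1 + norm (v - x))"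
    proof -
      have "norm (v' - x) \<le> norm (v - x) + norm (v' - v)"
        using norm_triangle_ineq[of "v - x" "v' - v"] by simp
      moreover have "0 \<le> real CARD('d) * norm (v - x)" by simp
      moreover have "(1 + real CARD('d)) * (1 + norm (v - x)) = 1 + real CARD('d) + norm (v - x) + real CARD('d) * norm (v - x)"
        by (simp add: algebra_simps)
      ultimately show ?thesis using n by linarith
    qed
    then have "(1 + norm (v' - x)) ^ M \<le> (1 + real CARD('d)) ^ M * (1 + norm (v - x)) ^ M"
      unfolding power_mult_distrib[symmetric] by (rule power_mono) simp
    moreover have "0 < (1 + norm (v' - x)) ^ M" "0 < (1 + norm (v - x)) ^ M"
      by (simp_all add: add_pos_nonneg)
    ultimately have "inverse ((1 + norm (v - x)) ^ M) \<le> (1 + real CARD('d)) ^ M * inverse ((1 + norm (v' - x)) ^ M)"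
      by (simp add: field_simps)
    then show ?thesis by (simp add: ennreal_leI flip: ennreal_mult)
  qed
  have avg: "?w v \<le> ?c * (\<integral>\<^sup>+v'. ?w v' * indicator (?Q k) v' \<partial>lborel)" if v: "v \<in> ?Q k" for v k
  proof -
    \<comment> \<open>The cube has measure 1, so a constant equals its integral over the
      cube.\<close>
    have "?w v = (\<integral>\<^sup>+v'. ?w v * indicator (?Q k) v' \<partial>lborel)"
      by (simp add: nn_integral_cmult_indicator emeasure_dyadic_cube)
    also have "\<dots> \<le> (\<integral>\<^sup>+v'. ?c * (?w v' * indicator (?Q k) v') \<partial>lborel)"
      by (intro nn_integral_mono) (use cmp[OF v] in \<open>auto split: split_indicator\<close>)
    also have "\<dots> = ?c * (\<integral>\<^sup>+v'. ?w v' * indicator (?Q k) v' \<partial>lborel)"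
      by (intro nn_integral_cmult) auto
    finally show ?thesis .
  qed
  have "(\<integral>\<^sup>+v. a v * ?w v \<partial>lborel) = (\<integral>\<^sup>+k. (\<integral>\<^sup>+v. a v * ?w v * indicator (?Q k) v \<partial>lborel) \<partial>count_space UNIV)"
    by (rule nn_integral_unit_cubes) auto
  also have "\<dots> \<le> (\<integral>\<^sup>+k. (?c * B) * (\<integral>\<^sup>+v'. ?w v' * indicator (?Q k) v' \<partial>lborel) \<partial>count_space UNIV)"
  proof (rule nn_integral_mono)
    fix k
    let ?I = "\<integral>\<^sup>+v'. ?w v' * indicator (?Q k) v' \<partial>lborel"
    have "(\<integral>\<^sup>+v. a v * ?w v * indicator (?Q k) v \<partial>lborel) \<le> (\<integral>\<^sup>+v. (a v * indicator (?Q k) v) * (?c * ?I) \<partial>lborel)"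
      by (intro nn_integral_mono) (auto split: split_indicator intro!: mult_left_mono avg)
    also have "\<dots> = (\<integral>\<^sup>+v. a v * indicator (?Q k) v \<partial>lborel) * (?c * ?I)"
      by (rule nn_integral_multc) auto
    also have "\<dots> \<le> B * (?c * ?I)" by (intro mult_right_mono B) auto
    finally show "(\<integral>\<^sup>+v. a v * ?w v * indicator (?Q k) v \<partial>lborel) \<le> (?c * B) * ?I" by (simp add: mult_ac)
  qed
  also have "\<dots> = (?c * B) * (\<integral>\<^sup>+k. (\<integral>\<^sup>+v'. ?w v' * indicator (?Q k) v' \<partial>lborel) \<partial>count_space UNIV)"
    by (rule nn_integral_cmult) auto
  also have "(\<integral>\<^sup>+k. (\<integral>\<^sup>+v'. ?w v' * indicator (?Q k) v' \<partial>lborel) \<partial>count_space UNIV) = (\<integral>\<^sup>+v. ?w v \<partial>lborel)"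
    by (rule nn_integral_unit_cubes[symmetric]) auto
  also have "\<dots> = (\<integral>\<^sup>+(z::real^'d). ennreal (inverse ((1 + norm z) ^ M)) \<partial>lborel)"
    by (subst nn_integral_lborel_affine[where c = 1 and t = x]) auto
  finally show ?thesis .
qed

lemma weight_integral_finite:
  "(\<integral>\<^sup>+(z::real^'d::finite). ennreal (inverse ((1 + norm z) ^ (2 * CARD('d)))) \<partial>lborel)
     = ennreal (weight_integral TYPE('d) (2 * CARD('d)))"
proof -
  have "(\<integral>\<^sup>+(z::real^'d). ennreal (inverse ((1 + norm z) ^ (2 * CARD('d)))) \<partial>lborel) < \<infinity>"
    using integrable_one_plus_norm[where 'd = 'd] by (simp add: integrable_iff_bounded)
  then show ?thesis by (simp add: weight_integral_def less_top)
qed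

text \<open>If \<open>A\<close> is the supremum of \<open>G y / (1 + \<bar>y - x\<bar>)\<^sup>L\<close>, then inserting \<open>G = G\<^sup>p G\<^bsup>1-p\<^esup>\<close> into the
  reproducing inequality gives \<open>A \<le> C B A\<^bsup>1-p\<^esup>\<close>; that \<open>A\<close> is finite is where the growth bound is needed.\<close>

lemma reproducing_bound_step:
  fixes G :: "real ^ 'd::finite \<Rightarrow> real"
  assumes G [measurable]: "G \<in> borel_measurable borel" and G0: "\<And>y. 0 \<le> G y"
    and p: "0 < p" "p \<le> 1" and B0: "0 \<le> B" and K0: "0 \<le> K"
    and growth: "\<And>y. G y \<le> A0 * (1 + norm (y - x)) ^ L"
    and repr: "\<And>y. ennreal (G y) \<le> ennreal K *
       (\<integral>\<^sup>+v. ennreal (G v * inverse ((1 + norm (v - y)) ^ (L + 2 * CARD('d)))) \<partial>lborel)"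
    and B: "\<And>k. (\<integral>\<^sup>+v. ennreal (G v powr p) * indicator (dyadic_cube 0 k) v \<partial>lborel) \<le> ennreal B"
  shows "G y \<le> (K * (1 + real CARD('d)) ^ (2 * CARD('d)) * B * weight_integral TYPE('d) (2 * CARD('d))) powr (1 / p)
     * (1 + norm (y - x)) ^ L"
proof -
  let ?D = "2 * CARD('d)"
  let ?K = "K * (1 + real CARD('d)) ^ ?D * B * weight_integral TYPE('d) ?D"
  have W0: "0 \<le> weight_integral TYPE('d) ?D" by (simp add: weight_integral_def)
  have K: "0 \<le> ?K" using K0 B0 W0 by simp
  define q where "q y = G y / (1 + norm (y - x)) ^ L" for y
  have pos: "0 < (1 + norm z) ^ n" for z :: "real ^ 'd" and n by (simp add: add_pos_nonneg)
  have q0: "0 \<le> q y" for y unfolding q_def using G0 by simp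
  have "q y \<le> A0" for y
    unfolding q_def using growth[of y] pos[of "y - x" L] by (simp add: field_simps)
  then have bdd: "bdd_above (range q)" by (auto simp: bdd_above_def)
  \<comment> \<open>This is the Peetre maximal function of \<open>G\<close> at
    \<open>x\<close>.\<close>
  define A where "A = (SUP y. q y)"
  have qA: "q y \<le> A" for y unfolding A_def by (rule cSUP_upper[OF _ bdd]) simp
  then have A0': "0 \<le> A" using q0 order_trans by blast
  have GA: "G v \<le> A * (1 + norm (v - x)) ^ L" for v
    using qA[of v] pos[of "v - x" L] by (simp add: q_def field_simps)
  have main: "q y \<le> ?K * A powr (1 - p)" for y
  proof -
    have pt: "G v * inverse ((1 + norm (v - y)) ^ (L + ?D))
      \<le> (A powr (1 - p) * (1 + norm (y - x)) ^ L) * (G v powr p * inverse ((1 + norm (v - y)) ^ ?D))" for v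
    proof (cases "G v = 0")
      case False
      then have "0 < G v" using G0[of v] by simp
      then have "G v = G v powr p * G v powr (1 - p)" by (simp flip: powr_add)
      also have "\<dots> \<le> G v powr p * (A * (1 + norm (v - x)) ^ L) powr (1 - p)"
        using p G0 GA by (intro mult_left_mono powr_mono2) auto
      also have "(A * (1 + norm (v - x)) ^ L) powr (1 - p) = A powr (1 - p) * ((1 + norm (v - x)) ^ L) powr (1 - p)"
        by (rule powr_mult)
      \<comment> \<open>The weight is at least 1, so it does not decrease when its exponent is
        raised from \<open>1 - p\<close> to 1.\<close>
      also have "((1 + norm (v - x)) ^ L) powr (1 - p) \<le> ((1 + norm (v - x)) ^ L) powr 1"
        using p by (intro powr_mono) (auto intro: one_le_power)
      also have "\<dots> = (1 + norm (v - x)) ^ L" using pos[of "v - x" L] by simp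
      also have "\<dots> \<le> (1 + norm (y - x)) ^ L * (1 + norm (v - y)) ^ L"
        using one_plus_norm_le[of "v - x" L "y - x"] by simp
      finally have "G v \<le> G v powr p * (A powr (1 - p) * ((1 + norm (y - x)) ^ L * (1 + norm (v - y)) ^ L))"
        by (simp add: mult_left_mono)
      then have "G v * inverse ((1 + norm (v - y)) ^ (L + ?D))
         \<le> G v powr p * (A powr (1 - p) * ((1 + norm (y - x)) ^ L * (1 + norm (v - y)) ^ L)) * inverse ((1 + norm (v - y)) ^ (L + ?D))"
        using pos[of "v - y" "L + ?D"] by (intro mult_right_mono) auto
      \<comment> \<open>Of the powers in the kernel, \<open>L\<close> cancel the weight of
        \<open>v - y\<close> from Peetre's inequality; the other \<open>2 * CARD('d)\<close> make
        the remaining integral converge.\<close>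
      also have "\<dots> = (A powr (1 - p) * (1 + norm (y - x)) ^ L) * (G v powr p * inverse ((1 + norm (v - y)) ^ ?D))"
        using pos[of "v - y" L] by (simp add: power_add field_simps)
      finally show ?thesis .
    qed simp
    have "ennreal (G y) \<le> ennreal K * (\<integral>\<^sup>+v. ennreal (G v * inverse ((1 + norm (v - y)) ^ (L + ?D))) \<partial>lborel)"
      by (rule repr)
    also have "\<dots> \<le> ennreal K * (\<integral>\<^sup>+v. ennreal (A powr (1 - p) * (1 + norm (y - x)) ^ L) *
         (ennreal (G v powr p) * ennreal (inverse ((1 + norm (v - y)) ^ ?D))) \<partial>lborel)"
      using pt by (intro mult_left_mono nn_integral_mono) (auto simp flip: ennreal_mult intro!: ennreal_leI)
    also have "\<dots> = ennreal K * (ennreal (A powr (1 - p) * (1 + norm (y - x)) ^ L) *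
        (\<integral>\<^sup>+v. ennreal (G v powr p) * ennreal (inverse ((1 + norm (v - y)) ^ ?D)) \<partial>lborel))"
      by (subst nn_integral_cmult) auto
    also have "\<dots> \<le> ennreal K * (ennreal (A powr (1 - p) * (1 + norm (y - x)) ^ L) *
        (ennreal ((1 + real CARD('d)) ^ ?D) * ennreal B * ennreal (weight_integral TYPE('d) ?D)))"
      using weighted_integral_le[OF _ B, of y ?D] unfolding weight_integral_finite
      by (intro mult_left_mono) auto
    also have "\<dots> = ennreal (?K * A powr (1 - p) * (1 + norm (y - x)) ^ L)"
      using K0 B0 W0 by (simp add: mult_ac flip: ennreal_mult)
    finally have "G y \<le> ?K * A powr (1 - p) * (1 + norm (y - x)) ^ L"
      using K by (subst (asm) ennreal_le_iff) auto
    then show ?thesis using pos[of "y - x" L] by (simp add: q_def field_simps)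
  qed
  then have "A \<le> ?K * A powr (1 - p)"
    unfolding A_def by (intro cSUP_least) auto
  have AK: "A \<le> ?K powr (1 / p)"
  proof (cases "A = 0")
    case False
    with A0' have Apos: "0 < A" by simp
    then have "A powr p * A powr (1 - p) = A" by (simp flip: powr_add)
    with \<open>A \<le> ?K * A powr (1 - p)\<close> have "A powr p * A powr (1 - p) \<le> ?K * A powr (1 - p)" by simp
    then have "A powr p \<le> ?K" using Apos by (simp add: mult_le_cancel_right)
    then have "(A powr p) powr (1 / p) \<le> ?K powr (1 / p)"
      using p by (intro powr_mono2) auto
    then show ?thesis using Apos p by (simp add: powr_powr)
  qed simp
  have "G y \<le> A * (1 + norm (y - x)) ^ L" by (rule GA)
  also have "\<dots> \<le> ?K powr (1 / p) * (1 + norm (y - x)) ^ L"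
    by (intro mult_right_mono AK) auto
  finally show ?thesis .
qed

text \<open>The step is applied twice. The constant of the first pass involves the growth order
  \<open>L\<close>, which depends on the function; at \<open>y = x\<close> it shows that
  \<open>G\<close> is bounded. The second pass can therefore start from \<open>L = 0\<close>, and
  its constant no longer depends on the growth.\<close>

lemma reproducing_bound:
  fixes G :: "real ^ 'd::finite \<Rightarrow> real"
  assumes G: "G \<in> borel_measurable borel" and G0: "\<And>y. 0 \<le> G y"
    and p: "0 < p" "p \<le> 1" and B0: "0 \<le> B" and K0: "\<And>M. 0 \<le> K M"
    and growth: "\<And>y. G y \<le> A0 * (1 + norm y) ^ L"
    and repr: "\<And>y M. ennreal (G y) \<le> ennreal (K M) *
       (\<integral>\<^sup>+v. ennreal (G v * inverse ((1 + norm (v - y)) ^ M)) \<partial>lborel)"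
    and B: "\<And>k. (\<integral>\<^sup>+v. ennreal (G v powr p) * indicator (dyadic_cube 0 k) v \<partial>lborel) \<le> ennreal B"
  shows "G x \<le> (K (2 * CARD('d)) * (1 + real CARD('d)) ^ (2 * CARD('d)) * B * weight_integral TYPE('d) (2 * CARD('d))) powr (1 / p)"
proof -
  let ?Z = "(K (L + 2 * CARD('d)) * (1 + real CARD('d)) ^ (2 * CARD('d)) * B * weight_integral TYPE('d) (2 * CARD('d))) powr (1 / p)"
  have "0 \<le> A0" using order_trans[OF G0 growth, of 0] by simp
  have Z: "G x \<le> ?Z * (1 + norm (x - x)) ^ L" for x
  proof (rule reproducing_bound_step[OF G G0 p B0 K0 _ repr B])
    fix y
    have "G y \<le> A0 * ((1 + norm x) ^ L * (1 + norm (y - x)) ^ L)"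
      using growth[of y] mult_left_mono[OF one_plus_norm_le[of y L x] \<open>0 \<le> A0\<close>] by simp
    then show "G y \<le> (A0 * (1 + norm x) ^ L) * (1 + norm (y - x)) ^ L" by (simp add: mult.assoc)
  qed
  have "G x \<le> (K (2 * CARD('d)) * (1 + real CARD('d)) ^ (2 * CARD('d)) * B * weight_integral TYPE('d) (2 * CARD('d))) powr (1 / p)
    * (1 + norm (x - x)) ^ 0"
    by (rule reproducing_bound_step[OF G G0 p B0 K0 _ _ B, where ?A0.0 = ?Z]) (use Z repr in auto)
  then show ?thesis by simp
qed

section \<open>Uniform bounds for the blocks\<close>

context littlewood_paley
begin

lemma ker_decay: "\<exists>C\<ge>0. \<forall>z. norm (ker 0 z) \<le> C * inverse ((1 + norm z) ^ M)"
proof -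
  obtain C where C: "\<And>z. (1 + norm z) ^ M * norm (partials [] (ker 0) z) \<le> C"
    using ker_schwartz[of 0] unfolding schwartz_iff by metis
  have "norm (ker 0 z) \<le> \<bar>C\<bar> * inverse ((1 + norm z) ^ M)" for z
  proof -
    have "0 < (1 + norm z) ^ M" by (simp add: add_pos_nonneg)
    then show ?thesis using C[of z] by (simp add: field_simps)
  qed
  then show ?thesis by (intro exI[of _ "\<bar>C\<bar>"]) auto
qed

text \<open>Dilation by 2^-j carries unit cubes to cubes of side 2^-j. Since all kernels are dilates
  of \<open>ker 0\<close>, the constants become independent of the level and of the
  distribution.\<close>

lemma blk_reproducing_scaled:
  obtains C where "\<And>M. 0 \<le> C M" and
    "\<And>M T j y. T \<in> tempered_distributions \<Longrightarrow> ennreal (norm (blk j T ((1 / 2) ^ j *\<^sub>R y))) \<le> ennreal (C M) *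
       (\<integral>\<^sup>+v. ennreal (norm (blk j T ((1 / 2) ^ j *\<^sub>R v)) * inverse ((1 + norm (v - y)) ^ M)) \<partial>lborel)"
proof -
  obtain C where C: "\<And>M. 0 \<le> C M" "\<And>M z. norm (ker 0 z) \<le> C M * inverse ((1 + norm z) ^ M)"
    using ker_decay by metis
  show ?thesis
  proof (rule that[of "\<lambda>M. 2 ^ CARD('d) * C M"])
    show "0 \<le> 2 ^ CARD('d) * C M" for M using C(1) by simp
    fix M j y and T :: "'d functional" assume T: "T \<in> tempered_distributions"
    let ?c = "(1 / 2 :: real) ^ j"
    have [measurable]: "blk j T \<in> borel_measurable borel"
      by (intro borel_measurable_continuous_onI blk_continuous[OF T])
    have "ennreal (norm (blk j T (?c *\<^sub>R y))) \<le> (\<integral>\<^sup>+v. ennreal (norm (ker (Suc j) (v - ?c *\<^sub>R y) * blk j T v)) \<partial>lborel)"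
      unfolding blk_reproducing[OF T, of j "?c *\<^sub>R y"]
      by (cases "integrable lborel (\<lambda>v. ker (Suc j) (v - ?c *\<^sub>R y) * blk j T v)")
        (auto intro: integral_norm_bound_ennreal simp: not_integrable_integral_eq)
    also have "\<dots> = ennreal (?c ^ CARD('d)) *
        (\<integral>\<^sup>+v. ennreal (norm (ker (Suc j) (?c *\<^sub>R v - ?c *\<^sub>R y) * blk j T (?c *\<^sub>R v))) \<partial>lborel)"
      by (subst nn_integral_lborel_affine[where c = ?c and t = 0]) auto
    also have "\<dots> = (\<integral>\<^sup>+v. ennreal (?c ^ CARD('d)) *
        ennreal (norm (ker (Suc j) (?c *\<^sub>R v - ?c *\<^sub>R y) * blk j T (?c *\<^sub>R v))) \<partial>lborel)"
      by (rule nn_integral_cmult[symmetric]) auto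
    also have "\<dots> \<le> (\<integral>\<^sup>+v. ennreal (2 ^ CARD('d) * C M) *
        ennreal (norm (blk j T (?c *\<^sub>R v)) * inverse ((1 + norm (v - y)) ^ M)) \<partial>lborel)"
    proof (rule nn_integral_mono)
      fix v :: "real ^ 'd"
      \<comment> \<open>The reproducing kernel has level \<open>Suc j\<close> instead of
        \<open>j\<close>: this costs the factor 2^d, and the argument
        \<open>2 *\<^sub>R (v - y)\<close> only improves the decay.\<close>
      have "?c ^ CARD('d) * norm (ker (Suc j) (?c *\<^sub>R v - ?c *\<^sub>R y))
         = 2 ^ CARD('d) * norm (ker 0 (2 *\<^sub>R (v - y)))"
      proof -
        have "2 ^ Suc j *\<^sub>R (?c *\<^sub>R v - ?c *\<^sub>R y) = 2 *\<^sub>R (v - y)"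
          by (simp add: power_one_over flip: scaleR_diff_right)
        moreover have "?c ^ CARD('d) * 2 ^ (Suc j * CARD('d)) = 2 ^ CARD('d)"
          by (simp add: power_one_over power_mult power_add)
        ultimately show ?thesis
          by (simp only: ker_scale[of "Suc j"] norm_mult) (simp add: norm_power)
      qed
      also have "norm (ker 0 (2 *\<^sub>R (v - y))) \<le> C M * inverse ((1 + norm (2 *\<^sub>R (v - y))) ^ M)"
        by (rule C)
      also have "\<dots> \<le> C M * inverse ((1 + norm (v - y)) ^ M)"
        using C(1) by (intro mult_left_mono le_imp_inverse_le power_mono) (auto intro!: add_pos_nonneg zero_less_power)
      finally have "?c ^ CARD('d) * norm (ker (Suc j) (?c *\<^sub>R v - ?c *\<^sub>R y))
         \<le> 2 ^ CARD('d) * (C M * inverse ((1 + norm (v - y)) ^ M))" by simp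
      from mult_right_mono[OF this, of "norm (blk j T (?c *\<^sub>R v))"]
      show "ennreal (?c ^ CARD('d)) * ennreal (norm (ker (Suc j) (?c *\<^sub>R v - ?c *\<^sub>R y) * blk j T (?c *\<^sub>R v)))
         \<le> ennreal (2 ^ CARD('d) * C M) * ennreal (norm (blk j T (?c *\<^sub>R v)) * inverse ((1 + norm (v - y)) ^ M))"
        using C(1) by (simp add: norm_mult mult_ac ennreal_leI flip: ennreal_mult)
    qed
    also have "\<dots> = ennreal (2 ^ CARD('d) * C M) *
        (\<integral>\<^sup>+v. ennreal (norm (blk j T (?c *\<^sub>R v)) * inverse ((1 + norm (v - y)) ^ M)) \<partial>lborel)"
      by (rule nn_integral_cmult) auto
    finally show "ennreal (norm (blk j T (?c *\<^sub>R y))) \<le> ennreal (2 ^ CARD('d) * C M) *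
       (\<integral>\<^sup>+v. ennreal (norm (blk j T (?c *\<^sub>R v)) * inverse ((1 + norm (v - y)) ^ M)) \<partial>lborel)" .
  qed
qed

lemma blk_growth:
  assumes T: "T \<in> tempered_distributions"
  obtains A L where "\<And>x. norm (blk j T x) \<le> A * (1 + norm x) ^ L"
  unfolding blk_def using tempered_translate_growth[OF T kernel_schwartz[of j]] by blast

text \<open>The hypothesis bounds the mean of |f_j|^p on each cube of side 2^-j by 2 N^p; after
  rescaling these are unit cubes. The growth of the block depends on \<open>T\<close>, but it serves
  only to make the absorption possible and leaves no trace in \<open>C\<close>.\<close>

theorem blk_bounded:
  assumes p: "0 < p" "p \<le> 1"
  obtains C where "0 < C" and
    "\<And>T j N x. T \<in> tempered_distributions \<Longrightarrow> 0 < N \<Longrightarrow>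
      (\<And>k. (\<integral>\<^sup>+v. ennreal (norm (blk j T v) powr p) * indicator (dyadic_cube (int j) k) v \<partial>lborel)
          \<le> ennreal (2 * N powr p * 2 powr (- real j * CARD('d)))) \<Longrightarrow> norm (blk j T x) \<le> C * N"
proof -
  obtain K where K: "\<And>M. 0 \<le> K M" and
    repr: "\<And>M T j y. T \<in> tempered_distributions \<Longrightarrow> ennreal (norm (blk j T ((1 / 2) ^ j *\<^sub>R y))) \<le> ennreal (K M) *
       (\<integral>\<^sup>+v. ennreal (norm (blk j T ((1 / 2) ^ j *\<^sub>R v)) * inverse ((1 + norm (v - y)) ^ M)) \<partial>lborel)"
    by (rule blk_reproducing_scaled) blast
  let ?K = "K (2 * CARD('d)) * (1 + real CARD('d)) ^ (2 * CARD('d)) * 2 * weight_integral TYPE('d) (2 * CARD('d))"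
  have K0: "0 \<le> ?K" using K by (simp add: weight_integral_def)
  show ?thesis
  \<comment> \<open>The added 1 only secures a positive constant.\<close>
  proof (rule that[of "?K powr (1 / p) + 1"])
    show "0 < ?K powr (1 / p) + 1" by (simp add: add_nonneg_pos)
    fix T :: "'d functional" and j :: nat and N :: real and x :: "real ^ 'd"
    assume T: "T \<in> tempered_distributions" and N: "0 < N" and
      B: "\<And>k. (\<integral>\<^sup>+v. ennreal (norm (blk j T v) powr p) * indicator (dyadic_cube (int j) k) v \<partial>lborel)
          \<le> ennreal (2 * N powr p * 2 powr (- real j * CARD('d)))"
    let ?c = "(1 / 2 :: real) ^ j"
    have c0: "0 < ?c" "?c \<le> 1" by (auto simp: power_le_one)
    define G where "G v = norm (blk j T (?c *\<^sub>R v))" for v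
    have bm[measurable]: "blk j T \<in> borel_measurable borel"
      by (intro borel_measurable_continuous_onI blk_continuous[OF T])
    obtain A L where AL: "\<And>x. norm (blk j T x) \<le> A * (1 + norm x) ^ L"
      by (rule blk_growth[OF T]) blast
    have A0: "0 \<le> A" using order_trans[OF norm_ge_zero AL, of 0] by simp
    have "G y \<le> (K (2 * CARD('d)) * (1 + real CARD('d)) ^ (2 * CARD('d)) * (2 * N powr p) * weight_integral TYPE('d) (2 * CARD('d))) powr (1 / p)" for y
    proof (rule reproducing_bound[OF _ _ p _ K])
      show "G \<in> borel_measurable borel" unfolding G_def by measurable
      show "0 \<le> G y" for y by (simp add: G_def)
      show "0 \<le> 2 * N powr p" by simp
      show "G y \<le> A * (1 + norm y) ^ L" for y
      proof -
        have "(1 + norm (?c *\<^sub>R y)) ^ L \<le> (1 + norm y) ^ L"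
          using c0 by (intro power_mono) (auto intro: mult_left_le_one_le)
        then show ?thesis using AL[of "?c *\<^sub>R y"] mult_left_mono[OF _ A0] unfolding G_def
          by (meson order_trans)
      qed
      show "ennreal (G y) \<le> ennreal (K M) * (\<integral>\<^sup>+v. ennreal (G v * inverse ((1 + norm (v - y)) ^ M)) \<partial>lborel)" for y M
        unfolding G_def by (rule repr[OF T])
      fix k
      have ind: "indicator (dyadic_cube (int j) k) (?c *\<^sub>R v) = (indicator (dyadic_cube 0 k) v :: ennreal)" for v :: "real ^ 'd"
        by (simp add: indicator_def dyadic_cube_eq power_one_over)
      have cd: "?c ^ CARD('d) = 2 powr (- real j * CARD('d))"
        by (simp add: power_one_over powr_minus inverse_eq_divide powr_realpow power_mult flip: powr_powr)
      have "ennreal (?c ^ CARD('d)) * (\<integral>\<^sup>+v. ennreal (G v powr p) * indicator (dyadic_cube 0 k) v \<partial>lborel)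
        = (\<integral>\<^sup>+v. ennreal (norm (blk j T v) powr p) * indicator (dyadic_cube (int j) k) v \<partial>lborel)"
        using c0 by (subst (2) nn_integral_lborel_affine[where c = ?c and t = 0]) (auto simp: G_def ind)
      also have "\<dots> \<le> ennreal (?c ^ CARD('d)) * ennreal (2 * N powr p)"
        using B[of k] c0 by (simp add: cd mult_ac flip: ennreal_mult)
      finally show "(\<integral>\<^sup>+v. ennreal (G v powr p) * indicator (dyadic_cube 0 k) v \<partial>lborel) \<le> ennreal (2 * N powr p)"
        using c0 by (subst (asm) ennreal_mult_le_mult_iff) auto
    qed
    from this[of "2 ^ j *\<^sub>R x"]
    have "norm (blk j T x) \<le> (?K * N powr p) powr (1 / p)"
      by (simp add: G_def power_one_over mult_ac)
    also have "\<dots> = ?K powr (1 / p) * N"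
      using N p by (simp add: powr_mult powr_powr)
    also have "\<dots> \<le> (?K powr (1 / p) + 1) * N" using N by simp
    finally show "norm (blk j T x) \<le> (?K powr (1 / p) + 1) * N" .
  qed
qed

end

section \<open>Summation of the blocks\<close>

lemma enn_powr_ennreal: "0 \<le> t \<Longrightarrow> enn_powr (ennreal t) a = ennreal (t powr a)"
  by (simp add: enn_powr_def)

lemma enn_powr_mono: "x \<le> y \<Longrightarrow> 0 \<le> a \<Longrightarrow> enn_powr x a \<le> enn_powr y a"
  by (cases x; cases y) (auto simp: enn_powr_def top_unique intro!: ennreal_leI powr_mono2)

lemma enn_powr_measurable [measurable]:
  assumes [measurable]: "f \<in> borel_measurable M"
  shows "(\<lambda>x. enn_powr (f x) a) \<in> borel_measurable M"
  unfolding enn_powr_def by measurable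

text \<open>For the tail, a_j = a_j^(1-\<alpha>) a_j^\<alpha> is estimated by the constant bound in
  the first factor and the decaying one in the second. What remains is a geometric series of ratio
  2^(-s \<alpha>).\<close>

lemma geometric_block_sum:
  fixes a :: "nat \<Rightarrow> real" and s \<alpha> C \<sigma> :: real
  assumes s: "0 < s" and \<alpha>: "0 < \<alpha>" "\<alpha> \<le> 1" and \<sigma>: "0 \<le> \<sigma>"
    and a0: "\<And>j. 0 \<le> a j" and aC: "\<And>j. a j \<le> C" and a\<sigma>: "\<And>j. a j \<le> 2 powr (- (real j * s)) * \<sigma>"
  shows "summable a"
    and "suminf a \<le> C * real J + C powr (1 - \<alpha>) / (1 - 2 powr (- (s * \<alpha>))) * (2 powr (- (real J * s)) * \<sigma>) powr \<alpha>"
proof -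
  let ?q = "2 powr (- (s * \<alpha>))"
  let ?X = "C powr (1 - \<alpha>) * (2 powr (- (real J * s)) * \<sigma>) powr \<alpha>"
  have q: "0 \<le> ?q" "?q < 1" using s \<alpha> by (auto simp: powr_less_one)
  have bound: "a (j + J) \<le> ?X * ?q ^ j" for j
  proof (cases "a (j + J) = 0")
    case False
    then have pos: "0 < a (j + J)" using a0[of "j + J"] by simp
    then have "a (j + J) = a (j + J) powr (1 - \<alpha>) * a (j + J) powr \<alpha>" by (simp flip: powr_add)
    also have "\<dots> \<le> C powr (1 - \<alpha>) * (2 powr (- (real (j + J) * s)) * \<sigma>) powr \<alpha>"
      using \<alpha> a0 aC a\<sigma>[of "j + J"] by (intro mult_mono powr_mono2) auto
    also have "2 powr (- (real (j + J) * s)) = 2 powr (- (real j * s)) * 2 powr (- (real J * s))"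
      by (simp add: algebra_simps flip: powr_add)
    also have "\<dots> * \<sigma> = 2 powr (- (real j * s)) * (2 powr (- (real J * s)) * \<sigma>)"
      by (rule mult.assoc)
    also have "(2 powr (- (real j * s)) * (2 powr (- (real J * s)) * \<sigma>)) powr \<alpha>
       = ?q ^ j * (2 powr (- (real J * s)) * \<sigma>) powr \<alpha>"
      by (simp add: powr_mult powr_powr mult_ac flip: powr_realpow)
    finally show ?thesis by (simp add: mult_ac)
  qed simp
  have geo: "summable (\<lambda>j. ?X * ?q ^ j)" using q by (intro summable_mult summable_geometric) simp
  have shift: "summable (\<lambda>j. a (j + J))"
    by (rule summable_comparison_test'[OF geo, of 0]) (use a0 bound in auto)
  then show sm: "summable a" by (simp add: summable_iff_shift)
  have "suminf a = (\<Sum>j. a (j + J)) + (\<Sum>j<J. a j)"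
    by (rule suminf_split_initial_segment[OF sm])
  also have "(\<Sum>j. a (j + J)) \<le> (\<Sum>j. ?X * ?q ^ j)"
    by (intro suminf_le bound shift geo)
  also have "\<dots> = ?X / (1 - ?q)" using q by (subst suminf_mult) (auto simp: suminf_geometric intro: summable_geometric)
  also have "(\<Sum>j<J. a j) \<le> (\<Sum>j<J. C)" by (intro sum_mono aC)
  finally show "suminf a \<le> C * real J + C powr (1 - \<alpha>) / (1 - ?q) * (2 powr (- (real J * s)) * \<sigma>) powr \<alpha>"
    by (simp add: mult_ac)
qed

text \<open>This takes the place of Hoelder's inequality between the exponents \<open>e\<close> and
  \<open>p\<close>: below the threshold \<open>l\<close> the first term suffices, above it v^(e-p)
  \<le> l^(e-p). The threshold is free and will be set to the expected size of
  \<open>v\<close>.\<close>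

lemma powr_le_split:
  fixes v l e p :: real
  assumes "0 \<le> v" "0 < l" "0 < e" "e \<le> p"
  shows "v powr e \<le> l powr e + l powr (e - p) * v powr p"
proof (cases "v \<le> l")
  case True
  then have "v powr e \<le> l powr e" using assms by (intro powr_mono2) auto
  then show ?thesis by (simp add: add_increasing2)
next
  case False
  then have "v powr e = v powr p * v powr (e - p)" using assms by (simp flip: powr_add)
  also have "v powr (e - p) \<le> l powr (e - p)" using False assms by (intro powr_mono2') auto
  finally have "v powr e \<le> v powr p * l powr (e - p)" by (simp add: mult_left_mono)
  then show ?thesis by (simp add: mult_ac add_increasing)
qed

lemma powr_add_le:
  fixes a b r :: real
  assumes "0 \<le> a" "0 \<le> b" "0 \<le> r"
  shows "(a + b) powr r \<le> 2 powr r * (a powr r + b powr r)"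
proof -
  have "(a + b) powr r \<le> (2 * max a b) powr r" using assms by (intro powr_mono2) auto
  also have "\<dots> = 2 powr r * max a b powr r" by (rule powr_mult)
  also have "\<dots> \<le> 2 powr r * (a powr r + b powr r)"
    using assms by (intro mult_left_mono) (auto simp: max_def)
  finally show ?thesis .
qed

text \<open>\<open>N\<close> is factored out first, so that both constants are free of it. The
  threshold splitting then leaves \<sigma> only in the power \<open>p\<close>, the one that the
  Morrey norm integrates.\<close>

lemma block_sum_powr_le:
  fixes a :: "nat \<Rightarrow> real" and s \<alpha> C N \<sigma> p r l :: real
  assumes s: "0 < s" and \<alpha>: "0 < \<alpha>" "\<alpha> \<le> 1" and \<sigma>: "0 \<le> \<sigma>" and C: "0 < C" and N: "0 < N"
    and a0: "\<And>j. 0 \<le> a j" and aC: "\<And>j. a j \<le> C * N" and a\<sigma>: "\<And>j. a j \<le> 2 powr (- (real j * s)) * \<sigma>"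
    and r: "1 \<le> r" "\<alpha> * r \<le> p" and l: "0 < l"
  defines "K \<equiv> C powr (1 - \<alpha>) / (1 - 2 powr (- (s * \<alpha>)))"
  shows "summable a"
    and "suminf a powr r \<le> (2 * N) powr r * ((C * real J) powr r + K powr r * l powr (\<alpha> * r))
      + (2 * N) powr r * K powr r * l powr (\<alpha> * r - p) * (2 powr (- (real J * s)) / N) powr p * \<sigma> powr p"
proof -
  show "summable a" by (rule geometric_block_sum[OF s \<alpha> \<sigma> a0 aC a\<sigma>])
  have q: "2 powr (- (s * \<alpha>)) < 1" using s \<alpha> by (auto simp: powr_less_one)
  have K: "0 < K" unfolding K_def using q C by simp
  let ?v = "2 powr (- (real J * s)) / N * \<sigma>"
  have v: "0 \<le> ?v" using \<sigma> N by simp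
  have "suminf a \<le> (C * N) * real J + (C * N) powr (1 - \<alpha>) / (1 - 2 powr (- (s * \<alpha>))) * (2 powr (- (real J * s)) * \<sigma>) powr \<alpha>"
    by (rule geometric_block_sum(2)[OF s \<alpha> \<sigma> a0 aC a\<sigma>])
  also have "2 powr (- (real J * s)) * \<sigma> = N * ?v" using N by simp
  also have "(C * N) powr (1 - \<alpha>) / (1 - 2 powr (- (s * \<alpha>))) * (N * ?v) powr \<alpha>
     = K * (N powr (1 - \<alpha>) * N powr \<alpha>) * ?v powr \<alpha>"
    by (simp only: K_def powr_mult) (simp add: mult_ac)
  also have "N powr (1 - \<alpha>) * N powr \<alpha> = N" using N by (simp flip: powr_add)
  finally have le: "suminf a \<le> N * (C * real J + K * ?v powr \<alpha>)" by (simp add: algebra_simps)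
  have "0 \<le> suminf a" by (intro suminf_nonneg \<open>summable a\<close> a0)
  with le have "suminf a powr r \<le> (N * (C * real J + K * ?v powr \<alpha>)) powr r"
    using r by (intro powr_mono2) auto
  also have "\<dots> = N powr r * (C * real J + K * ?v powr \<alpha>) powr r" by (rule powr_mult)
  also have "\<dots> \<le> N powr r * (2 powr r * ((C * real J) powr r + (K * ?v powr \<alpha>) powr r))"
    using C K r by (intro mult_left_mono powr_add_le) auto
  also have "\<dots> = (2 * N) powr r * ((C * real J) powr r + K powr r * ?v powr (\<alpha> * r))"
    by (simp add: powr_mult powr_powr mult_ac)
  also have "\<dots> \<le> (2 * N) powr r * ((C * real J) powr r + K powr r * (l powr (\<alpha> * r) + l powr (\<alpha> * r - p) * ?v powr p))"
    using \<alpha> r by (intro mult_left_mono add_left_mono powr_le_split v l) auto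
  also have "?v powr p = (2 powr (- (real J * s)) / N) powr p * \<sigma> powr p" by (rule powr_mult)
  finally show "suminf a powr r \<le> (2 * N) powr r * ((C * real J) powr r + K powr r * l powr (\<alpha> * r))
      + (2 * N) powr r * K powr r * l powr (\<alpha> * r - p) * (2 powr (- (real J * s)) / N) powr p * \<sigma> powr p"
    by (simp add: algebra_simps)
qed

section \<open>Integration over dyadic cubes\<close>

context littlewood_paley
begin

definition sup_fun :: "real \<Rightarrow> 'd functional \<Rightarrow> real ^ 'd \<Rightarrow> ennreal" where
  "sup_fun s T x = (SUP j. ennreal (2 powr (real j * s) * norm (blk j T x)))"

definition abs_sum :: "'d functional \<Rightarrow> real ^ 'd \<Rightarrow> ennreal" where
  "abs_sum T x = (\<Sum>j. ennreal (norm (blk j T x)))"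

lemma blk_measurable: "T \<in> tempered_distributions \<Longrightarrow> blk j T \<in> borel_measurable borel"
  by (intro borel_measurable_continuous_onI blk_continuous)

lemma sup_fun_measurable: "T \<in> tempered_distributions \<Longrightarrow> sup_fun s T \<in> borel_measurable borel"
  unfolding sup_fun_def[abs_def] using blk_measurable by measurable

lemma abs_sum_measurable: "T \<in> tempered_distributions \<Longrightarrow> abs_sum T \<in> borel_measurable borel"
  unfolding abs_sum_def[abs_def] using blk_measurable by measurable

lemma sup_fun_ge: "ennreal (2 powr (real j * s) * norm (blk j T x)) \<le> sup_fun s T x"
  unfolding sup_fun_def by (rule SUP_upper) simp

text \<open>A sequence norm of exponent \<open>q\<close> dominates each of its terms.\<close>

lemma sup_fun_le:
  assumes T: "T \<in> tempered_distributions" and q: "0 < q"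
  shows "sup_fun s T x \<le> (if q = \<infinity> then (SUP j. ennreal (2 powr (real j * s) * norm (lp_block \<phi> j T x)))
     else enn_powr (\<Sum>j. ennreal (2 powr (real j * s * real_of_ereal q) *
                      norm (lp_block \<phi> j T x) powr real_of_ereal q)) (1 / real_of_ereal q))"
proof (cases "q = \<infinity>")
  case False
  define e where "e = real_of_ereal q"
  have e: "0 < e" unfolding e_def using q False by (cases q) auto
  let ?t = "\<lambda>j. ennreal (2 powr (real j * s * e) * norm (blk j T x) powr e)"
  have "ennreal (2 powr (real j * s) * norm (blk j T x)) \<le> enn_powr (\<Sum>j. ?t j) (1 / e)" for j
  proof -
    have "?t j \<le> (\<Sum>j. ?t j)"
    proof -
      have "sum ?t {j} \<le> suminf ?t" by (rule sum_le_suminf) auto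
      then show ?thesis by simp
    qed
    then have "enn_powr (?t j) (1 / e) \<le> enn_powr (\<Sum>j. ?t j) (1 / e)"
      using e by (intro enn_powr_mono) auto
    also have "enn_powr (?t j) (1 / e) = ennreal (2 powr (real j * s) * norm (blk j T x))"
      using e by (simp add: enn_powr_ennreal powr_mult powr_powr)
    finally show ?thesis .
  qed
  then show ?thesis
    using False by (simp add: sup_fun_def lp_block_eq[OF T] e_def SUP_least)
qed (simp add: sup_fun_def lp_block_eq[OF T])

text \<open>The Morrey norm, restricted to one cube and solved for the integral: raising |Q|^(1/u -
  1/p) to the power \<open>p\<close> and moving it to the other side produces the exponent 1 -
  p/u.\<close>

lemma sup_fun_integral_le:
  assumes T: "T \<in> tempered_distributions" and q: "0 < q" and p: "0 < p" and u: "0 < u" and N: "0 < N"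
    and norm: "tlm_norm \<phi> s u p q T \<le> ennreal N"
  shows "(\<integral>\<^sup>+x. enn_powr (sup_fun s T x) p * indicator (dyadic_cube j k) x \<partial>lborel)
    \<le> ennreal (N powr p * measure lebesgue (dyadic_cube j k) powr (1 - p / u))"
proof -
  let ?Q = "dyadic_cube j k"
  let ?m = "measure lebesgue ?Q"
  let ?V = "\<lambda>x. if q = \<infinity> then (SUP j. ennreal (2 powr (real j * s) * norm (lp_block \<phi> j T x)))
     else enn_powr (\<Sum>j. ennreal (2 powr (real j * s * real_of_ereal q) *
                      norm (lp_block \<phi> j T x) powr real_of_ereal q)) (1 / real_of_ereal q)"
  define I where "I = (\<integral>\<^sup>+x. enn_powr (?V x) p * indicator ?Q x \<partial>lebesgue)"
  have m: "0 < ?m" by (simp add: measure_dyadic_cube)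
  have "?Q \<in> dyadic_cubes" by (auto simp: dyadic_cubes_def)
  then have "ennreal (?m powr (1 / u - 1 / p)) * enn_powr I (1 / p) \<le> tlm_norm \<phi> s u p q T"
    unfolding tlm_norm_def morrey_norm_def I_def by (rule SUP_upper)
  with norm have le: "ennreal (?m powr (1 / u - 1 / p)) * enn_powr I (1 / p) \<le> ennreal N"
    by (rule order_trans[rotated])
  \<comment> \<open>The volume factor is positive, so an infinite integral would make the bounded
    product infinite.\<close>
  have fin: "I \<noteq> \<infinity>"
  proof
    assume "I = \<infinity>"
    then show False using le m by (simp add: enn_powr_def ennreal_mult_top top_unique)
  qed
  then obtain t where t: "I = ennreal t" "0 \<le> t" by (cases I) auto
  have "?m powr (1 / u - 1 / p) * t powr (1 / p) \<le> N"
    using le t N by (simp add: enn_powr_ennreal flip: ennreal_mult)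
  then have "(?m powr (1 / u - 1 / p) * t powr (1 / p)) powr p \<le> N powr p"
    using p by (intro powr_mono2) auto
  also have "(?m powr (1 / u - 1 / p) * t powr (1 / p)) powr p = ?m powr (p / u - 1) * t"
    using p t by (simp add: powr_mult powr_powr left_diff_distrib)
  finally have "?m powr (1 - p / u) * (?m powr (p / u - 1) * t) \<le> ?m powr (1 - p / u) * N powr p"
    by (intro mult_left_mono) auto
  also have "?m powr (1 - p / u) * (?m powr (p / u - 1) * t) = t"
    using m by (simp flip: powr_add mult.assoc)
  finally have tle: "t \<le> N powr p * ?m powr (1 - p / u)" by (simp add: mult.commute)
  have "(\<integral>\<^sup>+x. enn_powr (sup_fun s T x) p * indicator ?Q x \<partial>lborel) \<le> (\<integral>\<^sup>+x. enn_powr (?V x) p * indicator ?Q x \<partial>lborel)"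
    by (intro nn_integral_mono mult_right_mono enn_powr_mono sup_fun_le T q) (use p in auto)
  also have "\<dots> = I" unfolding I_def by (rule nn_integral_completion[symmetric])
  also have "\<dots> \<le> ennreal (N powr p * ?m powr (1 - p / u))"
    unfolding t(1) using tle by (rule ennreal_leI)
  finally show ?thesis .
qed

text \<open>The critical smoothness is used here: on a cube of level \<open>j\<close> the factor
  2^(jsp) of S^p is exactly compensated by |Q|^(p/u), so the mean of |f_j|^p is bounded by N^p with
  no loss in \<open>j\<close>.\<close>

lemma blk_uniform_bound:
  assumes p: "0 < p" and u: "0 < u"
  obtains C where "0 < C" and
    "\<And>T q N j x. T \<in> tempered_distributions \<Longrightarrow> 0 < q \<Longrightarrow> 0 < N \<Longrightarrow>
      tlm_norm \<phi> (real CARD('d) / u) u p q T \<le> ennreal N \<Longrightarrow> norm (blk j T x) \<le> C * N"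
proof -
  let ?s = "real CARD('d) / u"
  \<comment> \<open>The absorption argument needs an exponent at most 1. For p > 1 it is lowered by
    splitting at the threshold \<open>N\<close>; both parts contribute N^e |Q|, whence the factor 2
    in \<open>blk_bounded\<close>.\<close>
  define e where "e = min p 1"
  have e: "0 < e" "e \<le> 1" "e \<le> p" using p by (auto simp: e_def)
  obtain C where C: "0 < C" and
    bd: "\<And>T j N x. T \<in> tempered_distributions \<Longrightarrow> 0 < N \<Longrightarrow>
      (\<And>k. (\<integral>\<^sup>+v. ennreal (norm (blk j T v) powr e) * indicator (dyadic_cube (int j) k) v \<partial>lborel)
          \<le> ennreal (2 * N powr e * 2 powr (- real j * CARD('d)))) \<Longrightarrow> norm (blk j T x) \<le> C * N"
    by (rule blk_bounded[OF e(1,2)]) blast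
  show ?thesis
  proof (rule that[OF C])
    fix T :: "'d functional" and q :: ereal and N :: real and j :: nat and x :: "real ^ 'd"
    assume T: "T \<in> tempered_distributions" and q: "0 < q" and N: "0 < N"
      and norm: "tlm_norm \<phi> ?s u p q T \<le> ennreal N"
    have [measurable]: "blk j T \<in> borel_measurable borel" "sup_fun ?s T \<in> borel_measurable borel"
      by (rule blk_measurable[OF T], rule sup_fun_measurable[OF T])
    show "norm (blk j T x) \<le> C * N"
    proof (rule bd[OF T N])
      fix k :: "int ^ 'd"
      let ?Q = "dyadic_cube (int j) k"
      define m where "m = (2::real) powr (- real j * CARD('d))"
      have mQ: "measure lebesgue ?Q = m" "emeasure lborel ?Q = ennreal m"
        by (simp_all add: measure_dyadic_cube emeasure_dyadic_cube m_def)
      have m: "0 < m" by (simp add: m_def)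
      let ?c = "N powr (e - p) * m powr (p / u)"
      have pt: "ennreal (norm (blk j T v) powr e) \<le> ennreal (N powr e) + ennreal ?c * enn_powr (sup_fun ?s T v) p" for v
      proof -
        let ?y = "norm (blk j T v)"
        have my: "m powr (p / u) * (2 powr (real j * ?s) * ?y) powr p = ?y powr p"
        proof -
          have "m powr (p / u) * (2 powr (real j * ?s)) powr p = 1"
            unfolding m_def powr_powr by (simp flip: powr_add add: field_simps)
          then show ?thesis by (simp add: powr_mult flip: mult.assoc)
        qed
        have "?y powr e \<le> N powr e + N powr (e - p) * ?y powr p"
          using N e by (intro powr_le_split) auto
        also have "\<dots> = N powr e + ?c * (2 powr (real j * ?s) * ?y) powr p"
          using my by (simp add: mult.assoc)
        finally have "ennreal (?y powr e) \<le> ennreal (N powr e) + ennreal ?c * ennreal ((2 powr (real j * ?s) * ?y) powr p)"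
          by (simp add: ennreal_leI flip: ennreal_plus ennreal_mult)
        also have "ennreal ((2 powr (real j * ?s) * ?y) powr p) = enn_powr (ennreal (2 powr (real j * ?s) * ?y)) p"
          by (simp add: enn_powr_ennreal)
        also have "ennreal (N powr e) + ennreal ?c * \<dots> \<le> ennreal (N powr e) + ennreal ?c * enn_powr (sup_fun ?s T v) p"
          using p by (intro add_left_mono mult_left_mono enn_powr_mono sup_fun_ge) auto
        finally show ?thesis .
      qed
      have "(\<integral>\<^sup>+v. ennreal (norm (blk j T v) powr e) * indicator ?Q v \<partial>lborel)
        \<le> (\<integral>\<^sup>+v. ennreal (N powr e) * indicator ?Q v + ennreal ?c * (enn_powr (sup_fun ?s T v) p * indicator ?Q v) \<partial>lborel)"
        using pt by (intro nn_integral_mono) (auto split: split_indicator)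
      also have "\<dots> = ennreal (N powr e) * ennreal m + ennreal ?c * (\<integral>\<^sup>+v. enn_powr (sup_fun ?s T v) p * indicator ?Q v \<partial>lborel)"
        by (subst nn_integral_add) (auto simp: nn_integral_cmult nn_integral_cmult_indicator mQ)
      also have "\<dots> \<le> ennreal (N powr e) * ennreal m + ennreal ?c * ennreal (N powr p * m powr (1 - p / u))"
        using sup_fun_integral_le[OF T q p u N norm, of "int j" k]
        by (intro add_left_mono mult_left_mono) (auto simp: mQ)
      also have "\<dots> = ennreal (N powr e * m + (N powr (e - p) * N powr p) * (m powr (p / u) * m powr (1 - p / u)))"
        using m by (simp add: mult_ac flip: ennreal_mult ennreal_plus)
      also have "N powr (e - p) * N powr p = N powr e" using N by (simp flip: powr_add)
      also have "m powr (p / u) * m powr (1 - p / u) = m" using m by (simp flip: powr_add)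
      finally show "(\<integral>\<^sup>+v. ennreal (norm (blk j T v) powr e) * indicator ?Q v \<partial>lborel)
          \<le> ennreal (2 * N powr e * 2 powr (- real j * CARD('d)))"
        by (simp add: m_def mult.assoc)
    qed
  qed
qed

text \<open>On the cube the p-th power of 2^(-Js) S / N has mean at most l^p, by the Morrey bound
  and the identity \<open>lm\<close>. With \<open>l\<close> as threshold, the two parts of the
  splitting are therefore of the same size.\<close>

lemma abs_sum_powr_integral_le:
  assumes p: "0 < p" and u: "0 < u" and r: "1 \<le> r"
  obtains c where "0 < c" and
    "\<And>T q N j k. T \<in> tempered_distributions \<Longrightarrow> 0 < q \<Longrightarrow> 0 < N \<Longrightarrow>
      tlm_norm \<phi> (real CARD('d) / u) u p q T \<le> ennreal N \<Longrightarrow>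
      (\<integral>\<^sup>+x. enn_powr (abs_sum T x) r * indicator (dyadic_cube j k) x \<partial>lborel)
        \<le> ennreal (measure lebesgue (dyadic_cube j k :: (real ^ 'd) set) *
           (c * (real (nat j) + 2 powr ((real_of_int j - real (nat j)) * (real CARD('d) / u) * min 1 (p / r))) * N) powr r)"
proof -
  let ?s = "real CARD('d) / u"
  define \<alpha> where "\<alpha> = min 1 (p / r)"
  have \<alpha>: "0 < \<alpha>" "\<alpha> \<le> 1" "\<alpha> * r \<le> p"
  proof -
    have "\<alpha> * r \<le> (p / r) * r" using r by (intro mult_right_mono) (auto simp: \<alpha>_def)
    then show "\<alpha> * r \<le> p" using r by simp
  qed (use p r in \<open>auto simp: \<alpha>_def\<close>)
  have s: "0 < ?s" using u by simp
  obtain C where C: "0 < C" and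
    bd: "\<And>T q N j x. T \<in> tempered_distributions \<Longrightarrow> 0 < q \<Longrightarrow> 0 < N \<Longrightarrow>
      tlm_norm \<phi> ?s u p q T \<le> ennreal N \<Longrightarrow> norm (blk j T x) \<le> C * N"
    by (rule blk_uniform_bound[OF p u]) blast
  define K where "K = C powr (1 - \<alpha>) / (1 - 2 powr (- (?s * \<alpha>)))"
  have "2 powr (- (?s * \<alpha>)) < 1" by (rule powr_less_one) (use mult_pos_pos[OF s \<alpha>(1)] in auto)
  with C have K: "0 < K" unfolding K_def by simp
  show ?thesis
  \<comment> \<open>6 = 2 * 3: the 2 comes from \<open>powr_add_le\<close>, the 3 from the three
    summands collected at the end, as 3 \<le> 3^r.\<close>
  proof (rule that[of "6 * (C + K)"])
    show "0 < 6 * (C + K)" using C K by simp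
    fix T :: "'d functional" and q :: ereal and N :: real and j :: int and k :: "int ^ 'd"
    assume T: "T \<in> tempered_distributions" and q: "0 < q" and N: "0 < N"
      and norm: "tlm_norm \<phi> ?s u p q T \<le> ennreal N"
    have [measurable]: "abs_sum T \<in> borel_measurable borel" "sup_fun ?s T \<in> borel_measurable borel"
      by (rule abs_sum_measurable[OF T], rule sup_fun_measurable[OF T])
    let ?Q = "dyadic_cube j k"
    define m where "m = (2::real) powr (- real_of_int j * CARD('d))"
    have mQ: "measure lebesgue ?Q = m" "emeasure lborel ?Q = ennreal m"
      by (simp_all add: measure_dyadic_cube emeasure_dyadic_cube m_def)
    have m: "0 < m" by (simp add: m_def)
    define J where "J = nat j"
    \<comment> \<open>Equal to 1 on cubes of side at most 1, where \<open>J = j\<close>, and to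
      |Q|^(-1/u) on larger ones, where \<open>J = 0\<close>.\<close>
    define l where "l = 2 powr ((real_of_int j - real J) * ?s)"
    have l: "0 < l" by (simp add: l_def)
    have lm: "2 powr (- (real J * ?s)) = l * m powr (1 / u)"
    proof -
      have "- (real J * ?s) = (real_of_int j - real J) * ?s + - real_of_int j * CARD('d) * (1 / u)"
        using u by (simp add: field_simps)
      then show ?thesis
        unfolding l_def m_def powr_powr powr_add[symmetric] by (rule arg_cong)
    qed
    define c1 where "c1 = (2 * N) powr r * ((C * real J) powr r + K powr r * l powr (\<alpha> * r))"
    define c2 where "c2 = (2 * N) powr r * K powr r * l powr (\<alpha> * r - p) * (2 powr (- (real J * ?s)) / N) powr p"
    have c: "0 \<le> c1" "0 < c2" using N K l by (simp_all add: c1_def c2_def)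
    have pt: "enn_powr (abs_sum T x) r \<le> ennreal c1 + ennreal c2 * enn_powr (sup_fun ?s T x) p" for x
    proof (cases "sup_fun ?s T x")
      case (real \<sigma>)
      have a\<sigma>: "norm (blk j T x) \<le> 2 powr (- (real j * ?s)) * \<sigma>" for j
      proof -
        have "2 powr (real j * ?s) * norm (blk j T x) \<le> \<sigma>"
          using sup_fun_ge[of j ?s T x] real by (simp add: ennreal_le_iff)
        then have "2 powr (- (real j * ?s)) * (2 powr (real j * ?s) * norm (blk j T x)) \<le> 2 powr (- (real j * ?s)) * \<sigma>"
          by (intro mult_left_mono) auto
        then show ?thesis by (simp flip: powr_add mult.assoc)
      qed
      note est1 = block_sum_powr_le(1)[OF s \<alpha>(1,2) real(1) C N norm_ge_zero bd[OF T q N norm] a\<sigma> r \<alpha>(3) l]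
      note est2 = block_sum_powr_le(2)[OF s \<alpha>(1,2) real(1) C N norm_ge_zero bd[OF T q N norm] a\<sigma> r \<alpha>(3) l,
          where J = J, folded K_def]
      have "abs_sum T x = ennreal (\<Sum>j. norm (blk j T x))"
        unfolding abs_sum_def by (rule suminf_ennreal2[OF norm_ge_zero est1])
      then have "enn_powr (abs_sum T x) r = ennreal ((\<Sum>j. norm (blk j T x)) powr r)"
        using suminf_nonneg[OF est1] by (simp add: enn_powr_ennreal)
      also have "\<dots> \<le> ennreal (c1 + c2 * \<sigma> powr p)"
        unfolding c1_def c2_def by (rule ennreal_leI[OF est2])
      also have "\<dots> = ennreal c1 + ennreal c2 * enn_powr (sup_fun ?s T x) p"
        using c real by (simp add: enn_powr_ennreal ennreal_mult)
      finally show ?thesis .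
    next
      case top
      \<comment> \<open>Positivity of \<open>c2\<close> makes the right-hand side infinite.\<close>
      then show ?thesis using c by (simp add: enn_powr_def ennreal_mult_top)
    qed
    have "(\<integral>\<^sup>+x. enn_powr (abs_sum T x) r * indicator ?Q x \<partial>lborel)
      \<le> (\<integral>\<^sup>+x. ennreal c1 * indicator ?Q x + ennreal c2 * (enn_powr (sup_fun ?s T x) p * indicator ?Q x) \<partial>lborel)"
      using pt by (intro nn_integral_mono) (auto split: split_indicator)
    also have "\<dots> = ennreal c1 * ennreal m + ennreal c2 * (\<integral>\<^sup>+x. enn_powr (sup_fun ?s T x) p * indicator ?Q x \<partial>lborel)"
      by (subst nn_integral_add) (auto simp: nn_integral_cmult nn_integral_cmult_indicator mQ)
    also have "\<dots> \<le> ennreal c1 * ennreal m + ennreal c2 * ennreal (N powr p * m powr (1 - p / u))"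
      using sup_fun_integral_le[OF T q p u N norm, of j k] by (intro add_left_mono mult_left_mono) (auto simp: mQ)
    also have "\<dots> = ennreal (c1 * m + c2 * (N powr p * m powr (1 - p / u)))"
      using c m by (simp flip: ennreal_mult ennreal_plus)
    \<comment> \<open>All powers of \<open>N\<close> from the splitting and of |Q| other than the
      first cancel, and the term repeats the second summand of \<open>c1 * m\<close>.\<close>
    also have "c2 * (N powr p * m powr (1 - p / u)) = (2 * N) powr r * K powr r * l powr (\<alpha> * r) * m"
    proof -
      have "(l * m powr (1 / u) / N) powr p = l powr p * m powr (p / u) / N powr p"
        by (simp add: powr_mult powr_divide powr_powr)
      moreover have "l powr (\<alpha> * r - p) * l powr p = l powr (\<alpha> * r)" using l by (simp flip: powr_add)
      moreover have "m powr (p / u) * m powr (1 - p / u) = m" using m by (simp flip: powr_add)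
      moreover have "A * B * L1 * (L * M1 / n) * (n * M2) = A * B * (L1 * L) * (M1 * M2)"
        if "n \<noteq> 0" for A B L1 L M1 M2 n :: real
        using that by (simp add: field_simps)
      ultimately show ?thesis
        unfolding c2_def lm using N by simp
    qed
    also have "c1 * m + (2 * N) powr r * K powr r * l powr (\<alpha> * r) * m
        = m * ((2 * N) powr r * ((C * real J) powr r + 2 * (K * l powr \<alpha>) powr r))"
      by (simp add: c1_def powr_mult powr_powr algebra_simps)
    also have "\<dots> \<le> m * (6 * (C + K) * (real J + l powr \<alpha>) * N) powr r"
    proof -
      let ?Y = "(C + K) * (real J + l powr \<alpha>)"
      have Y: "C * real J \<le> ?Y" "K * l powr \<alpha> \<le> ?Y"
        using C K by (simp_all add: algebra_simps add_increasing)
      have "(C * real J) powr r + 2 * (K * l powr \<alpha>) powr r \<le> ?Y powr r + 2 * ?Y powr r"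
        using Y C K r by (intro add_mono mult_left_mono powr_mono2) auto
      also have "\<dots> \<le> 3 powr r * ?Y powr r"
        using r powr_mono[of 1 r 3] by (simp add: mult_right_mono)
      finally have "(2 * N) powr r * ((C * real J) powr r + 2 * (K * l powr \<alpha>) powr r) \<le> (2 * N) powr r * (3 powr r * ?Y powr r)"
        by (rule mult_left_mono) simp
      also have "\<dots> = ((2 * N) * (3 * ?Y)) powr r" by (simp only: powr_mult)
      also have "(2 * N) * (3 * ?Y) = 6 * (C + K) * (real J + l powr \<alpha>) * N" by simp
      finally show ?thesis using m by (intro mult_left_mono) auto
    qed
    also have "l powr \<alpha> = 2 powr ((real_of_int j - real (nat j)) * ?s * min 1 (p / r))"
      by (simp add: l_def J_def \<alpha>_def powr_powr)
    finally show "(\<integral>\<^sup>+x. enn_powr (abs_sum T x) r * indicator ?Q x \<partial>lborel)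
        \<le> ennreal (measure lebesgue ?Q *
           (6 * (C + K) * (real (nat j) + 2 powr ((real_of_int j - real (nat j)) * ?s * min 1 (p / r))) * N) powr r)"
      by (simp add: mQ J_def ennreal_leI)
  qed
qed

end

lemma enn_powr_1 [simp]: "enn_powr x 1 = x"
  by (cases x) (auto simp: enn_powr_def)

lemma enn_powr_inverse: "0 \<le> t \<Longrightarrow> 0 < r \<Longrightarrow> enn_powr (ennreal (t powr r)) (1 / r) = ennreal t"
  by (simp add: enn_powr_ennreal powr_powr)

section \<open>The block series as density of the distribution\<close>

context littlewood_paley
begin

text \<open>Where the series diverges the value is of no meaning; for distributions of finite norm
  these points form a null set.\<close>

definition series :: "'d functional \<Rightarrow> real ^ 'd \<Rightarrow> complex" where
  "series T x = (\<Sum>j. blk j T x)"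

lemma abs_sum_finiteD:
  assumes "abs_sum T x \<noteq> \<infinity>"
  shows "summable (\<lambda>j. norm (blk j T x))" "abs_sum T x = ennreal (\<Sum>j. norm (blk j T x))"
proof -
  show "summable (\<lambda>j. norm (blk j T x))"
    using assms unfolding abs_sum_def by (intro summable_suminf_not_top) auto
  then show "abs_sum T x = ennreal (\<Sum>j. norm (blk j T x))"
    unfolding abs_sum_def by (intro suminf_ennreal2) auto
qed

lemma norm_series_le: "ennreal (norm (series T x)) \<le> abs_sum T x"
proof (cases "abs_sum T x = \<infinity>")
  case False
  note s = abs_sum_finiteD[OF False]
  show ?thesis
    unfolding s(2) series_def by (intro ennreal_leI summable_norm s(1))
qed simp

lemma series_measurable: "T \<in> tempered_distributions \<Longrightarrow> series T \<in> borel_measurable borel"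
  unfolding series_def[abs_def] using blk_measurable by measurable

text \<open>The cube estimate with r = 1 bounds the integral over all unit cubes by one constant.
  Integrating against the summable weight turns this into a single finite integral over the whole
  space, from which both claims follow.\<close>

lemma abs_sum_integral_finite:
  assumes T: "T \<in> tempered_distributions" and p: "0 < p" and u: "0 < u" and q: "0 < q"
    and norm: "tlm_norm \<phi> (real CARD('d) / u) u p q T < \<infinity>"
  shows "AE x in lborel. abs_sum T x \<noteq> \<infinity>"
    and "(\<integral>\<^sup>+x. abs_sum T x * indicator (cball 0 R) x \<partial>lborel) < \<infinity>"
proof -
  let ?D = "2 * CARD('d)"
  let ?w = "\<lambda>x::real^'d. ennreal (inverse ((1 + norm (x - 0)) ^ ?D))"
  have [measurable]: "abs_sum T \<in> borel_measurable borel" by (rule abs_sum_measurable[OF T])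
  obtain N where N: "0 < N" "tlm_norm \<phi> (real CARD('d) / u) u p q T \<le> ennreal N"
  proof -
    \<comment> \<open>The norm may vanish, whereas the estimates ask for a positive bound; hence the
      added 1.\<close>
    have "tlm_norm \<phi> (real CARD('d) / u) u p q T = ennreal (enn2real (tlm_norm \<phi> (real CARD('d) / u) u p q T))"
      using norm by (simp add: less_top)
    also have "\<dots> \<le> ennreal (enn2real (tlm_norm \<phi> (real CARD('d) / u) u p q T) + 1)"
      by (intro ennreal_leI) simp
    finally show ?thesis by (rule that[rotated]) (simp add: add_nonneg_pos)
  qed
  obtain B where B: "\<And>k. (\<integral>\<^sup>+x. abs_sum T x * indicator (dyadic_cube 0 k) x \<partial>lborel) \<le> ennreal B"
  proof -
    obtain c where
      "\<And>T q N j k. T \<in> tempered_distributions \<Longrightarrow> 0 < q \<Longrightarrow> 0 < N \<Longrightarrow>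
      tlm_norm \<phi> (real CARD('d) / u) u p q T \<le> ennreal N \<Longrightarrow>
      (\<integral>\<^sup>+x. enn_powr (abs_sum T x) 1 * indicator (dyadic_cube j k) x \<partial>lborel)
        \<le> ennreal (measure lebesgue (dyadic_cube j k :: (real ^ 'd) set) *
           (c * (real (nat j) + 2 powr ((real_of_int j - real (nat j)) * (real CARD('d) / u) * min 1 (p / 1))) * N) powr 1)"
      by (rule abs_sum_powr_integral_le[OF p u order_refl]) blast
    from this[OF T q N, of 0] show ?thesis
      by (intro that) (auto simp: measure_dyadic_cube)
  qed
  have "(\<integral>\<^sup>+x. abs_sum T x * ?w x \<partial>lborel) \<le> ennreal ((1 + real CARD('d)) ^ ?D) * ennreal B * ennreal (weight_integral TYPE('d) ?D)"
    using weighted_integral_le[OF _ B, of 0 ?D] unfolding weight_integral_finite by simp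
  also have "\<dots> < \<infinity>" by (simp add: ennreal_mult_less_top)
  finally have fin: "(\<integral>\<^sup>+x. abs_sum T x * ?w x \<partial>lborel) < \<infinity>" .
  have wpos: "0 < inverse ((1 + norm (x - 0)) ^ ?D)" for x :: "real ^ 'd"
    by (simp add: add_pos_nonneg)
  have "AE x in lborel. abs_sum T x * ?w x \<noteq> \<infinity>"
    using fin by (intro nn_integral_PInf_AE) auto
  then show "AE x in lborel. abs_sum T x \<noteq> \<infinity>"
  proof eventually_elim
    case (elim x)
    have "ennreal (inverse ((1 + norm (x - 0)) ^ ?D)) \<noteq> 0" using wpos[of x] by (metis ennreal_eq_0_iff not_le)
    with elim show ?case by (auto simp: ennreal_mult_eq_top_iff)
  qed
  have "abs_sum T x * indicator (cball 0 R) x \<le> ennreal ((1 + \<bar>R\<bar>) ^ ?D) * (abs_sum T x * ?w x)" for x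
  proof (cases "norm x \<le> R")
    case True
    then have "(1 + norm x) ^ ?D \<le> (1 + \<bar>R\<bar>) ^ ?D" by (intro power_mono) auto
    moreover have "0 < (1 + norm x) ^ ?D" by (simp add: add_pos_nonneg)
    ultimately have "1 \<le> (1 + \<bar>R\<bar>) ^ ?D * inverse ((1 + norm (x - 0)) ^ ?D)"
      by (simp add: field_simps)
    then have "ennreal 1 \<le> ennreal ((1 + \<bar>R\<bar>) ^ ?D) * ?w x"
      by (subst ennreal_mult[symmetric]) (auto intro: ennreal_leI)
    from mult_left_mono[OF this, of "abs_sum T x"] True show ?thesis by (simp add: mult_ac)
  qed simp
  then have "(\<integral>\<^sup>+x. abs_sum T x * indicator (cball 0 R) x \<partial>lborel) \<le> (\<integral>\<^sup>+x. ennreal ((1 + \<bar>R\<bar>) ^ ?D) * (abs_sum T x * ?w x) \<partial>lborel)"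
    by (rule nn_integral_mono)
  also have "\<dots> = ennreal ((1 + \<bar>R\<bar>) ^ ?D) * (\<integral>\<^sup>+x. abs_sum T x * ?w x \<partial>lborel)"
    by (rule nn_integral_cmult) auto
  also have "\<dots> < \<infinity>" using fin by (simp add: ennreal_mult_less_top)
  finally show "(\<integral>\<^sup>+x. abs_sum T x * indicator (cball 0 R) x \<partial>lborel) < \<infinity>" .
qed

text \<open>The partial sums tend to \<open>T\<close> on test functions, and by dominated
  convergence with majorant |\<psi>| \<open>abs_sum T\<close> their pairings also tend to that of
  the pointwise sum.\<close>

theorem series_represents:
  assumes T: "T \<in> tempered_distributions" and p: "0 < p" and u: "0 < u" and q: "0 < q"
    and norm: "tlm_norm \<phi> (real CARD('d) / u) u p q T < \<infinity>"
  shows "represents (series T) T"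
  unfolding represents_def
proof (intro conjI ballI)
  note fin = abs_sum_integral_finite[OF T p u q norm]
  have [measurable]: "series T \<in> borel_measurable borel" "abs_sum T \<in> borel_measurable borel"
    "\<And>j. blk j T \<in> borel_measurable borel"
    by (rule series_measurable[OF T], rule abs_sum_measurable[OF T], rule blk_measurable[OF T])
  show "locally_integrable (series T)"
    unfolding locally_integrable_def
  proof (intro allI impI)
    fix K :: "(real ^ 'd) set" assume K: "compact K"
    then have "bounded K" by (rule compact_imp_bounded)
    then obtain R where "\<And>x. x \<in> K \<Longrightarrow> norm x \<le> R" by (auto simp: bounded_iff)
    then have R: "K \<subseteq> cball 0 R" by auto
    have meas: "(\<lambda>x. indicator (cball 0 R) x *\<^sub>R series T x) \<in> borel_measurable lborel"
      using series_measurable[OF T] by (intro borel_measurable_scaleR borel_measurable_indicator) auto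
    have "integrable lborel (\<lambda>x. indicator (cball 0 R) x *\<^sub>R series T x)"
    proof (rule integrableI_bounded)
      have "(\<integral>\<^sup>+x. ennreal (norm (indicator (cball 0 R) x *\<^sub>R series T x)) \<partial>lborel)
         \<le> (\<integral>\<^sup>+x. abs_sum T x * indicator (cball 0 R) x \<partial>lborel)"
        by (intro nn_integral_mono) (auto split: split_indicator intro: norm_series_le)
      also have "\<dots> < \<infinity>" by (rule fin)
      finally show "(\<integral>\<^sup>+x. ennreal (norm (indicator (cball 0 R) x *\<^sub>R series T x)) \<partial>lborel) < \<infinity>" .
    qed (rule meas)
    then have "series T absolutely_integrable_on cball 0 R"
      unfolding set_integrable_def by (simp add: integrable_completion[OF meas])
    then show "series T absolutely_integrable_on K"
      by (rule set_integrable_subset[OF _ fmeasurableD[OF lmeasurable_compact[OF K]] R])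
  qed
  fix \<psi> :: "real ^ 'd \<Rightarrow> complex" assume \<psi>: "\<psi> \<in> test_functions"
  have [measurable]: "\<psi> \<in> borel_measurable borel" by (rule test_measurable[OF \<psi>])
  obtain R where R: "\<And>x. R < norm x \<Longrightarrow> \<psi> x = 0" using test_support[OF \<psi>] by blast
  obtain B where B: "\<And>x. norm (\<psi> x) \<le> B"
    using bsmoothD(2)[OF schwartz_bsmooth[OF test_schwartz[OF \<psi>]], of "[]"] by auto
  have "(\<lambda>m. \<integral>x. \<psi> x * (\<Sum>j\<le>m. blk j T x) \<partial>lborel) \<longlonglongrightarrow> (\<integral>x. \<psi> x * series T x \<partial>lborel)"
  proof (rule integral_dominated_convergence)
    \<comment> \<open>A real majorant is required; \<open>enn2real\<close> changes
      \<open>abs_sum\<close> only on the null set where it is infinite.\<close>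
    show "integrable lborel (\<lambda>x. norm (\<psi> x) * enn2real (abs_sum T x))"
    proof (rule integrableI_bounded)
      have "(\<integral>\<^sup>+x. ennreal (norm (norm (\<psi> x) * enn2real (abs_sum T x))) \<partial>lborel)
        \<le> (\<integral>\<^sup>+x. ennreal \<bar>B\<bar> * (abs_sum T x * indicator (cball 0 R) x) \<partial>lborel)"
      proof (rule nn_integral_mono)
        fix x
        show "ennreal (norm (norm (\<psi> x) * enn2real (abs_sum T x))) \<le> ennreal \<bar>B\<bar> * (abs_sum T x * indicator (cball 0 R) x)"
        proof (cases "norm x \<le> R")
          case True
          have "ennreal (norm (norm (\<psi> x) * enn2real (abs_sum T x))) = ennreal (norm (\<psi> x)) * ennreal (enn2real (abs_sum T x))"
            by (simp add: ennreal_mult)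
          also have "\<dots> \<le> ennreal \<bar>B\<bar> * abs_sum T x"
            using B[of x] by (intro mult_mono ennreal_leI) (auto simp: ennreal_enn2real_if)
          finally show ?thesis using True by simp
        qed (use R in simp)
      qed
      also have "\<dots> = ennreal \<bar>B\<bar> * (\<integral>\<^sup>+x. abs_sum T x * indicator (cball 0 R) x \<partial>lborel)"
        using abs_sum_measurable[OF T]
        by (intro nn_integral_cmult borel_measurable_times_ennreal borel_measurable_indicator) auto
      also have "\<dots> < \<infinity>" using fin(2) by (simp add: ennreal_mult_less_top)
      finally show "(\<integral>\<^sup>+x. ennreal (norm (norm (\<psi> x) * enn2real (abs_sum T x))) \<partial>lborel) < \<infinity>" .
    qed measurable
    show "AE x in lborel. (\<lambda>m. \<psi> x * (\<Sum>j\<le>m. blk j T x)) \<longlonglongrightarrow> \<psi> x * series T x"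
      using fin(1)
    proof eventually_elim
      case (elim x)
      have "summable (\<lambda>j. blk j T x)" by (rule summable_norm_cancel[OF abs_sum_finiteD(1)[OF elim]])
      from summable_LIMSEQ'[OF this] show ?case
        unfolding series_def by (intro tendsto_mult tendsto_const)
    qed
    show "AE x in lborel. norm (\<psi> x * (\<Sum>j\<le>m. blk j T x)) \<le> norm (\<psi> x) * enn2real (abs_sum T x)" for m
      using fin(1)
    proof eventually_elim
      case (elim x)
      note s = abs_sum_finiteD[OF elim]
      have "norm (\<Sum>j\<le>m. blk j T x) \<le> (\<Sum>j\<le>m. norm (blk j T x))" by (rule norm_sum)
      also have "\<dots> \<le> (\<Sum>j. norm (blk j T x))" by (rule sum_le_suminf[OF s(1)]) auto
      also have "\<dots> = enn2real (abs_sum T x)" using s by (simp add: suminf_nonneg)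
      finally show ?case by (simp add: norm_mult mult_left_mono)
    qed
  qed measurable
  then have "T \<psi> = (\<integral>x. \<psi> x * series T x \<partial>lborel)"
    using LIMSEQ_unique partial_sums_tendsto[OF T \<psi>] by blast
  also have "\<dots> = (\<integral>x. series T x * \<psi> x \<partial>lborel)" by (simp only: mult.commute)
  also have "\<dots> = (\<integral>x. series T x * \<psi> x \<partial>lebesgue)"
    by (rule integral_completion[symmetric]) measurable
  finally show "T \<psi> = (\<integral>x. series T x * \<psi> x \<partial>lebesgue)" .
qed

end

text \<open>Here \<open>m\<close> is the volume of a cube of level \<open>j\<close>. If j \<ge> 0,
  then m \<le> 1, so the power of 1 + m is bounded below, and j ln 2 \<le> ln(1/m). If j < 0, then 1
  + m \<le> 2m, and the power of 2 on the left is m^(-\<alpha>/u). The summand e keeps the logarithm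
  at least 1.\<close>

lemma log_factor_bound:
  fixes j :: int and u \<alpha> :: real and d :: nat
  assumes d: "0 < d" and u: "0 < u" and \<alpha>: "0 < \<alpha>"
  defines "m \<equiv> 2 powr (- real_of_int j * d)"
  shows "real (nat j) + 2 powr ((real_of_int j - real (nat j)) * (d / u) * \<alpha>)
     \<le> (2 powr (\<alpha> / u) * (1 / ln 2 + 1)) * ((1 + m) powr (- \<alpha> / u) * ln (exp 1 + inverse m))"
proof -
  have m: "0 < m" by (simp add: m_def)
  have ln1: "1 \<le> ln (exp 1 + inverse m)"
    using m by (subst ln_ge_iff) (auto intro: add_pos_pos)
  have l2: "0 < ln (2::real)" by simp
  show ?thesis
  proof (cases "0 \<le> j")
    case True
    have "m \<le> 2 powr 0" unfolding m_def using True by (intro powr_mono) auto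
    then have "m \<le> 1" by simp
    then have "2 powr (- \<alpha> / u) \<le> (1 + m) powr (- \<alpha> / u)"
      using m \<alpha> u by (intro powr_mono2') (auto simp: divide_nonpos_pos)
    then have A: "2 powr (\<alpha> / u) * 2 powr (- \<alpha> / u) \<le> 2 powr (\<alpha> / u) * (1 + m) powr (- \<alpha> / u)"
      by (intro mult_left_mono) auto
    have A1: "1 \<le> 2 powr (\<alpha> / u) * (1 + m) powr (- \<alpha> / u)"
      using A by (simp flip: powr_add)
    have "real_of_int j * ln 2 \<le> real_of_int j * real d * ln 2"
      using True d l2 by (intro mult_right_mono) (auto simp: mult_le_cancel_left1)
    also have "\<dots> = ln (inverse m)" by (simp add: m_def ln_powr ln_inverse)
    also have "\<dots> \<le> ln (exp 1 + inverse m)" using m by (subst ln_le_cancel_iff) (auto intro: add_pos_pos)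
    finally have "real_of_int j \<le> 1 / ln 2 * ln (exp 1 + inverse m)" using l2 by (simp add: field_simps)
    then have "real_of_int j + 1 \<le> (1 / ln 2 + 1) * ln (exp 1 + inverse m)"
      using ln1 by (simp add: distrib_right)
    also have "\<dots> \<le> (2 powr (\<alpha> / u) * (1 + m) powr (- \<alpha> / u)) * ((1 / ln 2 + 1) * ln (exp 1 + inverse m))"
      using mult_right_mono[OF A1, of "(1 / ln 2 + 1) * ln (exp 1 + inverse m)"] ln1 l2 by simp
    finally show ?thesis using True by (simp add: mult_ac)
  next
    case False
    have "2 powr 0 \<le> m" unfolding m_def using False by (intro powr_mono) (auto simp: mult_nonpos_nonneg)
    then have "1 \<le> m" by simp
    then have "(2 * m) powr (- \<alpha> / u) \<le> (1 + m) powr (- \<alpha> / u)"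
      using \<alpha> u by (intro powr_mono2') (auto simp: divide_nonpos_pos)
    then have A: "2 powr (\<alpha> / u) * (2 * m) powr (- \<alpha> / u) \<le> 2 powr (\<alpha> / u) * (1 + m) powr (- \<alpha> / u)"
      by (intro mult_left_mono) auto
    have "2 powr (\<alpha> / u) * (2 * m) powr (- \<alpha> / u) = (2 powr (\<alpha> / u) * 2 powr (- \<alpha> / u)) * m powr (- \<alpha> / u)"
      by (simp add: powr_mult)
    also have "\<dots> = 2 powr (real_of_int j * (d / u) * \<alpha>)"
      by (simp add: m_def powr_powr flip: powr_add)
    finally have "2 powr (real_of_int j * (d / u) * \<alpha>) \<le> 2 powr (\<alpha> / u) * (1 + m) powr (- \<alpha> / u)" using A by simp
    also have "\<dots> * 1 \<le> (2 powr (\<alpha> / u) * (1 + m) powr (- \<alpha> / u)) * ((1 / ln 2 + 1) * ln (exp 1 + inverse m))"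
    proof (rule mult_left_mono)
      have "1 * 1 \<le> (1 / ln 2 + 1) * ln (exp 1 + inverse m)"
        using ln1 l2 by (intro mult_mono) auto
      then show "1 \<le> (1 / ln 2 + 1) * ln (exp 1 + inverse m)" by simp
    qed auto
    finally show ?thesis using False by (simp add: mult_ac)
  qed
qed

theorem corollary4p12:
  fixes \<phi> :: "real ^ 'd::finite \<Rightarrow> complex" and p u r :: real and q :: ereal
  assumes "resolution_generator \<phi>"
    and "0 < p" and "p \<le> u" and "0 < q" and "1 \<le> r"
  shows "(\<forall>T \<in> tlm_space \<phi> (real CARD('d) / u) u p q. \<exists>f. represents f T) \<and>
    (\<exists>c>0. \<forall>Q \<in> dyadic_cubes. \<forall>T \<in> tlm_space \<phi> (real CARD('d) / u) u p q. \<forall>f. represents f T \<longrightarrow>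
       enn_powr (ennreal (1 / measure lebesgue Q) * (\<integral>\<^sup>+x\<in>Q. ennreal (norm (f x) powr r) \<partial>lebesgue)) (1 / r)
       \<le> ennreal (c * (1 + measure lebesgue Q) powr (- min 1 (p / r) / u) *
                  ln (exp 1 + inverse (measure lebesgue Q))) *
         tlm_norm \<phi> (real CARD('d) / u) u p q T)"
proof -
  interpret littlewood_paley \<phi> by unfold_locales (rule assms(1))
  note p = assms(2) and q = assms(4) and r = assms(5)
  have u: "0 < u" using assms(2,3) by simp
  let ?s = "real CARD('d) / u"
  let ?\<alpha> = "min 1 (p / r)"
  have \<alpha>: "0 < ?\<alpha>" using p r by simp
  have T: "T \<in> tempered_distributions" "tlm_norm \<phi> ?s u p q T < \<infinity>" if "T \<in> tlm_space \<phi> ?s u p q" for T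
    using that by (auto simp: tlm_space_def)
  have rep: "represents (series T) T" if "T \<in> tlm_space \<phi> ?s u p q" for T
    by (rule series_represents[OF T(1)[OF that] p u q T(2)[OF that]])
  obtain c where c: "0 < c" and
    est: "\<And>T q N j k. T \<in> tempered_distributions \<Longrightarrow> 0 < q \<Longrightarrow> 0 < N \<Longrightarrow>
      tlm_norm \<phi> ?s u p q T \<le> ennreal N \<Longrightarrow>
      (\<integral>\<^sup>+x. enn_powr (abs_sum T x) r * indicator (dyadic_cube j k) x \<partial>lborel)
        \<le> ennreal (measure lebesgue (dyadic_cube j k :: (real ^ 'd) set) *
           (c * (real (nat j) + 2 powr ((real_of_int j - real (nat j)) * ?s * ?\<alpha>)) * N) powr r)"
    by (rule abs_sum_powr_integral_le[OF p u r]) blast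
  define c' where "c' = c * (2 powr (?\<alpha> / u) * (1 / ln 2 + 1))"
  have c': "0 < c'" using c by (simp add: c'_def add_pos_pos)
  have main: "enn_powr (ennreal (1 / measure lebesgue Q) * (\<integral>\<^sup>+x\<in>Q. ennreal (norm (f x) powr r) \<partial>lebesgue)) (1 / r)
       \<le> ennreal (c' * (1 + measure lebesgue Q) powr (- ?\<alpha> / u) * ln (exp 1 + inverse (measure lebesgue Q))) *
         tlm_norm \<phi> ?s u p q T"
    if Q: "Q \<in> dyadic_cubes" and TS: "T \<in> tlm_space \<phi> ?s u p q" and f: "represents f T" for Q T f
  proof -
    obtain j k where Q: "Q = dyadic_cube j k" using Q by (auto simp: dyadic_cubes_def)
    define m where "m = measure lebesgue Q"
    have m: "m = 2 powr (- real_of_int j * CARD('d))" "0 < m" by (simp_all add: m_def Q measure_dyadic_cube)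
    define X where "X = c' * (1 + m) powr (- ?\<alpha> / u) * ln (exp 1 + inverse m)"
    have "1 \<le> ln (exp 1 + inverse m)" using m by (subst ln_ge_iff) (auto intro: add_pos_pos)
    moreover have "0 < (1 + m) powr (- ?\<alpha> / u)" using m(2) by simp
    ultimately have X: "0 < X" unfolding X_def using c' by simp
    define Y where "Y = real (nat j) + 2 powr ((real_of_int j - real (nat j)) * ?s * ?\<alpha>)"
    have Y0: "0 \<le> Y" by (simp add: Y_def)
    have "c * Y \<le> X"
      using mult_left_mono[OF log_factor_bound[OF _ u \<alpha>, of "CARD('d)" j] less_imp_le[OF c]]
      by (simp add: Y_def X_def c'_def m mult.assoc)
    define L where "L = enn_powr (ennreal (1 / m) * (\<integral>\<^sup>+x\<in>Q. ennreal (norm (f x) powr r) \<partial>lebesgue)) (1 / r)"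
    have bound: "L \<le> ennreal (X * N)" if N: "0 < N" "tlm_norm \<phi> ?s u p q T \<le> ennreal N" for N
    proof -
      \<comment> \<open>Uniqueness of densities makes the bound for the series valid for every
        representing function.\<close>
      have ae: "AE x in lebesgue. f x = series T x"
        by (rule represents_unique[OF generator f rep[OF TS]])
      have pt: "ennreal (norm (series T x) powr r) \<le> enn_powr (abs_sum T x) r" for x
        using enn_powr_mono[OF norm_series_le[of T x], of r] r by (simp add: enn_powr_ennreal)
      have "(\<integral>\<^sup>+x\<in>Q. ennreal (norm (f x) powr r) \<partial>lebesgue) \<le> (\<integral>\<^sup>+x\<in>Q. enn_powr (abs_sum T x) r \<partial>lebesgue)"
        using ae by (intro nn_integral_mono_AE, eventually_elim) (auto intro: mult_right_mono pt)
      also have "\<dots> = (\<integral>\<^sup>+x. enn_powr (abs_sum T x) r * indicator Q x \<partial>lborel)"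
        by (rule nn_integral_completion)
      also have "\<dots> \<le> ennreal (m * (c * Y * N) powr r)"
        using est[OF T(1)[OF TS] q N, of j k] by (simp add: m_def Q Y_def)
      finally have "ennreal (1 / m) * (\<integral>\<^sup>+x\<in>Q. ennreal (norm (f x) powr r) \<partial>lebesgue)
          \<le> ennreal (1 / m) * ennreal (m * (c * Y * N) powr r)"
        by (rule mult_left_mono) simp
      also have "\<dots> = ennreal ((c * Y * N) powr r)" using m by (simp flip: ennreal_mult)
      finally have "L \<le> enn_powr (ennreal ((c * Y * N) powr r)) (1 / r)"
        unfolding L_def using r by (intro enn_powr_mono) auto
      also have "\<dots> = ennreal (c * Y * N)" using r c Y0 N by (intro enn_powr_inverse) auto
      also have "\<dots> \<le> ennreal (X * N)" using \<open>c * Y \<le> X\<close> N by (intro ennreal_leI mult_right_mono) auto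
      finally show ?thesis .
    qed
    obtain n where n: "tlm_norm \<phi> ?s u p q T = ennreal n" "0 \<le> n"
      using T(2)[OF TS] by (cases "tlm_norm \<phi> ?s u p q T") auto
    \<comment> \<open>\<open>bound\<close> needs a positive \<open>N\<close>, but \<open>n\<close>
      may be 0. It is applied to \<open>n + e / X\<close>, so that the error is exactly
      \<open>e\<close>.\<close>
    have "L \<le> ennreal (X * n)"
    proof (rule ennreal_le_epsilon)
      fix e :: real assume e: "0 < e"
      have "L \<le> ennreal (X * (n + e / X))"
        using n X e by (intro bound) (auto intro: add_nonneg_pos ennreal_leI)
      also have "\<dots> = ennreal (X * n) + ennreal e" using X e n by (simp add: distrib_left flip: ennreal_plus)
      finally show "L \<le> ennreal (X * n) + ennreal e" .
    qed
    also have "\<dots> = ennreal X * tlm_norm \<phi> ?s u p q T" using X n by (simp add: ennreal_mult)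
    finally show ?thesis by (simp add: L_def X_def m_def)
  qed
  with rep c' show ?thesis by blast
qed

end
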